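(* Let $1<p<+\infty$, $c_0,c_1\in(-1,1)$, and let $a\in L^\infty(\mathbb{R}_+\times(0,1))$ be non-negative. Then there exist positive constants $C,\gamma$ depending only on $p$, $c_0$, $c_1$, and $\|a\|_{L^\infty(\mathbb{R}_+\times(0,1))}$ such that for all $\rho_0,\xi_0\in L^p(0,1)$ the unique (broad) solution $(\rho,\xi)$ of $$\begin{cases}\rho_t-\rho_x=-\tfrac12 a(t,x)(\rho-\xi) & \text{in }\mathbb{R}_+\times(0,1),\\ \xi_t+\xi_x=\tfrac12 a(t,x)(\rho-\xi) & \text{in }\mathbb{R}_+\times(0,1),\\ \xi(t,0)=c_0\,\rho(t,0),\quad \rho(t,1)=c_1\,\xi(t,1) & \text{in }\mathbb{R}_+,\end{cases}$$ with the initial condition $\rho(0,\cdot)=\rho_0$ and $\xi(0,\cdot)=\xi_0$ satisfies $$\|(\rho,\xi)(t,\cdot)\|_{L^p(0,1)}\le C e^{-\gamma t}\,\|(\rho_0,\xi_0)\|_{L^p(0,1)},\qquad t\ge 0.$$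
   Context: $\mathbb{R}_+=(0,+\infty)$, and $\|(f,g)\|_{L^p(0,1)}^p=\int_0^1(|f|^p+|g|^p)\,dx$. Broad solution: for $T>0$, a broad solution on $(0,T)$ of the system is a pair $(\rho,\xi)\in C([0,T];[L^p(0,1)]^2)\cap C([0,1];[L^p(0,T)]^2)$ that obeys the characteristic rules, i.e. with $F=-\tfrac12a(\rho-\xi)$ and $G=\tfrac12a(\rho-\xi)$, for a.e. $(t,x)\in(0,T)\times(0,1)$: $\rho(t,x)=\rho_0(x+t)+\int_0^tF(s,x+t-s)\,ds$ if $x+t<1$, and $\rho(t,x)=\rho(t+x-1,1)+\int_{t+x-1}^tF(s,x+t-s)\,ds$ if $x+t>1$; $\xi(t,x)=\xi_0(x-t)+\int_0^tG(s,x-t+s)\,ds$ if $x>t$, and $\xi(t,x)=\xi(t-x,0)+\int_{t-x}^tG(s,x-t+s)\,ds$ if $x<t$; and the boundary conditions $\xi(\cdot,0)=c_0\rho(\cdot,0)$, $\rho(\cdot,1)=c_1\xi(\cdot,1)$ hold a.e. in $(0,T)$. A solution on $\mathbb{R}_+$ is one whose restriction to $(0,T)$ is a broad solution for every $T>0$. *)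

theory Defs
  imports "HOL-Analysis.Analysis" "HOL-Probability.Essential_Supremum"
begin

text \<open>
  Elements of Lebesgue spaces are represented by Lebesgue-measurable functions, with equality
  almost everywhere expressed explicitly. The real exponent \<open>p\<close> is always assumed to be \<open>> 1\<close>, so
  that \<open>0 powr p = 0\<close> is the intended value.
\<close>

definition Lp_space :: "real \<Rightarrow> 'a::euclidean_space set \<Rightarrow> ('a \<Rightarrow> real) set" where
  "Lp_space p S = {f. f \<in> borel_measurable (lebesgue_on S) \<and>
                      integrable (lebesgue_on S) (\<lambda>x. \<bar>f x\<bar> powr p)}"

definition Lp_norm :: "real \<Rightarrow> 'a::euclidean_space set \<Rightarrow> ('a \<Rightarrow> real) \<Rightarrow> real" where
  "Lp_norm p S f = (LINT x|lebesgue_on S. \<bar>f x\<bar> powr p) powr (1 / p)"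

definition Lp_norm_pair ::
  "real \<Rightarrow> 'a::euclidean_space set \<Rightarrow> ('a \<Rightarrow> real) \<Rightarrow> ('a \<Rightarrow> real) \<Rightarrow> real" where
  "Lp_norm_pair p S f g =
     (LINT x|lebesgue_on S. \<bar>f x\<bar> powr p + \<bar>g x\<bar> powr p) powr (1 / p)"

definition Linf_norm :: "'a::euclidean_space set \<Rightarrow> ('a \<Rightarrow> real) \<Rightarrow> ereal" where
  "Linf_norm S f = esssup (lebesgue_on S) (\<lambda>x. ereal \<bar>f x\<bar>)"

definition Linf_space :: "'a::euclidean_space set \<Rightarrow> ('a \<Rightarrow> real) set" where
  "Linf_space S = {f. f \<in> borel_measurable (lebesgue_on S) \<and> Linf_norm S f < \<infinity>}"

text \<open>The space \<open>C(I; L\<^sup>p(S))\<close>.\<close>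

definition continuous_into_Lp ::
  "real \<Rightarrow> real set \<Rightarrow> 'a::euclidean_space set \<Rightarrow> (real \<Rightarrow> 'a \<Rightarrow> real) \<Rightarrow> bool" where
  "continuous_into_Lp p I S u \<longleftrightarrow>
     (\<forall>t\<in>I. u t \<in> Lp_space p S) \<and>
     (\<forall>t\<in>I. ((\<lambda>s. Lp_norm p S (\<lambda>x. u s x - u t x)) \<longlongrightarrow> 0) (at t within I))"

text \<open>
  The space \<open>C([0,T]; L\<^sup>p(0,1)) \<inter> C([0,1]; L\<^sup>p(0,T))\<close>. An element is given by one function
  \<open>u t x\<close> that represents both curves at once: \<open>u t\<close> is a representative of the value at every
  time \<open>t\<close>, and \<open>\<lambda>t. u t x\<close> of the trace at every point \<open>x\<close>, endpoints included. Such a common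
  representative exists for every element of the intersection. Joint measurability is what makes
  the two curves the same function on the rectangle; it does not follow from the measurability
  of all sections.
\<close>

definition broad_class :: "real \<Rightarrow> real \<Rightarrow> (real \<Rightarrow> real \<Rightarrow> real) \<Rightarrow> bool" where
  "broad_class p T u \<longleftrightarrow>
     (\<lambda>(t, x). u t x) \<in> borel_measurable (lebesgue_on ({0<..<T} \<times> {0<..<1})) \<and>
     continuous_into_Lp p {0..T} {0<..<1} u \<and>
     continuous_into_Lp p {0..1} {0<..<T} (\<lambda>x t. u t x)"

text \<open>
  For bounded measurable \<open>a\<close> the integrands below are integrable along almost every
  characteristic, by Fubini. The initial condition is contained in the characteristic rules.
\<close>

definition broad_solution_upto ::
  "real \<Rightarrow> real \<Rightarrow> real \<Rightarrow> (real \<times> real \<Rightarrow> real) \<Rightarrow> (real \<Rightarrow> real) \<Rightarrow> (real \<Rightarrow> real) \<Rightarrow> real \<Rightarrow>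
   (real \<Rightarrow> real \<Rightarrow> real) \<Rightarrow> (real \<Rightarrow> real \<Rightarrow> real) \<Rightarrow> bool" where
  "broad_solution_upto p c0 c1 a \<rho>0 \<xi>0 T \<rho> \<xi> \<longleftrightarrow>
     broad_class p T \<rho> \<and> broad_class p T \<xi> \<and>
     (let F = (\<lambda>t x. - (1/2) * a (t, x) * (\<rho> t x - \<xi> t x));
          G = (\<lambda>t x. (1/2) * a (t, x) * (\<rho> t x - \<xi> t x))
      in AE (t, x) in lebesgue_on ({0<..<T} \<times> {0<..<1}).
           (x + t < 1 \<longrightarrow>
              \<rho> t x = \<rho>0 (x + t) + (LINT s|lebesgue_on {0..t}. F s (x + t - s))) \<and>
           (x + t > 1 \<longrightarrow>
              \<rho> t x = \<rho> (t + x - 1) 1 + (LINT s|lebesgue_on {t + x - 1..t}. F s (x + t - s))) \<and>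
           (x > t \<longrightarrow>
              \<xi> t x = \<xi>0 (x - t) + (LINT s|lebesgue_on {0..t}. G s (x - t + s))) \<and>
           (x < t \<longrightarrow>
              \<xi> t x = \<xi> (t - x) 0 + (LINT s|lebesgue_on {t - x..t}. G s (x - t + s)))) \<and>
     (AE t in lebesgue_on {0<..<T}. \<xi> t 0 = c0 * \<rho> t 0) \<and>
     (AE t in lebesgue_on {0<..<T}. \<rho> t 1 = c1 * \<xi> t 1)"

definition broad_solution ::
  "real \<Rightarrow> real \<Rightarrow> real \<Rightarrow> (real \<times> real \<Rightarrow> real) \<Rightarrow> (real \<Rightarrow> real) \<Rightarrow> (real \<Rightarrow> real) \<Rightarrow>
   (real \<Rightarrow> real \<Rightarrow> real) \<Rightarrow> (real \<Rightarrow> real \<Rightarrow> real) \<Rightarrow> bool" where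
  "broad_solution p c0 c1 a \<rho>0 \<xi>0 \<rho> \<xi> \<longleftrightarrow>
     (\<forall>T>0. broad_solution_upto p c0 c1 a \<rho>0 \<xi>0 T \<rho> \<xi>)"

text \<open>
  Equality of two representatives as elements of \<open>C([0,T]; L\<^sup>p(0,1)) \<inter> C([0,1]; L\<^sup>p(0,T))\<close>
  for all \<open>T > 0\<close>.
\<close>

definition broad_eq :: "(real \<Rightarrow> real \<Rightarrow> real) \<Rightarrow> (real \<Rightarrow> real \<Rightarrow> real) \<Rightarrow> bool" where
  "broad_eq u v \<longleftrightarrow>
     (\<forall>t\<ge>0. AE x in lebesgue_on {0<..<1}. u t x = v t x) \<and>
     (\<forall>x\<in>{0..1}. AE t in lebesgue_on {0<..}. u t x = v t x)"

end

theory Submission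
  imports Defs
begin

text \<open>
Reflection turns both equations into transport to the left. With \<open>y False = \<rho>\<close> and
\<open>y True t x = \<xi> t (1 - x)\<close>, each component travels along the lines \<open>t + x = z\<close>. It starts on the
line with label \<open>z\<close> at time \<open>max 0 (z - 1)\<close>, from the initial datum if \<open>z < 1\<close> and from the boundary
\<open>x = 1\<close> if \<open>z > 1\<close>, where it receives the outflow of the other component at \<open>x = 0\<close> times \<open>c0\<close> or
\<open>c1\<close>. The zero order term exchanges mass between \<open>(t, x)\<close> and the mirror point \<open>(t, 1 - x)\<close>. All
arguments below treat the two components at once, with a Boolean index \<open>k\<close>.

Existence rests on positivity. After multiplication by \<open>exp (lam * t)\<close>, with \<open>lam\<close> at least half the
bound of \<open>a\<close>, the coefficients \<open>lam - a / 2\<close> and \<open>a / 2\<close> are non-negative. For non-negative data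
the Picard iterates increase in \<open>ennreal\<close>, so their supremum is a fixed point by monotone
convergence. Signed data and negative reflection coefficients are handled by carrying the positive and
the negative part as separate unknowns; a negative coefficient exchanges the two.

The decay in \<open>Lp\<close> reduces to an estimate in \<open>L1\<close> for a linear system. The tangent inequality
\<open>p * m powr (p - 1) * y \<le> (p - 1) * m powr p + y powr p\<close> is affine in \<open>y\<close>, and constants times
\<open>exp (lam * t)\<close> solve the exchange equation. Hence it passes from the data to the solutions
(lemma \<open>sol_comparison\<close>): the sum of both parts is controlled, for every \<open>m\<close>, by the solution \<open>R\<close> of
the positive system with data \<open>\<bar>f\<bar> powr p\<close>, and taking \<open>m\<close> equal to the value of the solution gives
\<open>\<bar>y\<bar> powr p \<le> exp (- lam * t) * R\<close>. For \<open>R\<close> there are weights (lemma \<open>ex_weights\<close>) whose transport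
and exchange inequality is affine in \<open>a\<close>; it holds for every \<open>a\<close> between \<open>0\<close> and \<open>2 * lam\<close>
because it holds at both ends. The boundary loses mass since \<open>\<bar>c0\<bar>\<close> and \<open>\<bar>c1\<bar>\<close> are below \<open>1\<close>, and this
loss pays for an exponential rate that depends only on \<open>lam\<close> and on the reflection coefficients
(lemma \<open>sol_decay\<close>).

The same estimate bounds the outflow of \<open>R\<close> through \<open>x = 0\<close>. Along a line \<open>R\<close> only grows, so its exit
value dominates the \<open>p\<close>-th power of the solution on the whole line. Dominated convergence, together with the
continuity of translations in \<open>Lp\<close>, then yields both continuity requirements of a broad solution.

Uniqueness is an \<open>L1\<close> Gronwall argument with the weight \<open>exp (- (2 * lam + 1) * t)\<close>
(lemma \<open>transport_gronwall\<close>). The characteristic rules only speak about almost every point of the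
open strip; the trace at \<open>x = 0\<close> is reached as an \<open>L1\<close> limit of nearby lines
(lemma \<open>trace_le_outflow\<close>).
\<close>

abbreviation borel2 :: "(real \<times> real \<Rightarrow> 'a::topological_space) set" where
  "borel2 \<equiv> borel_measurable (borel \<Otimes>\<^sub>M borel)"

abbreviation in_strip :: "real \<Rightarrow> real \<Rightarrow> real \<Rightarrow> bool" where
  "in_strip T t x \<equiv> 0 < t \<and> t < T \<and> 0 < x \<and> x < 1"

section \<open>Integration along a pencil of lines\<close>

lemma nn_integral_shift:
  fixes f :: "real \<Rightarrow> ennreal"
  assumes "f \<in> borel_measurable borel"
  shows "(\<integral>\<^sup>+x. f (x + c) \<partial>lborel) = (\<integral>\<^sup>+x. f x \<partial>lborel)"
  using nn_integral_real_affine[OF assms, of 1 c] by (simp add: add.commute)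

lemma nn_integral_flip:
  fixes f :: "real \<Rightarrow> ennreal"
  assumes "f \<in> borel_measurable borel"
  shows "(\<integral>\<^sup>+x. f (c - x) \<partial>lborel) = (\<integral>\<^sup>+x. f x \<partial>lborel)"
  using nn_integral_real_affine[OF assms, of "-1" c] by simp

text \<open>
Integrating over the label \<open>z\<close> and over the line with that label is the same as integrating over the
plane. It turns estimates on single lines into estimates on the strip.
\<close>

lemma nn_integral_shear:
  fixes k :: "real \<Rightarrow> real \<Rightarrow> ennreal"
  assumes [measurable]: "case_prod k \<in> borel2"
  shows "(\<integral>\<^sup>+z. (\<integral>\<^sup>+s. k s (z - s) \<partial>lborel) \<partial>lborel) = (\<integral>\<^sup>+s. (\<integral>\<^sup>+x. k s x \<partial>lborel) \<partial>lborel)"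
proof -
  have "(\<integral>\<^sup>+z. (\<integral>\<^sup>+s. k s (z - s) \<partial>lborel) \<partial>lborel) = (\<integral>\<^sup>+s. (\<integral>\<^sup>+z. k s (z - s) \<partial>lborel) \<partial>lborel)"
    by (rule lborel_pair.Fubini') measurable
  also have "\<dots> = (\<integral>\<^sup>+s. (\<integral>\<^sup>+x. k s x \<partial>lborel) \<partial>lborel)"
  proof (rule nn_integral_cong)
    fix s :: real
    show "(\<integral>\<^sup>+z. k s (z - s) \<partial>lborel) = (\<integral>\<^sup>+x. k s x \<partial>lborel)"
      using nn_integral_shift[of "k s" "- s"] by simp
  qed
  finally show ?thesis .
qed

text \<open>
Stated for non-negative functions, so that \<open>g\<close> and \<open>h\<close> may be infinite. By Tonelli it is enough to
compare the total weight that reaches a source at time \<open>s\<close>: what remains at \<open>b\<close> and what was spent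
between \<open>s\<close> and \<open>b\<close> add up to \<open>\<Phi> s\<close>.
\<close>

lemma nn_integral_by_parts:
  fixes \<Phi> \<psi> :: "real \<Rightarrow> real" and g :: ennreal and h :: "real \<Rightarrow> ennreal"
  assumes [measurable]: "\<Phi> \<in> borel_measurable borel" "\<psi> \<in> borel_measurable borel" "h \<in> borel_measurable borel"
    and "a \<le> b"
    and deriv: "\<And>\<tau>. a \<le> \<tau> \<Longrightarrow> \<tau> \<le> b \<Longrightarrow> (\<Phi> has_real_derivative - \<psi> \<tau>) (at \<tau>)"
    and \<Phi>0: "\<And>\<tau>. a \<le> \<tau> \<Longrightarrow> \<tau> \<le> b \<Longrightarrow> 0 \<le> \<Phi> \<tau>"
    and \<psi>0: "\<And>\<tau>. a \<le> \<tau> \<Longrightarrow> \<tau> \<le> b \<Longrightarrow> 0 \<le> \<psi> \<tau>"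
  shows "ennreal (\<Phi> b) * (g + (\<integral>\<^sup>+s\<in>{a..b}. h s \<partial>lborel))
           + (\<integral>\<^sup>+\<tau>\<in>{a..b}. ennreal (\<psi> \<tau>) * (g + (\<integral>\<^sup>+s\<in>{a..\<tau>}. h s \<partial>lborel)) \<partial>lborel)
         = ennreal (\<Phi> a) * g + (\<integral>\<^sup>+s\<in>{a..b}. ennreal (\<Phi> s) * h s \<partial>lborel)"
proof -
  define \<psi>' where "\<psi>' \<tau> = (if a \<le> \<tau> \<and> \<tau> \<le> b then \<psi> \<tau> else 0)" for \<tau>
  have [measurable]: "\<psi>' \<in> borel_measurable borel" unfolding \<psi>'_def by measurable
  have mass: "ennreal (\<Phi> b) + (\<integral>\<^sup>+\<tau>\<in>{s..b}. ennreal (\<psi> \<tau>) \<partial>lborel) = ennreal (\<Phi> s)"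
    if s: "a \<le> s" "s \<le> b" for s
  proof -
    have "(\<integral>\<^sup>+\<tau>\<in>{s..b}. ennreal (\<psi>' \<tau>) \<partial>lborel) = ennreal (- \<Phi> b - - \<Phi> s)"
    proof (rule nn_integral_FTC_Icc)
      show "((\<lambda>x. - \<Phi> x) has_real_derivative \<psi>' x) (at x)" if "x \<in> {s..b}" for x
        using deriv[of x] that s by (auto intro!: derivative_eq_intros simp: \<psi>'_def)
      show "0 \<le> \<psi>' x" if "x \<in> {s..b}" for x
        using \<psi>0[of x] that s by (auto simp: \<psi>'_def)
    qed (use s in auto)
    moreover have "(\<integral>\<^sup>+\<tau>\<in>{s..b}. ennreal (\<psi>' \<tau>) \<partial>lborel) = (\<integral>\<^sup>+\<tau>\<in>{s..b}. ennreal (\<psi> \<tau>) \<partial>lborel)"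
      using s by (intro nn_integral_cong) (auto simp: \<psi>'_def indicator_def)
    moreover have "\<Phi> b \<le> \<Phi> s"
    proof (rule DERIV_nonpos_imp_nonincreasing[OF s(2)])
      fix x assume "s \<le> x" "x \<le> b"
      then show "\<exists>y. (\<Phi> has_real_derivative y) (at x) \<and> y \<le> 0"
        using deriv[of x] \<psi>0[of x] s by (intro exI[of _ "- \<psi> x"]) auto
    qed
    ultimately show ?thesis
      using \<Phi>0[of b] \<Phi>0[of s] s \<open>a \<le> b\<close> by (simp flip: ennreal_plus)
  qed
  \<comment> \<open>Tonelli on the triangle \<open>a \<le> s \<le> \<tau> \<le> b\<close>.\<close>
  have swap: "(\<integral>\<^sup>+\<tau>\<in>{a..b}. ennreal (\<psi> \<tau>) * (\<integral>\<^sup>+s\<in>{a..\<tau>}. h s \<partial>lborel) \<partial>lborel)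
    = (\<integral>\<^sup>+s\<in>{a..b}. (\<integral>\<^sup>+\<tau>\<in>{s..b}. ennreal (\<psi> \<tau>) \<partial>lborel) * h s \<partial>lborel)"
  proof -
    have "(\<integral>\<^sup>+\<tau>\<in>{a..b}. ennreal (\<psi> \<tau>) * (\<integral>\<^sup>+s\<in>{a..\<tau>}. h s \<partial>lborel) \<partial>lborel)
      = (\<integral>\<^sup>+\<tau>. (\<integral>\<^sup>+s. (if a \<le> s \<and> s \<le> \<tau> \<and> \<tau> \<le> b then ennreal (\<psi> \<tau>) * h s else 0) \<partial>lborel) \<partial>lborel)"
    proof (rule nn_integral_cong)
      fix \<tau> :: real
      have "ennreal (\<psi> \<tau>) * (\<integral>\<^sup>+s\<in>{a..\<tau>}. h s \<partial>lborel) * indicator {a..b} \<tau>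
          = (ennreal (\<psi> \<tau>) * indicator {a..b} \<tau>) * (\<integral>\<^sup>+s\<in>{a..\<tau>}. h s \<partial>lborel)"
        by (simp add: ac_simps)
      also have "\<dots> = (\<integral>\<^sup>+s. (ennreal (\<psi> \<tau>) * indicator {a..b} \<tau>) * (h s * indicator {a..\<tau>} s) \<partial>lborel)"
        by (rule nn_integral_cmult[symmetric]) measurable
      also have "\<dots> = (\<integral>\<^sup>+s. (if a \<le> s \<and> s \<le> \<tau> \<and> \<tau> \<le> b then ennreal (\<psi> \<tau>) * h s else 0) \<partial>lborel)"
        by (intro nn_integral_cong) (auto simp: indicator_def)
      finally show "ennreal (\<psi> \<tau>) * (\<integral>\<^sup>+s\<in>{a..\<tau>}. h s \<partial>lborel) * indicator {a..b} \<tau>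
        = (\<integral>\<^sup>+s. (if a \<le> s \<and> s \<le> \<tau> \<and> \<tau> \<le> b then ennreal (\<psi> \<tau>) * h s else 0) \<partial>lborel)" .
    qed
    also have "\<dots> = (\<integral>\<^sup>+s. (\<integral>\<^sup>+\<tau>. (if a \<le> s \<and> s \<le> \<tau> \<and> \<tau> \<le> b then ennreal (\<psi> \<tau>) * h s else 0) \<partial>lborel) \<partial>lborel)"
      by (rule lborel_pair.Fubini') measurable
    also have "\<dots> = (\<integral>\<^sup>+s\<in>{a..b}. (\<integral>\<^sup>+\<tau>\<in>{s..b}. ennreal (\<psi> \<tau>) \<partial>lborel) * h s \<partial>lborel)"
    proof (rule nn_integral_cong)
      fix s :: real
      have "(\<integral>\<^sup>+\<tau>\<in>{s..b}. ennreal (\<psi> \<tau>) \<partial>lborel) * h s * indicator {a..b} s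
          = (h s * indicator {a..b} s) * (\<integral>\<^sup>+\<tau>\<in>{s..b}. ennreal (\<psi> \<tau>) \<partial>lborel)"
        by (simp add: ac_simps)
      also have "\<dots> = (\<integral>\<^sup>+\<tau>. (h s * indicator {a..b} s) * (ennreal (\<psi> \<tau>) * indicator {s..b} \<tau>) \<partial>lborel)"
        by (rule nn_integral_cmult[symmetric]) measurable
      also have "\<dots> = (\<integral>\<^sup>+\<tau>. (if a \<le> s \<and> s \<le> \<tau> \<and> \<tau> \<le> b then ennreal (\<psi> \<tau>) * h s else 0) \<partial>lborel)"
        by (intro nn_integral_cong) (auto simp: indicator_def ac_simps)
      finally show "(\<integral>\<^sup>+\<tau>. (if a \<le> s \<and> s \<le> \<tau> \<and> \<tau> \<le> b then ennreal (\<psi> \<tau>) * h s else 0) \<partial>lborel)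
        = (\<integral>\<^sup>+\<tau>\<in>{s..b}. ennreal (\<psi> \<tau>) \<partial>lborel) * h s * indicator {a..b} s" ..
    qed
    finally show ?thesis .
  qed
  have [measurable]: "(\<lambda>\<tau>. \<integral>\<^sup>+s\<in>{a..\<tau>}. h s \<partial>lborel) \<in> borel_measurable borel"
    unfolding indicator_def atLeastAtMost_iff by measurable
  have [measurable]: "(\<lambda>s. \<integral>\<^sup>+\<tau>\<in>{s..b}. ennreal (\<psi> \<tau>) \<partial>lborel) \<in> borel_measurable borel"
    unfolding indicator_def atLeastAtMost_iff by measurable
  have "(\<integral>\<^sup>+\<tau>\<in>{a..b}. ennreal (\<psi> \<tau>) * (g + (\<integral>\<^sup>+s\<in>{a..\<tau>}. h s \<partial>lborel)) \<partial>lborel)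
    = (\<integral>\<^sup>+\<tau>\<in>{a..b}. ennreal (\<psi> \<tau>) \<partial>lborel) * g
      + (\<integral>\<^sup>+\<tau>\<in>{a..b}. ennreal (\<psi> \<tau>) * (\<integral>\<^sup>+s\<in>{a..\<tau>}. h s \<partial>lborel) \<partial>lborel)"
    by (subst nn_integral_multc[symmetric], measurable, subst nn_integral_add[symmetric], measurable)
       (auto intro!: nn_integral_cong simp: algebra_simps)
  moreover have "ennreal (\<Phi> b) * (\<integral>\<^sup>+s\<in>{a..b}. h s \<partial>lborel) = (\<integral>\<^sup>+s\<in>{a..b}. ennreal (\<Phi> b) * h s \<partial>lborel)"
    by (subst nn_integral_cmult[symmetric]) (auto intro!: nn_integral_cong simp: ac_simps)
  moreover have "(\<integral>\<^sup>+s\<in>{a..b}. ennreal (\<Phi> b) * h s \<partial>lborel)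
      + (\<integral>\<^sup>+s\<in>{a..b}. (\<integral>\<^sup>+\<tau>\<in>{s..b}. ennreal (\<psi> \<tau>) \<partial>lborel) * h s \<partial>lborel)
      = (\<integral>\<^sup>+s\<in>{a..b}. ennreal (\<Phi> s) * h s \<partial>lborel)"
  proof (subst nn_integral_add[symmetric], measurable, rule nn_integral_cong)
    fix s :: real
    show "ennreal (\<Phi> b) * h s * indicator {a..b} s
        + (\<integral>\<^sup>+\<tau>\<in>{s..b}. ennreal (\<psi> \<tau>) \<partial>lborel) * h s * indicator {a..b} s
      = ennreal (\<Phi> s) * h s * indicator {a..b} s"
      by (cases "s \<in> {a..b}") (simp_all add: mass flip: distrib_right)
  qed
  moreover have "ennreal (\<Phi> b) * g + (\<integral>\<^sup>+\<tau>\<in>{a..b}. ennreal (\<psi> \<tau>) \<partial>lborel) * g = ennreal (\<Phi> a) * g"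
    using mass[of a] \<open>a \<le> b\<close> by (simp flip: distrib_right)
  ultimately show ?thesis
    using swap by (simp add: algebra_simps)
qed

section \<open>Transport to the left in the strip\<close>

text \<open>
The time at which the line \<open>t + x = z\<close> enters the strip \<open>0 \<le> x \<le> 1\<close>, \<open>t \<ge> 0\<close>.
\<close>

definition entry :: "real \<Rightarrow> real" where
  "entry z = max 0 (z - 1)"

text \<open>
The solution of \<open>u\<^sub>t - u\<^sub>x = h\<close> that has the value \<open>g z\<close> where the line with label \<open>z\<close> enters. One
function \<open>g\<close> of the label holds both the initial datum (\<open>z < 1\<close>) and the inflow at \<open>x = 1\<close>
(time \<open>z - 1\<close>, for \<open>z \<ge> 1\<close>).
\<close>

definition transport :: "(real \<Rightarrow> ennreal) \<Rightarrow> (real \<Rightarrow> real \<Rightarrow> ennreal) \<Rightarrow> real \<Rightarrow> real \<Rightarrow> ennreal" where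
  "transport g h t x = g (x + t) + (\<integral>\<^sup>+s\<in>{entry (x + t)..t}. h s (x + t - s) \<partial>lborel)"

lemma entry_measurable [measurable]: "entry \<in> borel_measurable borel"
  unfolding entry_def by measurable

lemma transport_measurable [measurable]:
  assumes [measurable]: "g \<in> borel_measurable borel" "case_prod h \<in> borel2"
  shows "case_prod (transport g h) \<in> borel2"
  unfolding transport_def indicator_def atLeastAtMost_iff split_beta' by measurable

lemma transport_mono:
  assumes "\<And>z. g z \<le> g' z" "\<And>t x. h t x \<le> h' t x"
  shows "transport g h t x \<le> transport g' h' t x"
  unfolding transport_def by (intro add_mono nn_integral_mono mult_right_mono assms) auto

text \<open>
A non-negative source makes the solution grow along its line, so the exit value at \<open>x = 0\<close> is the
largest one.
\<close>

lemma transport_le_exit: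
  assumes "t \<le> z"
  shows "transport g h t (z - t) \<le> transport g h z 0"
  unfolding transport_def
  by (intro add_mono nn_integral_mono) (use assms in \<open>auto simp: indicator_def\<close>)

text \<open>
Integration by parts on each line, integrated over the labels up to \<open>T + 1\<close>. A line ends at \<open>x = 0\<close> if
its label is at most \<open>T\<close> and at time \<open>T\<close> otherwise, which splits the final values into an outflow term
and a term at time \<open>T\<close>; the initial values split in the same way.
\<close>

lemma transport_energy:
  fixes \<Phi> \<Psi> :: "real \<Rightarrow> real \<Rightarrow> real"
  assumes [measurable]: "g \<in> borel_measurable borel" "case_prod h \<in> borel2"
      "case_prod \<Phi> \<in> borel2" "case_prod \<Psi> \<in> borel2"
    and T: "0 \<le> T"
    and \<Phi>0: "\<And>t x. 0 \<le> t \<Longrightarrow> 0 \<le> x \<Longrightarrow> x \<le> 1 \<Longrightarrow> 0 \<le> \<Phi> t x"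
    and \<Psi>0: "\<And>t x. 0 \<le> t \<Longrightarrow> 0 \<le> x \<Longrightarrow> x \<le> 1 \<Longrightarrow> 0 \<le> \<Psi> t x"
    and deriv: "\<And>z t. 0 \<le> t \<Longrightarrow> t \<le> z \<Longrightarrow> z \<le> t + 1 \<Longrightarrow>
       ((\<lambda>\<tau>. \<Phi> \<tau> (z - \<tau>)) has_real_derivative - \<Psi> t (z - t)) (at t)"
  shows "(\<integral>\<^sup>+t\<in>{0..T}. ennreal (\<Phi> t 0) * transport g h t 0 \<partial>lborel)
       + (\<integral>\<^sup>+x\<in>{0..1}. ennreal (\<Phi> T x) * transport g h T x \<partial>lborel)
       + (\<integral>\<^sup>+t\<in>{0..T}. (\<integral>\<^sup>+x\<in>{0..1}. ennreal (\<Psi> t x) * transport g h t x \<partial>lborel) \<partial>lborel)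
     = (\<integral>\<^sup>+x\<in>{0..1}. ennreal (\<Phi> 0 x) * g x \<partial>lborel)
       + (\<integral>\<^sup>+t\<in>{0..T}. ennreal (\<Phi> t 1) * g (t + 1) \<partial>lborel)
       + (\<integral>\<^sup>+t\<in>{0..T}. (\<integral>\<^sup>+x\<in>{0..1}. ennreal (\<Phi> t x) * h t x \<partial>lborel) \<partial>lborel)"
proof -
  let ?D = "transport g h"
  define e where "e z = min z T" for z
  have [measurable]: "e \<in> borel_measurable borel" unfolding e_def by measurable
  have char: "ennreal (\<Phi> (e z) (z - e z)) * ?D (e z) (z - e z)
        + (\<integral>\<^sup>+\<tau>\<in>{entry z..e z}. ennreal (\<Psi> \<tau> (z - \<tau>)) * ?D \<tau> (z - \<tau>) \<partial>lborel)
      = ennreal (\<Phi> (entry z) (z - entry z)) * g z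
        + (\<integral>\<^sup>+s\<in>{entry z..e z}. ennreal (\<Phi> s (z - s)) * h s (z - s) \<partial>lborel)"
    if z: "0 \<le> z" "z \<le> T + 1" for z
  proof -
    have D: "?D \<tau> (z - \<tau>) = g z + (\<integral>\<^sup>+s\<in>{entry z..\<tau>}. h s (z - s) \<partial>lborel)" for \<tau>
      by (simp add: transport_def)
    show ?thesis
      unfolding D
    proof (rule nn_integral_by_parts)
      show "entry z \<le> e z" using z T by (auto simp: entry_def e_def)
    qed (use z T in \<open>auto simp: entry_def e_def intro!: deriv \<Phi>0 \<Psi>0\<close>)
  qed
  have strip: "(\<integral>\<^sup>+z\<in>{0..T+1}. (\<integral>\<^sup>+\<tau>\<in>{entry z..e z}. F \<tau> (z - \<tau>) \<partial>lborel) \<partial>lborel)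
      = (\<integral>\<^sup>+t\<in>{0..T}. (\<integral>\<^sup>+x\<in>{0..1}. F t x \<partial>lborel) \<partial>lborel)"
    if [measurable]: "case_prod F \<in> borel2" for F :: "real \<Rightarrow> real \<Rightarrow> ennreal"
  proof -
    have "(\<integral>\<^sup>+z\<in>{0..T+1}. (\<integral>\<^sup>+\<tau>\<in>{entry z..e z}. F \<tau> (z - \<tau>) \<partial>lborel) \<partial>lborel)
      = (\<integral>\<^sup>+z. (\<integral>\<^sup>+\<tau>. (F \<tau> (z - \<tau>) * indicator {0..1} (z - \<tau>)) * indicator {0..T} \<tau> \<partial>lborel) \<partial>lborel)"
    proof (rule nn_integral_cong)
      fix z :: real
      have "(\<integral>\<^sup>+\<tau>\<in>{entry z..e z}. F \<tau> (z - \<tau>) \<partial>lborel) * indicator {0..T+1} z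
        = (\<integral>\<^sup>+\<tau>. (F \<tau> (z - \<tau>) * indicator {entry z..e z} \<tau>) * indicator {0..T+1} z \<partial>lborel)"
        by (rule nn_integral_multc[symmetric]) measurable
      also have "\<dots> = (\<integral>\<^sup>+\<tau>. (F \<tau> (z - \<tau>) * indicator {0..1} (z - \<tau>)) * indicator {0..T} \<tau> \<partial>lborel)"
        by (intro nn_integral_cong) (auto simp: indicator_def entry_def e_def)
      finally show "(\<integral>\<^sup>+\<tau>\<in>{entry z..e z}. F \<tau> (z - \<tau>) \<partial>lborel) * indicator {0..T+1} z
        = (\<integral>\<^sup>+\<tau>. (F \<tau> (z - \<tau>) * indicator {0..1} (z - \<tau>)) * indicator {0..T} \<tau> \<partial>lborel)" .
    qed
    also have "\<dots> = (\<integral>\<^sup>+t. (\<integral>\<^sup>+x. (F t x * indicator {0..1} x) * indicator {0..T} t \<partial>lborel) \<partial>lborel)"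
      by (rule nn_integral_shear) measurable
    also have "\<dots> = (\<integral>\<^sup>+t\<in>{0..T}. (\<integral>\<^sup>+x\<in>{0..1}. F t x \<partial>lborel) \<partial>lborel)"
      by (intro nn_integral_cong nn_integral_multc) measurable
    finally show ?thesis .
  qed
  \<comment> \<open>Labels up to \<open>T\<close> leave the strip through \<open>x = 0\<close>, the later ones are still inside at time \<open>T\<close>.\<close>
  have split: "(\<integral>\<^sup>+z\<in>{0..T+1}. f z \<partial>lborel) = (\<integral>\<^sup>+z\<in>{0..r}. f z \<partial>lborel) + (\<integral>\<^sup>+x\<in>{0..T+1-r}. f (x + r) \<partial>lborel)"
    if [measurable]: "f \<in> borel_measurable borel" and "0 \<le> r" "r \<le> T + 1" for f :: "real \<Rightarrow> ennreal" and r
  proof -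
    have "(\<integral>\<^sup>+z\<in>{0..T+1}. f z \<partial>lborel) = (\<integral>\<^sup>+z. f z * indicator {0..r} z + f z * indicator {r..T+1} z \<partial>lborel)"
      using AE_lborel_singleton[of r]
      by (intro nn_integral_cong_AE, eventually_elim) (use that in \<open>auto simp: indicator_def\<close>)
    also have "\<dots> = (\<integral>\<^sup>+z\<in>{0..r}. f z \<partial>lborel) + (\<integral>\<^sup>+z\<in>{r..T+1}. f z \<partial>lborel)"
      by (rule nn_integral_add) measurable
    also have "(\<integral>\<^sup>+z\<in>{r..T+1}. f z \<partial>lborel) = (\<integral>\<^sup>+x. f (x + r) * indicator {r..T+1} (x + r) \<partial>lborel)"
      by (rule nn_integral_shift[symmetric]) measurable
    also have "\<dots> = (\<integral>\<^sup>+x\<in>{0..T+1-r}. f (x + r) \<partial>lborel)"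
      by (intro nn_integral_cong) (auto simp: indicator_def)
    finally show ?thesis .
  qed
  have strip_meas [measurable]: "(\<lambda>z. \<integral>\<^sup>+\<tau>\<in>{entry z..e z}. F \<tau> (z - \<tau>) \<partial>lborel) \<in> borel_measurable borel"
    if [measurable]: "case_prod F \<in> borel2" for F :: "real \<Rightarrow> real \<Rightarrow> ennreal"
    unfolding indicator_def atLeastAtMost_iff by measurable
  have out: "(\<integral>\<^sup>+z\<in>{0..T+1}. ennreal (\<Phi> (e z) (z - e z)) * ?D (e z) (z - e z) \<partial>lborel)
      = (\<integral>\<^sup>+t\<in>{0..T}. ennreal (\<Phi> t 0) * ?D t 0 \<partial>lborel)
       + (\<integral>\<^sup>+x\<in>{0..1}. ennreal (\<Phi> T x) * ?D T x \<partial>lborel)"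
    using T by (subst split[of _ T], measurable)
      (auto intro!: arg_cong2[where f="(+)"] nn_integral_cong simp: indicator_def e_def)
  have inn: "(\<integral>\<^sup>+z\<in>{0..T+1}. ennreal (\<Phi> (entry z) (z - entry z)) * g z \<partial>lborel)
      = (\<integral>\<^sup>+x\<in>{0..1}. ennreal (\<Phi> 0 x) * g x \<partial>lborel)
       + (\<integral>\<^sup>+t\<in>{0..T}. ennreal (\<Phi> t 1) * g (t + 1) \<partial>lborel)"
    using T by (subst split[of _ 1], measurable)
      (auto intro!: arg_cong2[where f="(+)"] nn_integral_cong simp: indicator_def entry_def)
  have mD [measurable]: "(\<lambda>(t, x). ennreal (\<Psi> t x) * ?D t x) \<in> borel2"
    "(\<lambda>(t, x). ennreal (\<Phi> t x) * h t x) \<in> borel2"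
    by measurable
  have "(\<integral>\<^sup>+z\<in>{0..T+1}. ennreal (\<Phi> (e z) (z - e z)) * ?D (e z) (z - e z) \<partial>lborel)
      + (\<integral>\<^sup>+z\<in>{0..T+1}. (\<integral>\<^sup>+\<tau>\<in>{entry z..e z}. ennreal (\<Psi> \<tau> (z - \<tau>)) * ?D \<tau> (z - \<tau>) \<partial>lborel) \<partial>lborel)
    = (\<integral>\<^sup>+z\<in>{0..T+1}. ennreal (\<Phi> (entry z) (z - entry z)) * g z \<partial>lborel)
      + (\<integral>\<^sup>+z\<in>{0..T+1}. (\<integral>\<^sup>+s\<in>{entry z..e z}. ennreal (\<Phi> s (z - s)) * h s (z - s) \<partial>lborel) \<partial>lborel)"
    using strip_meas[OF mD(1)] strip_meas[OF mD(2)]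
    by (subst (1 2) nn_integral_add[symmetric], measurable)
       (auto intro!: nn_integral_cong simp: indicator_def[of "{0..T+1}"] char)
  then show ?thesis
    unfolding out inn strip[OF mD(1)] strip[OF mD(2)] by (simp add: ac_simps)
qed

section \<open>The positive system and its Picard iteration\<close>

lemma sum_bool_flip: "(\<Sum>k\<in>UNIV. F (\<not> k)) = (\<Sum>k\<in>UNIV. F (k::bool))" for F :: "bool \<Rightarrow> 'a::comm_monoid_add"
  by (simp add: UNIV_bool add.commute)

lemma transport_add:
  assumes [measurable]: "case_prod h \<in> borel2" "case_prod h' \<in> borel2"
  shows "transport g h t x + transport g' h' t x = transport (\<lambda>z. g z + g' z) (\<lambda>t x. h t x + h' t x) t x"
proof -
  have "(\<integral>\<^sup>+s\<in>{entry (x + t)..t}. h s (x + t - s) + h' s (x + t - s) \<partial>lborel)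
      = (\<integral>\<^sup>+s\<in>{entry (x + t)..t}. h s (x + t - s) \<partial>lborel) + (\<integral>\<^sup>+s\<in>{entry (x + t)..t}. h' s (x + t - s) \<partial>lborel)"
    by (subst nn_integral_add[symmetric]) (auto simp: distrib_right)
  then show ?thesis unfolding transport_def by (simp add: ac_simps)
qed

lemma transport_cmult:
  assumes [measurable]: "case_prod h \<in> borel2"
  shows "a * transport g h t x = transport (\<lambda>z. a * g z) (\<lambda>t x. a * h t x) t x"
  unfolding transport_def by (simp add: distrib_left nn_integral_cmult mult.assoc)

lemma transport_le:
  assumes "0 \<le> t" "0 \<le> x" "x \<le> 1"
    and "g (x + t) \<le> g' (x + t)"
    and "\<And>s y. 0 \<le> s \<Longrightarrow> 0 \<le> y \<Longrightarrow> y \<le> 1 \<Longrightarrow> h s y \<le> h' s y"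
  shows "transport g h t x \<le> transport g' h' t x"
  unfolding transport_def
proof (intro add_mono nn_integral_mono)
  fix s
  show "h s (x + t - s) * indicator {entry (x + t)..t} s \<le> h' s (x + t - s) * indicator {entry (x + t)..t} s"
    using assms by (cases "s \<in> {entry (x + t)..t}") (auto simp: entry_def)
qed (use assms in auto)

text \<open>
Constants solve the exchange equation; in the variables multiplied by \<open>exp (lam * t)\<close> they become
\<open>exp (lam * t)\<close>, with source \<open>lam * exp (lam * t)\<close>.
\<close>

lemma transport_exp:
  assumes "0 \<le> t" "x \<le> 1" "0 < lam"
  shows "transport (\<lambda>z. ennreal (exp (lam * entry z))) (\<lambda>t x. ennreal (lam * exp (lam * t))) t x = ennreal (exp (lam * t))"
proof -
  have le: "entry (x + t) \<le> t" using assms by (auto simp: entry_def)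
  have "(\<integral>\<^sup>+s\<in>{entry (x + t)..t}. ennreal (lam * exp (lam * s)) \<partial>lborel)
      = ennreal (exp (lam * t) - exp (lam * entry (x + t)))"
    by (rule nn_integral_FTC_Icc) (use le assms in \<open>auto intro!: derivative_eq_intros simp: mult.commute\<close>)
  then show ?thesis
    using le assms by (simp add: transport_def flip: ennreal_plus)
qed

lemma transport_SUP:
  assumes [measurable]: "\<And>n. case_prod (h n) \<in> borel2"
    and "incseq g" "incseq h"
  shows "transport (\<lambda>z. SUP n. g n z) (\<lambda>t x. SUP n. h n t x) t x = (SUP n. transport (g n) (h n) t x)"
proof -
  have "(\<integral>\<^sup>+s\<in>{entry (x + t)..t}. (SUP n. h n s (x + t - s)) \<partial>lborel)
      = (\<integral>\<^sup>+s. (SUP n. h n s (x + t - s) * indicator {entry (x + t)..t} s) \<partial>lborel)"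
    by (simp add: SUP_mult_right_ennreal)
  also have "\<dots> = (SUP n. \<integral>\<^sup>+s\<in>{entry (x + t)..t}. h n s (x + t - s) \<partial>lborel)"
    using \<open>incseq h\<close>
    by (intro nn_integral_monotone_convergence_SUP) (auto simp: incseq_def le_fun_def intro!: mult_right_mono)
  finally have *: "(\<integral>\<^sup>+s\<in>{entry (x + t)..t}. (SUP n. h n s (x + t - s)) \<partial>lborel)
    = (SUP n. \<integral>\<^sup>+s\<in>{entry (x + t)..t}. h n s (x + t - s) \<partial>lborel)" .
  show ?thesis
    unfolding transport_def *
    by (rule ennreal_SUP_add[symmetric])
       (use assms(2,3) in \<open>auto simp: incseq_def le_fun_def intro!: nn_integral_mono mult_right_mono\<close>)
qed

text \<open>
The exchange coefficient \<open>al k\<close> is half of \<open>a\<close>, seen from component \<open>k\<close>. The reflection law says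
that the mirror point carries the same coefficient, so that what one component gives the other receives.
\<close>

locale coupling =
  fixes lam :: real and al :: "bool \<Rightarrow> real \<Rightarrow> real \<Rightarrow> real"
  assumes lam_pos: "0 < lam"
    and al_measurable [measurable]: "\<And>k. case_prod (al k) \<in> borel2"
    and al_nonneg: "\<And>k t x. 0 \<le> al k t x" and al_le: "\<And>k t x. al k t x \<le> lam"
    and al_reflect: "\<And>k t x. al (\<not> k) t (1 - x) = al k t x"
begin

text \<open>
The source in the variables multiplied by \<open>exp (lam * t)\<close>, which turns the loss term \<open>- al * u\<close> into
the non-negative gain \<open>(lam - al) * u\<close>.
\<close>

definition src :: "(bool \<Rightarrow> real \<Rightarrow> real \<Rightarrow> ennreal) \<Rightarrow> bool \<Rightarrow> real \<Rightarrow> real \<Rightarrow> ennreal" where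
  "src u k t x = ennreal (lam - al k t x) * u k t x + ennreal (al k t x) * u (\<not> k) t (1 - x)"

text \<open>
The second Boolean index is the sign: \<open>True\<close> for positive and \<open>False\<close> for negative parts. A
negative reflection coefficient exchanges the two, whence the comparison of \<open>s\<close> with \<open>c k < 0\<close>.
\<close>

definition inflow :: "(bool \<Rightarrow> real) \<Rightarrow> (bool \<Rightarrow> bool \<Rightarrow> real \<Rightarrow> ennreal) \<Rightarrow>
    (bool \<Rightarrow> bool \<Rightarrow> real \<Rightarrow> real \<Rightarrow> ennreal) \<Rightarrow> bool \<Rightarrow> bool \<Rightarrow> real \<Rightarrow> ennreal" where
  "inflow c f u k s z = (if z < 1 then f k s z else ennreal \<bar>c k\<bar> * u (\<not> k) (s \<noteq> (c k < 0)) (z - 1) 0)"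

definition picard :: "(bool \<Rightarrow> real) \<Rightarrow> (bool \<Rightarrow> bool \<Rightarrow> real \<Rightarrow> ennreal) \<Rightarrow>
    (bool \<Rightarrow> bool \<Rightarrow> real \<Rightarrow> real \<Rightarrow> ennreal) \<Rightarrow> bool \<Rightarrow> bool \<Rightarrow> real \<Rightarrow> real \<Rightarrow> ennreal" where
  "picard c f u k s = transport (inflow c f u k s) (src (\<lambda>k. u k s) k)"

primrec iter :: "(bool \<Rightarrow> real) \<Rightarrow> (bool \<Rightarrow> bool \<Rightarrow> real \<Rightarrow> ennreal) \<Rightarrow> nat \<Rightarrow>
    bool \<Rightarrow> bool \<Rightarrow> real \<Rightarrow> real \<Rightarrow> ennreal" where
  "iter c f 0 = (\<lambda>k s t x. 0)"
| "iter c f (Suc n) = picard c f (iter c f n)"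

definition sol :: "(bool \<Rightarrow> real) \<Rightarrow> (bool \<Rightarrow> bool \<Rightarrow> real \<Rightarrow> ennreal) \<Rightarrow>
    bool \<Rightarrow> bool \<Rightarrow> real \<Rightarrow> real \<Rightarrow> ennreal" where
  "sol c f k s t x = (SUP n. iter c f n k s t x)"

lemma src_measurable:
  assumes [measurable]: "\<And>k. case_prod (u k) \<in> borel2"
  shows "case_prod (src u k) \<in> borel2"
  unfolding src_def split_beta' by measurable

lemma inflow_measurable:
  assumes [measurable]: "\<And>k s. case_prod (u k s) \<in> borel2"
    "\<And>k s. f k s \<in> borel_measurable borel"
  shows "inflow c f u k s \<in> borel_measurable borel"
  unfolding inflow_def split_beta' by measurable

lemma picard_measurable:
  assumes "\<And>k s. case_prod (u k s) \<in> borel2"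
    "\<And>k s. f k s \<in> borel_measurable borel"
  shows "case_prod (picard c f u k s) \<in> borel2"
  unfolding picard_def by (intro transport_measurable inflow_measurable src_measurable assms)

lemma iter_measurable [measurable]:
  assumes "\<And>k s. f k s \<in> borel_measurable borel"
  shows "case_prod (iter c f n k s) \<in> borel2"
proof (induction n arbitrary: k s)
  case (Suc n)
  then show ?case unfolding iter.simps by (intro picard_measurable assms)
qed simp

lemma sol_measurable [measurable]:
  assumes [measurable]: "\<And>k s. f k s \<in> borel_measurable borel"
  shows "case_prod (sol c f k s) \<in> borel2"
  unfolding sol_def split_beta' by measurable

lemma picard_mono:
  assumes "\<And>k s t x. u k s t x \<le> v k s t x"
  shows "picard c f u k s t x \<le> picard c f v k s t x"
  unfolding picard_def
  by (intro transport_mono) (auto simp: src_def inflow_def intro!: add_mono mult_left_mono assms)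

lemma iter_le_Suc: "iter c f n k s t x \<le> iter c f (Suc n) k s t x"
proof (induction n arbitrary: k s t x)
  case (Suc n)
  show ?case
    using picard_mono[of "iter c f n" "iter c f (Suc n)"] Suc by simp
qed simp

lemma iter_mono: "m \<le> n \<Longrightarrow> iter c f m k s t x \<le> iter c f n k s t x"
  by (rule lift_Suc_mono_le[of "\<lambda>n. iter c f n k s t x"]) (rule iter_le_Suc)

text \<open>
Monotone convergence; where the iterates blow up, both sides are infinite.
\<close>

lemma sol_fixpoint:
  assumes [measurable]: "\<And>k s. f k s \<in> borel_measurable borel"
  shows "sol c f k s = picard c f (sol c f) k s"
proof (intro ext)
  fix t x
  have inc: "incseq (\<lambda>n. iter c f n k' s' t' x')" for k' s' t' x'
    by (auto simp: incseq_def intro: iter_mono)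
  have src: "src (\<lambda>k. sol c f k s) k = (\<lambda>t x. SUP n. src (\<lambda>k. iter c f n k s) k t x)"
    unfolding src_def sol_def SUP_mult_left_ennreal
    by (intro ext ennreal_SUP_add[symmetric]) (auto simp: incseq_def intro!: mult_left_mono iter_mono)
  have inflow: "inflow c f (sol c f) k s = (\<lambda>z. SUP n. inflow c f (iter c f n) k s z)"
    unfolding inflow_def sol_def SUP_mult_left_ennreal by auto
  have "picard c f (sol c f) k s t x = (SUP n. picard c f (iter c f n) k s t x)"
    unfolding picard_def src inflow
  proof (rule transport_SUP)
    show "case_prod (src (\<lambda>k. iter c f n k s) k) \<in> borel2" for n
      by (intro src_measurable iter_measurable assms)
  qed (auto simp: incseq_def le_fun_def inflow_def src_def intro!: add_mono mult_left_mono iter_mono)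
  also have "\<dots> = (SUP n. iter c f (Suc n) k s t x)" by simp
  also have "\<dots> = sol c f k s t x"
    unfolding sol_def
  proof (rule antisym)
    show "(SUP n. iter c f n k s t x) \<le> (SUP n. iter c f (Suc n) k s t x)"
      by (intro SUP_mono) (metis UNIV_I iter_le_Suc)
    show "(SUP n. iter c f (Suc n) k s t x) \<le> (SUP n. iter c f n k s t x)"
      by (intro SUP_mono) (metis UNIV_I order_refl)
  qed
  finally show "sol c f k s t x = picard c f (sol c f) k s t x" ..
qed

text \<open>
The right-hand side is a supersolution for the sum of the two parts: the sum is insensitive to the
exchange of signs at the boundary, the function \<open>\<beta> * exp (lam * t)\<close> solves the equation in the interior,
and the boundary can only decrease it because \<open>\<bar>c k\<bar> \<le> \<kappa> \<le> 1\<close>.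
\<close>

lemma iter_comparison:
  fixes \<alpha> \<beta> :: real
  assumes [measurable]: "\<And>k s. f k s \<in> borel_measurable borel" "\<And>k. r k \<in> borel_measurable borel"
    and ab: "0 \<le> \<alpha>" "0 \<le> \<beta>" and c: "\<And>k. \<bar>c k\<bar> \<le> \<kappa>" "\<kappa> \<le> 1"
    and data: "\<And>k z. ennreal \<alpha> * (f k True z + f k False z) \<le> ennreal \<beta> + r k z"
  shows "0 \<le> t \<Longrightarrow> 0 \<le> x \<Longrightarrow> x \<le> 1 \<Longrightarrow>
    ennreal \<alpha> * (iter c f n k True t x + iter c f n k False t x)
      \<le> ennreal (\<beta> * exp (lam * t)) + iter (\<lambda>_. \<kappa>) (\<lambda>k _. r k) n k True t x"
proof (induction n arbitrary: k t x)
  case (Suc n)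
  let ?u = "iter c f n" and ?v = "iter (\<lambda>_. \<kappa>) (\<lambda>k _. r k) n"
  have \<kappa>: "0 \<le> \<kappa>" using c(1)[of True] by linarith
  have mu [measurable]: "case_prod (?u k s) \<in> borel2" for k s by measurable
  have mv [measurable]: "case_prod (?v k s) \<in> borel2" for k s by measurable
  have ms [measurable]: "case_prod (src (\<lambda>k. ?u k s) k) \<in> borel2" for s k
    by (rule src_measurable) measurable
  have mt [measurable]: "case_prod (src (\<lambda>k. ?v k s) k) \<in> borel2" for s k
    by (rule src_measurable) measurable
  have "ennreal \<alpha> * (picard c f ?u k True t x + picard c f ?u k False t x)
      = transport (\<lambda>z. ennreal \<alpha> * (inflow c f ?u k True z + inflow c f ?u k False z))
         (\<lambda>t x. ennreal \<alpha> * (src (\<lambda>k. ?u k True) k t x + src (\<lambda>k. ?u k False) k t x)) t x"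
    unfolding picard_def by (simp add: transport_add transport_cmult)
  also have "\<dots> \<le> transport (\<lambda>z. ennreal \<beta> * ennreal (exp (lam * entry z)) + inflow (\<lambda>_. \<kappa>) (\<lambda>k _. r k) ?v k True z)
         (\<lambda>t x. ennreal \<beta> * ennreal (lam * exp (lam * t)) + src (\<lambda>k. ?v k True) k t x) t x"
  proof (rule transport_le)
    show "ennreal \<alpha> * (inflow c f ?u k True (x + t) + inflow c f ?u k False (x + t))
      \<le> ennreal \<beta> * ennreal (exp (lam * entry (x + t))) + inflow (\<lambda>_. \<kappa>) (\<lambda>k _. r k) ?v k True (x + t)"
    proof (cases "x + t < 1")
      case True
      then show ?thesis using data[of k "x + t"] by (simp add: inflow_def entry_def)
    next
      case False
      let ?U = "\<lambda>s. ?u (\<not> k) s (x + t - 1) 0"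
      have "?U (True \<noteq> (c k < 0)) + ?U (False \<noteq> (c k < 0)) = ?U True + ?U False"
        by (cases "c k < 0") (auto simp: add.commute)
      then have "ennreal \<alpha> * (inflow c f ?u k True (x + t) + inflow c f ?u k False (x + t))
          = ennreal \<bar>c k\<bar> * (ennreal \<alpha> * (?U True + ?U False))"
        using False by (simp add: inflow_def distrib_left[symmetric] mult.left_commute)
      also have "\<dots> \<le> ennreal \<bar>c k\<bar> * (ennreal (\<beta> * exp (lam * (x + t - 1))) + ?v (\<not> k) True (x + t - 1) 0)"
        using Suc.IH[of "x + t - 1" 0 "\<not> k"] False by (intro mult_left_mono) auto
      also have "\<dots> = ennreal \<bar>c k\<bar> * ennreal (\<beta> * exp (lam * (x + t - 1))) + ennreal \<bar>c k\<bar> * ?v (\<not> k) True (x + t - 1) 0"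
        by (simp add: distrib_left)
      also have "\<dots> \<le> 1 * ennreal (\<beta> * exp (lam * (x + t - 1))) + ennreal \<bar>\<kappa>\<bar> * ?v (\<not> k) True (x + t - 1) 0"
        using c(1)[of k] c(2) \<kappa> by (intro add_mono mult_right_mono) (auto intro!: ennreal_leI)
      also have "\<dots> = ennreal \<beta> * ennreal (exp (lam * entry (x + t))) + inflow (\<lambda>_. \<kappa>) (\<lambda>k _. r k) ?v k True (x + t)"
        using False \<kappa> ab by (simp add: inflow_def entry_def ennreal_mult')
      finally show ?thesis .
    qed
    fix s y :: real assume sy: "0 \<le> s" "0 \<le> y" "y \<le> 1"
    have "ennreal \<alpha> * (src (\<lambda>k. ?u k True) k s y + src (\<lambda>k. ?u k False) k s y)
      = ennreal (lam - al k s y) * (ennreal \<alpha> * (?u k True s y + ?u k False s y))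
        + ennreal (al k s y) * (ennreal \<alpha> * (?u (\<not> k) True s (1 - y) + ?u (\<not> k) False s (1 - y)))"
      unfolding src_def by (simp add: algebra_simps)
    also have "\<dots> \<le> ennreal (lam - al k s y) * (ennreal (\<beta> * exp (lam * s)) + ?v k True s y)
        + ennreal (al k s y) * (ennreal (\<beta> * exp (lam * s)) + ?v (\<not> k) True s (1 - y))"
      using Suc.IH[of s y k] Suc.IH[of s "1 - y" "\<not> k"] sy by (intro add_mono mult_left_mono) auto
    also have "\<dots> = (ennreal (lam - al k s y) + ennreal (al k s y)) * ennreal (\<beta> * exp (lam * s)) + src (\<lambda>k. ?v k True) k s y"
      unfolding src_def by (simp add: algebra_simps)
    also have "ennreal (lam - al k s y) + ennreal (al k s y) = ennreal lam"
      using al_nonneg al_le by (simp flip: ennreal_plus)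
    also have "ennreal lam * ennreal (\<beta> * exp (lam * s)) = ennreal \<beta> * ennreal (lam * exp (lam * s))"
      using ab lam_pos by (simp add: mult.left_commute flip: ennreal_mult)
    finally show "ennreal \<alpha> * (src (\<lambda>k. ?u k True) k s y + src (\<lambda>k. ?u k False) k s y)
      \<le> ennreal \<beta> * ennreal (lam * exp (lam * s)) + src (\<lambda>k. ?v k True) k s y" .
  qed (use Suc.prems in auto)
  also have "\<dots> = ennreal \<beta> * transport (\<lambda>z. ennreal (exp (lam * entry z))) (\<lambda>t x. ennreal (lam * exp (lam * t))) t x
      + picard (\<lambda>_. \<kappa>) (\<lambda>k _. r k) ?v k True t x"
    unfolding picard_def by (simp add: transport_add transport_cmult split_beta')
  also have "transport (\<lambda>z. ennreal (exp (lam * entry z))) (\<lambda>t x. ennreal (lam * exp (lam * t))) t x = ennreal (exp (lam * t))"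
    using Suc.prems lam_pos by (intro transport_exp) auto
  finally show ?case using ab by (simp add: ennreal_mult')
qed simp

text \<open>
Used with the slope and the intercept of a tangent of \<open>y powr p\<close> as \<open>\<alpha>\<close> and \<open>\<beta>\<close>. The family of all
tangents recovers the convex function, so this linear statement carries the whole \<open>Lp\<close> estimate.
\<close>

lemma sol_comparison:
  fixes \<alpha> \<beta> :: real
  assumes "\<And>k s. f k s \<in> borel_measurable borel" "\<And>k. r k \<in> borel_measurable borel"
    and "0 \<le> \<alpha>" "0 \<le> \<beta>" and "\<And>k. \<bar>c k\<bar> \<le> \<kappa>" "\<kappa> \<le> 1"
    and "\<And>k z. ennreal \<alpha> * (f k True z + f k False z) \<le> ennreal \<beta> + r k z"
    and "0 \<le> t" "0 \<le> x" "x \<le> 1"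
  shows "ennreal \<alpha> * (sol c f k True t x + sol c f k False t x)
      \<le> ennreal (\<beta> * exp (lam * t)) + sol (\<lambda>_. \<kappa>) (\<lambda>k _. r k) k True t x"
proof -
  have "sol c f k True t x + sol c f k False t x = (SUP n. iter c f n k True t x + iter c f n k False t x)"
    unfolding sol_def by (intro ennreal_SUP_add[symmetric]) (auto simp: incseq_def intro!: iter_mono)
  moreover have "ennreal \<alpha> * (SUP n. iter c f n k True t x + iter c f n k False t x)
      \<le> ennreal (\<beta> * exp (lam * t)) + sol (\<lambda>_. \<kappa>) (\<lambda>k _. r k) k True t x"
    unfolding SUP_mult_left_ennreal
  proof (rule SUP_least)
    fix n
    have "iter (\<lambda>_. \<kappa>) (\<lambda>k _. r k) n k True t x \<le> sol (\<lambda>_. \<kappa>) (\<lambda>k _. r k) k True t x"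
      unfolding sol_def by (rule SUP_upper) simp
    then show "ennreal \<alpha> * (iter c f n k True t x + iter c f n k False t x)
        \<le> ennreal (\<beta> * exp (lam * t)) + sol (\<lambda>_. \<kappa>) (\<lambda>k _. r k) k True t x"
      by (intro order_trans[OF iter_comparison[of f r \<alpha> \<beta> c \<kappa>]] assms add_mono) auto
  qed
  ultimately show ?thesis by simp
qed

end

section \<open>Weights that decay under the positive system\<close>

text \<open>
Without the factor \<open>exp (eps * x)\<close> the weights would be \<open>a x = 1 - (1 - q) * exp (- lam * x)\<close> for
\<open>\<rho>\<close> and \<open>1\<close> for \<open>\<xi>\<close>: here \<open>a\<close> rises from \<open>q\<close> with slope \<open>lam * (1 - a)\<close>, which balances the exchange
at its maximal rate, and it stays below \<open>1\<close>. The gap \<open>a 1 = \<theta> < 1\<close> leaves room to tilt the two weights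
in opposite directions by a rate \<open>eps\<close> with \<open>exp (2 * eps) * \<theta> = 1\<close>, without losing the order of the
weights. The weight of \<open>\<xi>\<close> is stated in the reflected variable.
\<close>

lemma ex_weights:
  fixes lam q :: real
  assumes "0 < lam" "0 < q" "q < 1"
  obtains eps :: real and w w' :: "bool \<Rightarrow> real \<Rightarrow> real" where "0 < eps"
    "\<And>k x. (w k has_real_derivative w' k x) (at x)"
    "\<And>k. w' k \<in> borel_measurable borel"
    "\<And>k x. 0 \<le> x \<Longrightarrow> x \<le> 1 \<Longrightarrow> q \<le> w k x"
    "\<And>k x. 0 \<le> x \<Longrightarrow> x \<le> 1 \<Longrightarrow> w k x \<le> 1"
    "\<And>k x. 0 \<le> x \<Longrightarrow> x \<le> 1 \<Longrightarrow> eps * w k x \<le> w' k x"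
    "\<And>k x. 0 \<le> x \<Longrightarrow> x \<le> 1 \<Longrightarrow> lam * w (\<not> k) (1 - x) \<le> (lam - eps) * w k x + w' k x"
    "\<And>k. q * w k 1 \<le> w (\<not> k) 0"
proof -
  define \<theta> where "\<theta> = 1 - (1 - q) * exp (- lam)"
  define eps where "eps = - ln \<theta> / 2"
  define a where "a x = 1 - (1 - q) * exp (- lam * x)" for x
  define w where "w k x = (if k then exp (- eps * (1 - x)) else exp (eps * x) * a x)" for k x
  define w' where "w' k x = (if k then eps * exp (- eps * (1 - x))
     else eps * (exp (eps * x) * a x) + exp (eps * x) * (lam * (1 - a x)))" for k x
  have "(1 - q) * exp (- lam) < (1 - q) * 1" using assms by (intro mult_strict_left_mono) auto
  moreover have "0 < (1 - q) * exp (- lam)" using assms by simp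
  moreover have "\<theta> + (1 - q) * exp (- lam) = 1" by (simp add: \<theta>_def)
  ultimately have \<theta>: "q < \<theta>" "\<theta> < 1" by simp_all
  then have "0 < \<theta>" using assms by simp
  note \<theta> = \<theta> this
  then have eps: "0 < eps" by (simp add: eps_def)
  have exp_eps: "exp (- eps) * exp (- eps) = \<theta>" using \<theta> by (simp add: eps_def flip: exp_add)
  have a_mono: "a x \<le> a y" if "x \<le> y" for x y
    unfolding a_def using assms that by (intro diff_left_mono mult_left_mono) auto
  have a0: "a 0 = q" and a1: "a 1 = \<theta>" by (auto simp: a_def \<theta>_def)
  have a_ge: "q \<le> a x" if "0 \<le> x" for x using a_mono[OF that] a0 by simp
  \<comment> \<open>The weight of \<open>\<rho>\<close> stays below the one of \<open>\<xi>\<close>; at \<open>x = 1\<close> this is an equality, which fixes \<open>eps\<close>.\<close>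
  have key: "exp (eps * x) * a x \<le> exp (- eps * x)" if "0 \<le> x" "x \<le> 1" for x
  proof -
    have "exp (eps * x) * a x \<le> exp (eps * x) * (exp (- eps) * exp (- eps))"
      using a_mono[OF that(2)] a1 exp_eps by (intro mult_left_mono) auto
    also have "\<dots> = exp (eps * x - 2 * eps)" by (simp add: algebra_simps flip: exp_add)
    also have "\<dots> \<le> exp (- eps * x)" using that eps by (simp add: algebra_simps)
    finally show ?thesis .
  qed
  show thesis
  proof (rule that[of eps w w'])
    show "(w k has_real_derivative w' k x) (at x)" for k x
    proof (cases k)
      case True
      then show ?thesis unfolding w_def w'_def by (auto intro!: derivative_eq_intros)
    next
      case False
      have "((\<lambda>x. exp (eps * x) * a x) has_real_derivative
         eps * (exp (eps * x) * a x) + exp (eps * x) * (lam * (1 - a x))) (at x)"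
        unfolding a_def by (auto intro!: derivative_eq_intros simp: algebra_simps)
      then show ?thesis using False unfolding w_def w'_def by simp
    qed
    show "w' k \<in> borel_measurable borel" for k
      unfolding w'_def a_def by measurable
    fix k x assume x: "0 \<le> x" "x \<le> (1::real)"
    have "\<theta> \<le> exp (- eps * (1 - x))"
    proof -
      have "\<theta> = exp (- eps - eps)" using exp_eps by (simp flip: exp_add)
      also have "\<dots> \<le> exp (- eps * (1 - x))"
      proof -
        have "0 \<le> eps * x" and "- eps * (1 - x) = - eps + eps * x"
          using x eps by (auto simp: algebra_simps)
        then show ?thesis using eps by (subst exp_le_cancel_iff) linarith
      qed
      finally show ?thesis .
    qed
    moreover have "q \<le> exp (eps * x) * a x"
    proof -
      have "1 * q \<le> exp (eps * x) * a x" using a_ge[of x] x eps assms by (intro mult_mono) auto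
      then show ?thesis by simp
    qed
    ultimately show "q \<le> w k x" using \<theta> by (simp add: w_def)
    have "exp (- eps * x) \<le> 1" using x eps by simp
    then have "exp (eps * x) * a x \<le> 1" using key[OF x] by linarith
    then show "w k x \<le> 1" using x eps by (auto simp: w_def)
    have a_le: "a x \<le> 1" unfolding a_def using assms by simp
    then show "eps * w k x \<le> w' k x" using assms by (auto simp: w_def w'_def)
    show "lam * w (\<not> k) (1 - x) \<le> (lam - eps) * w k x + w' k x"
    proof (cases k)
      case True
      have "lam * (exp (eps * (1 - x)) * a (1 - x)) \<le> lam * exp (- eps * (1 - x))"
        using key[of "1 - x"] x assms by (intro mult_left_mono) auto
      then show ?thesis using True by (simp add: w_def w'_def algebra_simps)
    next
      case False
      have "exp (- eps * x) \<le> exp (eps * x)" using x eps by simp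
      then have "lam * exp (- eps * x) \<le> lam * exp (eps * x)" using assms by (intro mult_left_mono) auto
      then show ?thesis using False by (simp add: w_def w'_def algebra_simps)
    qed
  next
    fix k
    have "q * (exp eps * \<theta>) \<le> 1 * (exp eps * \<theta>)" using assms \<theta> by (intro mult_right_mono) auto
    also have "\<dots> \<le> exp (- eps)" using key[of 1] a1 by simp
    finally show "q * w k 1 \<le> w (\<not> k) 0" using a0 a1 by (simp add: w_def)
  qed (rule eps)
qed

text \<open>
The reflection coefficients of the positive system will be \<open>q\<^sup>2\<close>, whereas the weights only
absorb a factor \<open>q\<close> at the boundary. The remaining factor \<open>q < 1\<close> controls the outflow.
\<close>

locale weighted_coupling = coupling +
  fixes q eps :: real and w w' :: "bool \<Rightarrow> real \<Rightarrow> real"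
  assumes q: "0 < q" "q < 1" and eps: "0 < eps"
    and w_deriv: "\<And>k x. (w k has_real_derivative w' k x) (at x)"
    and w'_measurable [measurable]: "\<And>k. w' k \<in> borel_measurable borel"
    and w_ge: "\<And>k x. 0 \<le> x \<Longrightarrow> x \<le> 1 \<Longrightarrow> q \<le> w k x"
    and w_le: "\<And>k x. 0 \<le> x \<Longrightarrow> x \<le> 1 \<Longrightarrow> w k x \<le> 1"
    and w_growth: "\<And>k x. 0 \<le> x \<Longrightarrow> x \<le> 1 \<Longrightarrow> eps * w k x \<le> w' k x"
    and w_exchange: "\<And>k x. 0 \<le> x \<Longrightarrow> x \<le> 1 \<Longrightarrow> lam * w (\<not> k) (1 - x) \<le> (lam - eps) * w k x + w' k x"
    and w_boundary: "\<And>k. q * w k 1 \<le> w (\<not> k) 0"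
begin

text \<open>
The factor \<open>exp (- lam * t)\<close> undoes the change of variables, \<open>exp (eps * t)\<close> is the rate of decay.
\<close>

definition \<Phi> :: "bool \<Rightarrow> real \<Rightarrow> real \<Rightarrow> real" where
  "\<Phi> k t x = exp ((eps - lam) * t) * w k x"

text \<open>
Minus the derivative of \<open>\<Phi>\<close> along the lines.
\<close>

definition \<Psi> :: "bool \<Rightarrow> real \<Rightarrow> real \<Rightarrow> real" where
  "\<Psi> k t x = exp ((eps - lam) * t) * ((lam - eps) * w k x + w' k x)"

text \<open>
The positive system that majorizes \<open>p\<close>-th powers. Its data and coefficients are non-negative, so both sign
indices carry the same function and \<open>True\<close> stands for either.
\<close>

abbreviation R :: "(bool \<Rightarrow> real \<Rightarrow> ennreal) \<Rightarrow> bool \<Rightarrow> real \<Rightarrow> real \<Rightarrow> ennreal" where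
  "R r k \<equiv> sol (\<lambda>_. q\<^sup>2) (\<lambda>k _. r k) k True"

lemma w_measurable [measurable]: "w k \<in> borel_measurable borel"
  by (rule borel_measurable_continuous_onI)
     (meson DERIV_isCont continuous_at_imp_continuous_on w_deriv)

lemma w_pos: "0 \<le> x \<Longrightarrow> x \<le> 1 \<Longrightarrow> 0 \<le> w k x"
  using w_ge[of x k] q by linarith

lemma \<Phi>_measurable [measurable]: "case_prod (\<Phi> k) \<in> borel2"
  unfolding \<Phi>_def split_beta' by measurable

lemma \<Psi>_measurable [measurable]: "case_prod (\<Psi> k) \<in> borel2"
  unfolding \<Psi>_def split_beta' by measurable

lemma \<Phi>_nonneg: "0 \<le> x \<Longrightarrow> x \<le> 1 \<Longrightarrow> 0 \<le> \<Phi> k t x"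
  by (simp add: \<Phi>_def w_pos)

lemma \<Psi>_nonneg: "0 \<le> x \<Longrightarrow> x \<le> 1 \<Longrightarrow> 0 \<le> \<Psi> k t x"
  unfolding \<Psi>_def using w_exchange[of x k] w_pos[of "1 - x" "\<not> k"] lam_pos
  by (intro mult_nonneg_nonneg order_trans[OF _ w_exchange]) auto

lemma \<Phi>_deriv: "((\<lambda>\<tau>. \<Phi> k \<tau> (z - \<tau>)) has_real_derivative - \<Psi> k t (z - t)) (at t)"
proof -
  have "((\<lambda>\<tau>. w k (z - \<tau>)) has_real_derivative w' k (z - t) * (0 - 1)) (at t)"
    by (rule DERIV_chain2[OF w_deriv]) (auto intro!: derivative_eq_intros)
  then show ?thesis
    unfolding \<Phi>_def \<Psi>_def by (auto intro!: derivative_eq_intros simp: algebra_simps)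
qed

text \<open>
The inequality is affine in \<open>al k t x\<close>, a convex combination of \<open>w_growth\<close> (no exchange) and
\<open>w_exchange\<close> (exchange at rate \<open>lam\<close>).
\<close>

lemma exchange_weight:
  assumes "0 \<le> x" "x \<le> 1"
  shows "\<Phi> k t x * (lam - al k t x) + \<Phi> (\<not> k) t (1 - x) * al k t x \<le> \<Psi> k t x"
proof -
  let ?X = "(lam - eps) * w k x + w' k x"
  have "(lam - al k t x) * (lam * w k x) + al k t x * (lam * w (\<not> k) (1 - x))
      \<le> (lam - al k t x) * ?X + al k t x * ?X"
    using al_nonneg al_le w_growth[OF assms] w_exchange[OF assms]
    by (intro add_mono mult_left_mono) (auto simp: algebra_simps)
  then have "lam * (w k x * (lam - al k t x) + w (\<not> k) (1 - x) * al k t x) \<le> lam * ?X"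
    by (simp add: algebra_simps)
  then have "w k x * (lam - al k t x) + w (\<not> k) (1 - x) * al k t x \<le> ?X"
    using lam_pos by simp
  then have "exp ((eps - lam) * t) * (w k x * (lam - al k t x) + w (\<not> k) (1 - x) * al k t x)
      \<le> exp ((eps - lam) * t) * ?X"
    by (intro mult_left_mono) auto
  then show ?thesis by (simp add: \<Phi>_def \<Psi>_def algebra_simps)
qed

text \<open>
Reflecting the exchanged mass back to its origin charges each component with the weight of both
places, which is what \<open>exchange_weight\<close> compares with \<open>\<Psi>\<close>.
\<close>

lemma src_energy:
  assumes [measurable]: "\<And>k. case_prod (u k) \<in> borel2"
  shows "(\<Sum>k\<in>UNIV. \<integral>\<^sup>+x\<in>{0..1}. ennreal (\<Phi> k t x) * src u k t x \<partial>lborel)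
      \<le> (\<Sum>k\<in>UNIV. \<integral>\<^sup>+x\<in>{0..1}. ennreal (\<Psi> k t x) * u k t x \<partial>lborel)"
proof -
  define A where "A k = (\<integral>\<^sup>+x\<in>{0..1}. ennreal (\<Phi> k t x * (lam - al k t x)) * u k t x \<partial>lborel)" for k
  define B where "B k = (\<integral>\<^sup>+x\<in>{0..1}. ennreal (\<Phi> (\<not> k) t (1 - x) * al k t x) * u k t x \<partial>lborel)" for k
  have "(\<integral>\<^sup>+x\<in>{0..1}. ennreal (\<Phi> k t x) * src u k t x \<partial>lborel) = A k + B (\<not> k)" for k
  proof -
    have "(\<integral>\<^sup>+x\<in>{0..1}. ennreal (\<Phi> k t x) * src u k t x \<partial>lborel)
        = (\<integral>\<^sup>+x. ennreal (\<Phi> k t x * (lam - al k t x)) * u k t x * indicator {0..1} x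
             + ennreal (\<Phi> k t x * al k t x) * u (\<not> k) t (1 - x) * indicator {0..1} x \<partial>lborel)"
      using \<Phi>_nonneg al_le al_nonneg
      by (intro nn_integral_cong)
         (auto simp: src_def indicator_def ennreal_mult' distrib_left mult.assoc)
    also have "\<dots> = A k + (\<integral>\<^sup>+x\<in>{0..1}. ennreal (\<Phi> k t x * al k t x) * u (\<not> k) t (1 - x) \<partial>lborel)"
      unfolding A_def by (rule nn_integral_add) measurable
    also have "(\<integral>\<^sup>+x\<in>{0..1}. ennreal (\<Phi> k t x * al k t x) * u (\<not> k) t (1 - x) \<partial>lborel)
      = (\<integral>\<^sup>+x. ennreal (\<Phi> k t (1 - (1 - x)) * al k t (1 - (1 - x))) * u (\<not> k) t (1 - x) * indicator {0..1} (1 - x) \<partial>lborel)"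
      by (intro nn_integral_cong) (auto simp: indicator_def)
    also have "\<dots> = (\<integral>\<^sup>+x\<in>{0..1}. ennreal (\<Phi> k t (1 - x) * al k t (1 - x)) * u (\<not> k) t x \<partial>lborel)"
      by (rule nn_integral_flip[where f="\<lambda>x. ennreal (\<Phi> k t (1 - x) * al k t (1 - x)) * u (\<not> k) t x * indicator {0..1} x"]) measurable
    also have "\<dots> = B (\<not> k)"
      unfolding B_def using al_reflect[of "\<not> k"] by simp
    finally show ?thesis .
  qed
  then have "(\<Sum>k\<in>UNIV. \<integral>\<^sup>+x\<in>{0..1}. ennreal (\<Phi> k t x) * src u k t x \<partial>lborel) = (\<Sum>k\<in>UNIV. A k + B k)"
    by (simp add: sum.distrib sum_bool_flip)
  also have "\<dots> \<le> (\<Sum>k\<in>UNIV. \<integral>\<^sup>+x\<in>{0..1}. ennreal (\<Psi> k t x) * u k t x \<partial>lborel)"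
  proof (rule sum_mono)
    fix k :: bool
    have "A k + B k = (\<integral>\<^sup>+x. ennreal (\<Phi> k t x * (lam - al k t x)) * u k t x * indicator {0..1} x
        + ennreal (\<Phi> (\<not> k) t (1 - x) * al k t x) * u k t x * indicator {0..1} x \<partial>lborel)"
      unfolding A_def B_def by (rule nn_integral_add[symmetric]) measurable
    also have "\<dots> \<le> (\<integral>\<^sup>+x\<in>{0..1}. ennreal (\<Psi> k t x) * u k t x \<partial>lborel)"
    proof (rule nn_integral_mono)
      fix x
      show "ennreal (\<Phi> k t x * (lam - al k t x)) * u k t x * indicator {0..1} x
        + ennreal (\<Phi> (\<not> k) t (1 - x) * al k t x) * u k t x * indicator {0..1} x
        \<le> ennreal (\<Psi> k t x) * u k t x * indicator {0..1} x"
      proof (cases "x \<in> {0..1}")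
        case True
        then have "ennreal (\<Phi> k t x * (lam - al k t x)) + ennreal (\<Phi> (\<not> k) t (1 - x) * al k t x) \<le> ennreal (\<Psi> k t x)"
          using exchange_weight[of x k t] \<Phi>_nonneg[of x k t] \<Phi>_nonneg[of "1 - x" "\<not> k" t] al_nonneg[of k t x] al_le[of k t x]
          by (metis diff_ge_0_iff_ge ennreal_leI ennreal_plus mult_nonneg_nonneg True atLeastAtMost_iff
              diff_le_eq le_add_same_cancel1)
        then have "(ennreal (\<Phi> k t x * (lam - al k t x)) + ennreal (\<Phi> (\<not> k) t (1 - x) * al k t x)) * u k t x
            \<le> ennreal (\<Psi> k t x) * u k t x"
          by (rule mult_right_mono) simp
        then show ?thesis using True by (simp add: distrib_right)
      qed simp
    qed
    finally show "A k + B k \<le> (\<integral>\<^sup>+x\<in>{0..1}. ennreal (\<Psi> k t x) * u k t x \<partial>lborel)" .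
  qed
  finally show ?thesis .
qed

end

section \<open>Decay and outflow of the positive system\<close>

context weighted_coupling begin

text \<open>
The estimate for one Picard step; \<open>b\<close> is the outflow at \<open>x = 0\<close>, \<open>D\<close> the mass at time \<open>T\<close> and \<open>Q\<close>
the dissipation in the interior, all weighted.
\<close>

lemma energy_step:
  fixes r :: "bool \<Rightarrow> real \<Rightarrow> ennreal" and T :: real
  assumes [measurable]: "\<And>k. r k \<in> borel_measurable borel" and T: "0 \<le> T"
  defines "u \<equiv> \<lambda>n k. iter (\<lambda>_. q\<^sup>2) (\<lambda>k _. r k) n k True"
  defines "b \<equiv> \<lambda>n. \<Sum>k\<in>UNIV. \<integral>\<^sup>+t\<in>{0..T}. ennreal (\<Phi> k t 0) * u n k t 0 \<partial>lborel"
  defines "D \<equiv> \<lambda>n. \<Sum>k\<in>UNIV. \<integral>\<^sup>+x\<in>{0..1}. ennreal (\<Phi> k T x) * u n k T x \<partial>lborel"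
  defines "Q \<equiv> \<lambda>n. \<Sum>k\<in>UNIV. \<integral>\<^sup>+t\<in>{0..T}. (\<integral>\<^sup>+x\<in>{0..1}. ennreal (\<Psi> k t x) * u n k t x \<partial>lborel) \<partial>lborel"
  shows "b (Suc n) + D (Suc n) + Q (Suc n)
    \<le> (\<Sum>k\<in>UNIV. \<integral>\<^sup>+x\<in>{0..1}. r k x \<partial>lborel) + ennreal q * b n + Q n"
proof -
  let ?f = "\<lambda>k _::bool. r k"
  let ?v = "iter (\<lambda>_. q\<^sup>2) ?f n"
  let ?g = "\<lambda>k. inflow (\<lambda>_. q\<^sup>2) ?f ?v k True"
  let ?h = "src (\<lambda>k. ?v k True)"
  have mv [measurable]: "case_prod (?v k s) \<in> borel2" for k s by measurable
  have mg [measurable]: "?g k \<in> borel_measurable borel" for k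
    by (intro inflow_measurable) measurable
  have mh [measurable]: "case_prod (?h k) \<in> borel2" for k
    by (rule src_measurable) measurable
  have u: "u (Suc n) k = transport (?g k) (?h k)" for k
    by (simp add: u_def picard_def)
  have "b (Suc n) + D (Suc n) + Q (Suc n)
      = (\<Sum>k\<in>UNIV. \<integral>\<^sup>+x\<in>{0..1}. ennreal (\<Phi> k 0 x) * ?g k x \<partial>lborel)
        + (\<Sum>k\<in>UNIV. \<integral>\<^sup>+t\<in>{0..T}. ennreal (\<Phi> k t 1) * ?g k (t + 1) \<partial>lborel)
        + (\<Sum>k\<in>UNIV. \<integral>\<^sup>+t\<in>{0..T}. (\<integral>\<^sup>+x\<in>{0..1}. ennreal (\<Phi> k t x) * ?h k t x \<partial>lborel) \<partial>lborel)"
    unfolding b_def D_def Q_def u sum.distrib[symmetric]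
    by (intro sum.cong refl transport_energy T \<Phi>_nonneg \<Psi>_nonneg \<Phi>_deriv) (auto intro!: measurable)
  also have "\<dots> \<le> (\<Sum>k\<in>UNIV. \<integral>\<^sup>+x\<in>{0..1}. r k x \<partial>lborel) + ennreal q * b n + Q n"
  proof (intro add_mono)
    show "(\<Sum>k\<in>UNIV. \<integral>\<^sup>+x\<in>{0..1}. ennreal (\<Phi> k 0 x) * ?g k x \<partial>lborel) \<le> (\<Sum>k\<in>UNIV. \<integral>\<^sup>+x\<in>{0..1}. r k x \<partial>lborel)"
    proof (intro sum_mono nn_integral_mono_AE)
      fix k :: bool
      show "AE x in lborel. ennreal (\<Phi> k 0 x) * ?g k x * indicator {0..1} x \<le> r k x * indicator {0..1} x"
        using AE_lborel_singleton[of 1]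
      proof eventually_elim
        case (elim x)
        show ?case
        proof (cases "x \<in> {0..1}")
          case True
          then have "ennreal (\<Phi> k 0 x) * r k x \<le> 1 * r k x"
            by (intro mult_right_mono) (auto simp: \<Phi>_def w_le)
          then show ?thesis using True elim by (simp add: inflow_def)
        qed simp
      qed
    qed
    show "(\<Sum>k\<in>UNIV. \<integral>\<^sup>+t\<in>{0..T}. ennreal (\<Phi> k t 1) * ?g k (t + 1) \<partial>lborel) \<le> ennreal q * b n"
    proof -
      have "(\<Sum>k\<in>UNIV. \<integral>\<^sup>+t\<in>{0..T}. ennreal (\<Phi> k t 1) * ?g k (t + 1) \<partial>lborel)
          \<le> (\<Sum>k\<in>UNIV. \<integral>\<^sup>+t\<in>{0..T}. ennreal q * (ennreal (\<Phi> (\<not> k) t 0) * u n (\<not> k) t 0) \<partial>lborel)"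
      proof (intro sum_mono nn_integral_mono)
        fix k t
        have "\<Phi> k t 1 * q\<^sup>2 = exp ((eps - lam) * t) * q * (q * w k 1)"
          by (simp add: \<Phi>_def power2_eq_square)
        also have "\<dots> \<le> exp ((eps - lam) * t) * q * w (\<not> k) 0"
          using w_boundary[of k] q by (intro mult_left_mono) auto
        finally have "\<Phi> k t 1 * q\<^sup>2 \<le> q * \<Phi> (\<not> k) t 0"
          by (simp add: \<Phi>_def ac_simps)
        then have "ennreal (\<Phi> k t 1) * ennreal (q\<^sup>2) * u n (\<not> k) t 0 \<le> ennreal q * ennreal (\<Phi> (\<not> k) t 0) * u n (\<not> k) t 0"
          using q \<Phi>_nonneg[of 1 k t] by (intro mult_right_mono) (auto intro!: ennreal_leI simp flip: ennreal_mult')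
        then show "ennreal (\<Phi> k t 1) * ?g k (t + 1) * indicator {0..T} t
            \<le> ennreal q * (ennreal (\<Phi> (\<not> k) t 0) * u n (\<not> k) t 0) * indicator {0..T} t"
          by (auto simp: inflow_def indicator_def u_def mult.assoc)
      qed
      also have "\<dots> = (\<Sum>k\<in>UNIV. ennreal q * (\<integral>\<^sup>+t\<in>{0..T}. ennreal (\<Phi> (\<not> k) t 0) * u n (\<not> k) t 0 \<partial>lborel))"
        unfolding u_def by (subst nn_integral_cmult[symmetric]) (auto simp: mult.assoc)
      also have "\<dots> = ennreal q * b n"
        unfolding b_def sum_distrib_left
        by (rule sum_bool_flip[of "\<lambda>k. ennreal q * (\<integral>\<^sup>+t\<in>{0..T}. ennreal (\<Phi> k t 0) * u n k t 0 \<partial>lborel)"])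
      finally show ?thesis .
    qed
    have "(\<Sum>k\<in>UNIV. \<integral>\<^sup>+t\<in>{0..T}. (\<integral>\<^sup>+x\<in>{0..1}. ennreal (\<Phi> k t x) * ?h k t x \<partial>lborel) \<partial>lborel)
        = (\<integral>\<^sup>+t\<in>{0..T}. (\<Sum>k\<in>UNIV. \<integral>\<^sup>+x\<in>{0..1}. ennreal (\<Phi> k t x) * ?h k t x \<partial>lborel) \<partial>lborel)"
      unfolding sum_distrib_right by (rule nn_integral_sum[symmetric]) measurable
    also have "\<dots> \<le> (\<integral>\<^sup>+t\<in>{0..T}. (\<Sum>k\<in>UNIV. \<integral>\<^sup>+x\<in>{0..1}. ennreal (\<Psi> k t x) * u n k t x \<partial>lborel) \<partial>lborel)"
      unfolding u_def by (intro nn_integral_mono mult_right_mono src_energy) auto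
    also have "\<dots> = Q n"
      unfolding Q_def sum_distrib_right u_def by (rule nn_integral_sum) measurable
    finally show "(\<Sum>k\<in>UNIV. \<integral>\<^sup>+t\<in>{0..T}. (\<integral>\<^sup>+x\<in>{0..1}. ennreal (\<Phi> k t x) * ?h k t x \<partial>lborel) \<partial>lborel) \<le> Q n" .
  qed
  finally show ?thesis .
qed

text \<open>
The iterates increase, so \<open>Q n\<close> on the right of \<open>energy_step\<close> may be replaced by \<open>Q (Suc n)\<close> and
cancelled. This needs \<open>Q (Suc n)\<close> finite, which the same inequality provides by induction.
\<close>

lemma sol_energy:
  fixes r :: "bool \<Rightarrow> real \<Rightarrow> ennreal" and T :: real
  assumes [measurable]: "\<And>k. r k \<in> borel_measurable borel" and T: "0 \<le> T"
    and fin: "(\<Sum>k\<in>UNIV. \<integral>\<^sup>+x\<in>{0..1}. r k x \<partial>lborel) < \<infinity>"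
  shows "(\<Sum>k\<in>UNIV. \<integral>\<^sup>+x\<in>{0..1}. ennreal (\<Phi> k T x) * R r k T x \<partial>lborel)
      + ennreal (1 - q) * (\<Sum>k\<in>UNIV. \<integral>\<^sup>+t\<in>{0..T}. ennreal (\<Phi> k t 0) * R r k t 0 \<partial>lborel)
    \<le> (\<Sum>k\<in>UNIV. \<integral>\<^sup>+x\<in>{0..1}. r k x \<partial>lborel)"
proof -
  define u where "u n k = iter (\<lambda>_. q\<^sup>2) (\<lambda>k _. r k) n k True" for n k
  define b where "b n = (\<Sum>k\<in>UNIV. \<integral>\<^sup>+t\<in>{0..T}. ennreal (\<Phi> k t 0) * u n k t 0 \<partial>lborel)" for n
  define D where "D n = (\<Sum>k\<in>UNIV. \<integral>\<^sup>+x\<in>{0..1}. ennreal (\<Phi> k T x) * u n k T x \<partial>lborel)" for n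
  define Q where "Q n = (\<Sum>k\<in>UNIV. \<integral>\<^sup>+t\<in>{0..T}. (\<integral>\<^sup>+x\<in>{0..1}. ennreal (\<Psi> k t x) * u n k t x \<partial>lborel) \<partial>lborel)" for n
  define I where "I = (\<Sum>k\<in>UNIV. \<integral>\<^sup>+x\<in>{0..1}. r k x \<partial>lborel)"
  have step: "b (Suc n) + D (Suc n) + Q (Suc n) \<le> I + ennreal q * b n + Q n" for n
    using energy_step[of r T n] T unfolding b_def D_def Q_def I_def u_def by simp
  have u_mono: "u m k t x \<le> u n k t x" if "m \<le> n" for m n k t x
    unfolding u_def by (rule iter_mono[OF that])
  have [measurable]: "case_prod (u n k) \<in> borel2" for n k
    unfolding u_def by measurable
  have inc: "incseq b" "incseq D" "incseq Q"
    unfolding incseq_def b_def D_def Q_def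
    by (auto intro!: sum_mono nn_integral_mono mult_left_mono mult_right_mono u_mono)
  \<comment> \<open>The iteration starts with the function \<open>0\<close>, whose energies vanish.\<close>
  have fin_bQ: "b n < \<infinity> \<and> Q n < \<infinity>" for n
  proof (induction n)
    case 0 show ?case by (simp add: b_def Q_def u_def)
  next
    case (Suc n)
    have "I + ennreal q * b n + Q n < \<infinity>"
      using Suc fin by (simp add: I_def ennreal_mult_less_top)
    then have "b (Suc n) + D (Suc n) + Q (Suc n) < \<infinity>"
      using step[of n] by (rule order.strict_trans1[rotated])
    then show ?case by simp
  qed
  have bound: "D n + ennreal (1 - q) * b n \<le> I" for n
  proof -
    have "b (Suc n) + D (Suc n) + Q (Suc n) \<le> I + ennreal q * b (Suc n) + Q (Suc n)"
      using step[of n] inc[THEN incseq_SucD, of n]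
      by (intro order_trans[OF step] add_mono mult_left_mono) auto
    then have "b (Suc n) + D (Suc n) \<le> I + ennreal q * b (Suc n)"
      using fin_bQ[of "Suc n"] by (auto simp: add.commute[of _ "Q (Suc n)"] ennreal_add_left_cancel_le)
    moreover have "b (Suc n) = ennreal q * b (Suc n) + ennreal (1 - q) * b (Suc n)"
      using q by (simp flip: distrib_right ennreal_plus)
    ultimately have "ennreal q * b (Suc n) + (D (Suc n) + ennreal (1 - q) * b (Suc n)) \<le> ennreal q * b (Suc n) + I"
      by (metis add.assoc add.commute)
    then have "D (Suc n) + ennreal (1 - q) * b (Suc n) \<le> I"
      using fin_bQ[of "Suc n"] by (auto simp: ennreal_add_left_cancel_le ennreal_mult_eq_top_iff)
    then show ?thesis
      using inc[THEN incseq_SucD, of n] by (elim order_trans[rotated]) (intro add_mono mult_left_mono, auto)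
  qed
  have R: "R r k t x = (SUP n. u n k t x)" for k t x by (simp add: sol_def u_def)
  have "(\<Sum>k\<in>UNIV. \<integral>\<^sup>+x\<in>{0..1}. ennreal (\<Phi> k T x) * R r k T x \<partial>lborel) = (SUP n. D n)"
  proof -
    have "(\<integral>\<^sup>+x\<in>{0..1}. ennreal (\<Phi> k T x) * R r k T x \<partial>lborel)
        = (SUP n. \<integral>\<^sup>+x\<in>{0..1}. ennreal (\<Phi> k T x) * u n k T x \<partial>lborel)" for k
      unfolding R SUP_mult_left_ennreal SUP_mult_right_ennreal
      by (rule nn_integral_monotone_convergence_SUP)
         (auto simp: incseq_def le_fun_def intro!: mult_left_mono mult_right_mono u_mono)
    then show ?thesis
      unfolding D_def
      by (subst ennreal_SUP_sum)
         (auto simp: incseq_def intro!: nn_integral_mono mult_left_mono mult_right_mono u_mono)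
  qed
  moreover have "(\<Sum>k\<in>UNIV. \<integral>\<^sup>+t\<in>{0..T}. ennreal (\<Phi> k t 0) * R r k t 0 \<partial>lborel) = (SUP n. b n)"
  proof -
    have "(\<integral>\<^sup>+t\<in>{0..T}. ennreal (\<Phi> k t 0) * R r k t 0 \<partial>lborel)
        = (SUP n. \<integral>\<^sup>+t\<in>{0..T}. ennreal (\<Phi> k t 0) * u n k t 0 \<partial>lborel)" for k
      unfolding R SUP_mult_left_ennreal SUP_mult_right_ennreal
      by (rule nn_integral_monotone_convergence_SUP)
         (auto simp: incseq_def le_fun_def intro!: mult_left_mono mult_right_mono u_mono)
    then show ?thesis
      unfolding b_def
      by (subst ennreal_SUP_sum)
         (auto simp: incseq_def intro!: nn_integral_mono mult_left_mono mult_right_mono u_mono)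
  qed
  moreover have "(SUP n. D n) + ennreal (1 - q) * (SUP n. b n) \<le> I"
    unfolding SUP_mult_left_ennreal
    using inc bound
    by (subst ennreal_SUP_add[symmetric]) (auto simp: incseq_def intro!: mult_left_mono SUP_least)
  ultimately show ?thesis by (simp add: I_def)
qed

lemma sol_decay:
  fixes r :: "bool \<Rightarrow> real \<Rightarrow> ennreal" and T :: real
  assumes [measurable]: "\<And>k. r k \<in> borel_measurable borel" and T: "0 \<le> T"
    and fin: "(\<Sum>k\<in>UNIV. \<integral>\<^sup>+x\<in>{0..1}. r k x \<partial>lborel) < \<infinity>"
  shows "ennreal (q * exp ((eps - lam) * T)) * (\<Sum>k\<in>UNIV. \<integral>\<^sup>+x\<in>{0..1}. R r k T x \<partial>lborel)
    \<le> (\<Sum>k\<in>UNIV. \<integral>\<^sup>+x\<in>{0..1}. r k x \<partial>lborel)"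
proof -
  have "ennreal (q * exp ((eps - lam) * T)) * (\<Sum>k\<in>UNIV. \<integral>\<^sup>+x\<in>{0..1}. R r k T x \<partial>lborel)
      = (\<Sum>k\<in>UNIV. \<integral>\<^sup>+x\<in>{0..1}. ennreal (q * exp ((eps - lam) * T)) * R r k T x \<partial>lborel)"
    unfolding sum_distrib_left by (subst nn_integral_cmult[symmetric]) (auto simp: mult.assoc)
  also have "\<dots> \<le> (\<Sum>k\<in>UNIV. \<integral>\<^sup>+x\<in>{0..1}. ennreal (\<Phi> k T x) * R r k T x \<partial>lborel)"
  proof (intro sum_mono nn_integral_mono)
    fix k x
    show "ennreal (q * exp ((eps - lam) * T)) * R r k T x * indicator {0..1} x
        \<le> ennreal (\<Phi> k T x) * R r k T x * indicator {0..1} x"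
      by (cases "x \<in> {0..1}")
         (auto intro!: mult_right_mono ennreal_leI simp: \<Phi>_def w_ge mult.commute)
  qed
  also have "\<dots> \<le> (\<Sum>k\<in>UNIV. \<integral>\<^sup>+x\<in>{0..1}. r k x \<partial>lborel)"
    using sol_energy[OF assms] by (rule order_trans[rotated]) simp
  finally show ?thesis .
qed

text \<open>
The loss of the factor \<open>1 - q\<close> at the boundary bounds the total outflow, hence the trace at \<open>x = 0\<close>.
\<close>

lemma sol_outflow_finite:
  fixes r :: "bool \<Rightarrow> real \<Rightarrow> ennreal" and T :: real
  assumes [measurable]: "\<And>k. r k \<in> borel_measurable borel" and T: "0 \<le> T"
    and fin: "(\<Sum>k\<in>UNIV. \<integral>\<^sup>+x\<in>{0..1}. r k x \<partial>lborel) < \<infinity>"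
  shows "(\<integral>\<^sup>+t\<in>{0..T}. R r k t 0 \<partial>lborel) < \<infinity>"
proof -
  define a where "a = q * exp (- lam * T)"
  have a: "0 < a" using q by (simp add: a_def)
  have "ennreal (1 - q) * (ennreal a * (\<integral>\<^sup>+t\<in>{0..T}. R r k t 0 \<partial>lborel))
      = ennreal (1 - q) * (\<integral>\<^sup>+t\<in>{0..T}. ennreal a * R r k t 0 \<partial>lborel)"
    by (subst nn_integral_cmult[symmetric]) (auto simp: mult.assoc)
  also have "\<dots> \<le> ennreal (1 - q) * (\<integral>\<^sup>+t\<in>{0..T}. ennreal (\<Phi> k t 0) * R r k t 0 \<partial>lborel)"
  proof (intro mult_left_mono nn_integral_mono)
    fix t
    have "a \<le> \<Phi> k t 0" if "0 \<le> t" "t \<le> T"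
    proof -
      have "exp (- lam * T) \<le> exp ((eps - lam) * t)"
      proof -
        have "lam * t \<le> lam * T" "0 \<le> eps * t" using that eps lam_pos by auto
        then show ?thesis by (simp add: algebra_simps)
      qed
      then show ?thesis
        unfolding a_def \<Phi>_def using w_ge[of 0 k] q by (subst mult.commute, intro mult_mono) auto
    qed
    then show "ennreal a * R r k t 0 * indicator {0..T} t \<le> ennreal (\<Phi> k t 0) * R r k t 0 * indicator {0..T} t"
      by (cases "t \<in> {0..T}") (auto intro!: mult_right_mono ennreal_leI)
  qed simp
  also have "\<dots> \<le> ennreal (1 - q) * (\<Sum>k\<in>UNIV. \<integral>\<^sup>+t\<in>{0..T}. ennreal (\<Phi> k t 0) * R r k t 0 \<partial>lborel)"
    by (intro mult_left_mono member_le_sum) auto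
  also have "\<dots> \<le> (\<Sum>k\<in>UNIV. \<integral>\<^sup>+x\<in>{0..1}. r k x \<partial>lborel)"
    using sol_energy[OF assms] by (rule order_trans[rotated]) simp
  also have "\<dots> < \<infinity>" by (rule fin)
  finally show ?thesis using a q by (auto simp: ennreal_mult_less_top)
qed

end

section \<open>Continuity of translations in Lp\<close>

text \<open>
The \<open>p\<close>-th power of the norm in \<open>Lp\<close>, with the value \<open>\<infinity>\<close> outside of this space.
\<close>

definition pmass :: "real \<Rightarrow> (real \<Rightarrow> real) \<Rightarrow> ennreal" where
  "pmass p f = (\<integral>\<^sup>+x. ennreal (\<bar>f x\<bar> powr p) \<partial>lborel)"

lemma abs_add_powr_le:
  fixes a b p :: real
  assumes "0 < p"
  shows "\<bar>a + b\<bar> powr p \<le> 2 powr p * (\<bar>a\<bar> powr p + \<bar>b\<bar> powr p)"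
proof -
  have "\<bar>a + b\<bar> powr p \<le> (2 * max \<bar>a\<bar> \<bar>b\<bar>) powr p"
    using assms by (intro powr_mono2) auto
  also have "\<dots> = 2 powr p * max \<bar>a\<bar> \<bar>b\<bar> powr p"
    by (simp add: powr_mult)
  also have "\<dots> \<le> 2 powr p * (\<bar>a\<bar> powr p + \<bar>b\<bar> powr p)"
    by (intro mult_left_mono) (auto simp: max_def)
  finally show ?thesis .
qed

lemma pmass_shift:
  assumes [measurable]: "f \<in> borel_measurable borel"
  shows "pmass p (\<lambda>x. f (x + c)) = pmass p f"
  unfolding pmass_def by (rule nn_integral_shift[where f="\<lambda>x. ennreal (\<bar>f x\<bar> powr p)"]) measurable

lemma pmass_add_le:
  assumes "0 < p" and [measurable]: "f \<in> borel_measurable borel" "g \<in> borel_measurable borel"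
  shows "pmass p (\<lambda>x. f x + g x) \<le> ennreal (2 powr p) * (pmass p f + pmass p g)"
proof -
  have "pmass p (\<lambda>x. f x + g x) \<le> (\<integral>\<^sup>+x. ennreal (2 powr p) * (ennreal (\<bar>f x\<bar> powr p) + ennreal (\<bar>g x\<bar> powr p)) \<partial>lborel)"
    unfolding pmass_def
  proof (intro nn_integral_mono)
    fix x
    show "ennreal (\<bar>f x + g x\<bar> powr p) \<le> ennreal (2 powr p) * (ennreal (\<bar>f x\<bar> powr p) + ennreal (\<bar>g x\<bar> powr p))"
      using abs_add_powr_le[OF assms(1), of "f x" "g x"]
      by (simp flip: ennreal_plus ennreal_mult)
  qed
  also have "\<dots> = ennreal (2 powr p) * (pmass p f + pmass p g)"
    unfolding pmass_def by (simp add: nn_integral_cmult nn_integral_add)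
  finally show ?thesis .
qed

lemma pmass_dominated_convergence:
  assumes "0 < p" and [measurable]: "\<And>n. u n \<in> borel_measurable borel" "M \<in> borel_measurable borel"
    and "\<And>n. AE x in lborel. \<bar>u n x\<bar> \<le> M x" and "pmass p M < \<infinity>"
    and "AE x in lborel. (\<lambda>n. u n x) \<longlonglongrightarrow> 0"
  shows "(\<lambda>n. pmass p (u n)) \<longlonglongrightarrow> 0"
proof -
  have "(\<lambda>n. \<integral>\<^sup>+x. ennreal (\<bar>u n x\<bar> powr p) \<partial>lborel) \<longlonglongrightarrow> (\<integral>\<^sup>+x. 0 \<partial>(lborel :: real measure))"
  proof (rule nn_integral_dominated_convergence[where w="\<lambda>x. ennreal (\<bar>M x\<bar> powr p)"])
    show "AE x in lborel. ennreal (\<bar>u n x\<bar> powr p) \<le> ennreal (\<bar>M x\<bar> powr p)" for n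
      using assms(4)[of n]
      by eventually_elim (use \<open>0 < p\<close> in \<open>auto intro!: ennreal_leI powr_mono2\<close>)
    show "AE x in lborel. (\<lambda>n. ennreal (\<bar>u n x\<bar> powr p)) \<longlonglongrightarrow> 0"
      using assms(6)
    proof eventually_elim
      case (elim x)
      have "(\<lambda>n. \<bar>u n x\<bar> powr p) \<longlonglongrightarrow> 0"
        using tendsto_rabs_zero[OF elim] \<open>0 < p\<close> by (intro tendsto_zero_powrI[of _ _ _ p]) auto
      then show ?case using tendsto_ennrealI by fastforce
    qed
  qed (use assms(5) in \<open>auto simp: pmass_def\<close>)
  then show ?thesis by (simp add: pmass_def)
qed

text \<open>
The usual three epsilon argument: \<open>a m\<close> is the error of the \<open>m\<close>-th approximation, uniform in \<open>n\<close>.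
\<close>

lemma tendsto_zero_by_approximation:
  fixes u a :: "nat \<Rightarrow> ennreal" and v :: "nat \<Rightarrow> nat \<Rightarrow> ennreal"
  assumes bound: "\<And>n m. u n \<le> K * (a m + v m n)" and K: "K < \<infinity>"
    and a: "a \<longlonglongrightarrow> 0" and v: "\<And>m. v m \<longlonglongrightarrow> 0"
  shows "u \<longlonglongrightarrow> 0"
proof (rule tendsto_zero_ennreal)
  fix r :: real assume r: "0 < r"
  obtain L where L: "K \<le> ennreal L" "0 < L"
    using K by (cases K) (auto intro: that[of "enn2real K + 1"] ennreal_leI)
  have "0 < ennreal (r / (3 * L))" using r L by simp
  then obtain m where m: "a m < ennreal (r / (3 * L))"
    using order_tendstoD(2)[OF a] eventually_sequentially by (metis order_refl)
  show "\<forall>\<^sub>F n in sequentially. u n < ennreal r"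
    using order_tendstoD(2)[OF v[of m] \<open>0 < ennreal (r / (3 * L))\<close>]
  proof eventually_elim
    case (elim n)
    have "u n \<le> K * (a m + v m n)" by (rule bound)
    also have "\<dots> \<le> ennreal L * (ennreal (r / (3 * L)) + ennreal (r / (3 * L)))"
      using L m elim by (intro mult_mono add_mono) auto
    also have "\<dots> = ennreal (2 * r / 3)"
      using L r by (simp add: field_simps flip: ennreal_plus ennreal_mult)
    also have "\<dots> < ennreal r" using r by (auto intro!: ennreal_lessI)
    finally show ?case .
  qed
qed

definition translation_continuous :: "real \<Rightarrow> (real \<Rightarrow> real) \<Rightarrow> bool" where
  "translation_continuous p f \<longleftrightarrow>
     (\<forall>s. s \<longlonglongrightarrow> 0 \<longrightarrow> (\<lambda>n. pmass p (\<lambda>y. f (y + s n) - f y)) \<longlonglongrightarrow> 0)"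

text \<open>
Dominated limits preserve the property. It is used twice, to pass from continuous functions of
compact support to bounded functions of compact support, and from those to all of \<open>Lp\<close>.
\<close>

lemma translation_continuous_limit:
  assumes "0 < p" and [measurable]: "\<And>m. f m \<in> borel_measurable borel" "g \<in> borel_measurable borel" "M \<in> borel_measurable borel"
    and f: "\<And>m. translation_continuous p (f m)"
    and lim: "AE x in lborel. (\<lambda>m. f m x) \<longlonglongrightarrow> g x"
    and dom: "\<And>m. AE x in lborel. \<bar>f m x - g x\<bar> \<le> M x" and M: "pmass p M < \<infinity>"
  shows "translation_continuous p g"
  unfolding translation_continuous_def
proof (intro allI impI)
  fix s :: "nat \<Rightarrow> real" assume s: "s \<longlonglongrightarrow> 0"
  have a: "(\<lambda>m. pmass p (\<lambda>x. f m x - g x)) \<longlonglongrightarrow> 0"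
  proof (rule pmass_dominated_convergence[OF assms(1) _ _ dom M])
    show "AE x in lborel. (\<lambda>m. f m x - g x) \<longlonglongrightarrow> 0"
      using lim by eventually_elim (simp add: LIM_zero)
  qed measurable
  let ?K = "ennreal (2 powr p)"
  have neg: "pmass p (\<lambda>x. g x - f m x) = pmass p (\<lambda>x. f m x - g x)" for m
    by (simp add: pmass_def abs_minus_commute)
  show "(\<lambda>n. pmass p (\<lambda>y. g (y + s n) - g y)) \<longlonglongrightarrow> 0"
  proof (rule tendsto_zero_by_approximation)
    fix n m
    have "pmass p (\<lambda>y. g (y + s n) - g y)
        = pmass p (\<lambda>y. (g (y + s n) - f m (y + s n)) + ((f m (y + s n) - f m y) + (f m y - g y)))"
      by (simp add: algebra_simps)
    also have "\<dots> \<le> ?K * (pmass p (\<lambda>y. g (y + s n) - f m (y + s n)) + pmass p (\<lambda>y. (f m (y + s n) - f m y) + (f m y - g y)))"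
      by (rule pmass_add_le[OF assms(1)]) measurable
    also have "\<dots> \<le> ?K * (pmass p (\<lambda>y. g (y + s n) - f m (y + s n))
        + ?K * (pmass p (\<lambda>y. f m (y + s n) - f m y) + pmass p (\<lambda>y. f m y - g y)))"
      by (intro mult_left_mono add_left_mono pmass_add_le[OF assms(1)]) measurable
    also have "pmass p (\<lambda>y. g (y + s n) - f m (y + s n)) = pmass p (\<lambda>y. f m y - g y)"
      using pmass_shift[of "\<lambda>y. g y - f m y" p "s n"] neg[of m] by simp
    also have "?K * (pmass p (\<lambda>y. f m y - g y) + ?K * (pmass p (\<lambda>y. f m (y + s n) - f m y) + pmass p (\<lambda>y. f m y - g y)))
      = ?K * (((1 + ?K) * pmass p (\<lambda>y. f m y - g y)) + ?K * pmass p (\<lambda>y. f m (y + s n) - f m y))"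
      by (simp add: algebra_simps)
    finally show "pmass p (\<lambda>y. g (y + s n) - g y)
      \<le> ?K * ((1 + ?K) * pmass p (\<lambda>y. f m y - g y) + ?K * pmass p (\<lambda>y. f m (y + s n) - f m y))" .
  next
    show "(\<lambda>m. (1 + ?K) * pmass p (\<lambda>y. f m y - g y)) \<longlonglongrightarrow> 0"
      using ennreal_tendsto_cmult[OF _ a, of "1 + ?K"] by simp
    show "(\<lambda>n. ?K * pmass p (\<lambda>y. f m (y + s n) - f m y)) \<longlonglongrightarrow> 0" for m
      using ennreal_tendsto_cmult[of ?K, OF _ f[of m, unfolded translation_continuous_def, rule_format, OF s]] by simp
  qed simp
qed

lemma pmass_interval:
  assumes "0 < p"
  shows "pmass p (\<lambda>x. K * indicator {a..b} x) < \<infinity>"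
proof -
  have "pmass p (\<lambda>x. K * indicator {a..b} x) = (\<integral>\<^sup>+x\<in>{a..b}. ennreal (\<bar>K\<bar> powr p) \<partial>lborel)"
    unfolding pmass_def using assms by (intro nn_integral_cong) (auto simp: indicator_def)
  also have "\<dots> < \<infinity>" by (simp add: nn_integral_cmult_indicator ennreal_mult_less_top emeasure_lborel_Icc_eq)
  finally show ?thesis .
qed

lemma translation_continuous_compact_support:
  assumes "0 < p" and g: "continuous_on UNIV g"
    and K: "\<And>x. \<bar>g x\<bar> \<le> K" and B: "\<And>x. B < \<bar>x\<bar> \<Longrightarrow> g x = 0"
  shows "translation_continuous p g"
  unfolding translation_continuous_def
proof (intro allI impI)
  fix s :: "nat \<Rightarrow> real" assume s: "s \<longlonglongrightarrow> 0"
  have [measurable]: "g \<in> borel_measurable borel" using g by (rule borel_measurable_continuous_onI)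
  obtain S where S: "\<And>n. \<bar>s n\<bar> \<le> S"
    using convergent_imp_Bseq[of s] s by (auto simp: convergent_def Bseq_def)
  show "(\<lambda>n. pmass p (\<lambda>y. g (y + s n) - g y)) \<longlonglongrightarrow> 0"
  proof (rule pmass_dominated_convergence[OF assms(1) _ _ _ pmass_interval[OF assms(1), of "2 * K" "- B - S" "B + S"]])
    fix n
    show "AE y in lborel. \<bar>g (y + s n) - g y\<bar> \<le> 2 * K * indicator {- B - S..B + S} y"
    proof (rule AE_I2)
      fix y
      show "\<bar>g (y + s n) - g y\<bar> \<le> 2 * K * indicator {- B - S..B + S} y"
        using K[of y] K[of "y + s n"] B[of y] B[of "y + s n"] S[of n] by (auto simp: indicator_def)
    qed
    show "AE y in lborel. (\<lambda>n. g (y + s n) - g y) \<longlonglongrightarrow> 0"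
    proof (rule AE_I2)
      fix y
      have "(\<lambda>n. g (y + s n)) \<longlonglongrightarrow> g y"
      proof (rule isCont_tendsto_compose[of _ g])
        show "isCont g y" using g by (simp add: continuous_on_eq_continuous_at)
        show "(\<lambda>n. y + s n) \<longlonglongrightarrow> y" using tendsto_add[OF tendsto_const[of y] s] by simp
      qed
      then show "(\<lambda>n. g (y + s n) - g y) \<longlonglongrightarrow> 0" by (rule LIM_zero)
    qed
  qed measurable
qed

text \<open>
A measurable function is almost everywhere a limit of continuous functions; truncating them in height
and in space makes the limit dominated.
\<close>

lemma translation_continuous_bounded_support:
  assumes "0 < p" and [measurable]: "f \<in> borel_measurable borel"
    and K: "\<And>x. \<bar>f x\<bar> \<le> K" and B: "\<And>x. B < \<bar>x\<bar> \<Longrightarrow> f x = 0"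
  shows "translation_continuous p f"
proof -
  have "f measurable_on UNIV"
    by (intro lebesgue_measurable_imp_measurable_on measurable_completion) auto
  then obtain N g where N: "negligible N" and g: "\<And>n. continuous_on UNIV (g n)"
    and lim: "\<And>x. x \<notin> N \<Longrightarrow> (\<lambda>n. g n x) \<longlonglongrightarrow> f x"
    unfolding measurable_on_def by auto
  have AE_N: "AE x in lborel. x \<notin> N"
    using N by (metis AE_completion_iff AE_not_in negligible_iff_null_sets)
  \<comment> \<open>A continuous cut-off that equals \<open>1\<close> on the support of \<open>f\<close>.\<close>
  define cut where "cut x = max 0 (min 1 (B + 1 - \<bar>x\<bar>))" for x :: real
  define h where "h n x = max (- K) (min K (g n x)) * cut x" for n x
  have K0: "0 \<le> K" using K[of 0] by linarith
  have cut01: "0 \<le> cut x" "cut x \<le> 1" for x by (auto simp: cut_def)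
  have cont: "continuous_on UNIV (h n)" for n
    unfolding h_def cut_def by (intro continuous_intros g)
  then have meas [measurable]: "h n \<in> borel_measurable borel" for n
    by (rule borel_measurable_continuous_onI)
  have hK: "\<bar>h n x\<bar> \<le> K" for n x
  proof -
    have "\<bar>max (- K) (min K (g n x))\<bar> * \<bar>cut x\<bar> \<le> K * 1"
      using K0 cut01[of x] by (intro mult_mono) auto
    then show ?thesis by (simp add: h_def abs_mult)
  qed
  have hB: "h n x = 0" if "B + 1 < \<bar>x\<bar>" for n x using that by (simp add: h_def cut_def)
  show ?thesis
  proof (rule translation_continuous_limit[OF assms(1) meas assms(2) _ _ _ _
        pmass_interval[OF assms(1), of "2 * K" "- B - 1" "B + 1"]])
    show "translation_continuous p (h n)" for n
      by (rule translation_continuous_compact_support[OF assms(1) cont hK hB])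
    show "AE x in lborel. (\<lambda>n. h n x) \<longlonglongrightarrow> f x"
      using AE_N
    proof eventually_elim
      case (elim x)
      have "(\<lambda>n. h n x) \<longlonglongrightarrow> max (- K) (min K (f x)) * cut x"
        unfolding h_def by (intro tendsto_intros lim elim)
      moreover have "max (- K) (min K (f x)) * cut x = f x"
        using K[of x] B[of x] by (cases "B < \<bar>x\<bar>") (auto simp: cut_def)
      ultimately show ?case by simp
    qed
    show "AE x in lborel. \<bar>h n x - f x\<bar> \<le> 2 * K * indicator {- B - 1..B + 1} x" for n
    proof (rule AE_I2)
      fix x
      show "\<bar>h n x - f x\<bar> \<le> 2 * K * indicator {- B - 1..B + 1} x"
        using hK[of n x] hB[of x n] K[of x] B[of x] by (auto simp: indicator_def)
    qed
  qed measurable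
qed

lemma pmass_translation_continuous:
  assumes "0 < p" and [measurable]: "f \<in> borel_measurable borel" and "pmass p f < \<infinity>"
  shows "translation_continuous p f"
proof -
  define g where "g n x = (if \<bar>x\<bar> \<le> real n \<and> \<bar>f x\<bar> \<le> real n then f x else 0)" for n x
  have meas [measurable]: "g n \<in> borel_measurable borel" for n unfolding g_def by measurable
  show ?thesis
  proof (rule translation_continuous_limit[OF assms(1) meas assms(2) assms(2)[THEN borel_measurable_abs]])
    show "translation_continuous p (g n)" for n
      by (rule translation_continuous_bounded_support[OF assms(1) meas, of n "real n" "real n"]) (auto simp: g_def)
    show "AE x in lborel. (\<lambda>n. g n x) \<longlonglongrightarrow> f x"
    proof (rule AE_I2)
      fix x
      have "\<forall>\<^sub>F n in sequentially. g n x = f x"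
        using eventually_ge_at_top[of "nat \<lceil>max \<bar>x\<bar> \<bar>f x\<bar>\<rceil>"]
        by eventually_elim (auto simp: g_def nat_le_iff ceiling_le_iff)
      then show "(\<lambda>n. g n x) \<longlonglongrightarrow> f x" by (rule tendsto_eventually)
    qed
    show "AE x in lborel. \<bar>g n x - f x\<bar> \<le> \<bar>f x\<bar>" for n by (auto simp: g_def)
    show "pmass p (\<lambda>x. \<bar>f x\<bar>) < \<infinity>" using assms(3) by (simp add: pmass_def)
  qed
qed

lemma nn_integral_lebesgue_on:
  assumes "S \<in> sets lebesgue" and "f \<in> borel_measurable borel"
  shows "(\<integral>\<^sup>+x. f x \<partial>lebesgue_on S) = (\<integral>\<^sup>+x. f x * indicator S x \<partial>lborel)"
  using assms by (subst nn_integral_restrict_space) (auto simp: nn_integral_completion)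

lemma Lp_norm_eq:
  assumes "f \<in> borel_measurable (lebesgue_on S)"
  shows "Lp_norm p S f = enn2real (\<integral>\<^sup>+x. ennreal (\<bar>f x\<bar> powr p) \<partial>lebesgue_on S) powr (1 / p)"
  unfolding Lp_norm_def using assms by (subst integral_eq_nn_integral) auto

lemma borel_imp_lebesgue_on:
  "f \<in> borel_measurable borel \<Longrightarrow> f \<in> borel_measurable (lebesgue_on S)"
  by (intro measurable_restrict_space1 measurable_completion) auto

lemma Lp_norm_le_pmass:
  assumes "0 < p" "S \<in> sets lebesgue" and [measurable]: "f \<in> borel_measurable borel" and "pmass p f < \<infinity>"
  shows "f \<in> Lp_space p S" and "Lp_norm p S f \<le> enn2real (pmass p f) powr (1 / p)"
proof -
  have le: "(\<integral>\<^sup>+x. ennreal (\<bar>f x\<bar> powr p) \<partial>lebesgue_on S) \<le> pmass p f"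
    unfolding pmass_def by (subst nn_integral_lebesgue_on[OF assms(2)])
      (auto intro!: nn_integral_mono simp: indicator_def)
  have [measurable]: "f \<in> borel_measurable (lebesgue_on S)" by (rule borel_imp_lebesgue_on) measurable
  show "f \<in> Lp_space p S"
    unfolding Lp_space_def using le assms(4) by (auto intro!: integrableI_nonneg)
  show "Lp_norm p S f \<le> enn2real (pmass p f) powr (1 / p)"
    using le assms(1,4) by (subst Lp_norm_eq) (auto intro!: powr_mono2 enn2real_mono)
qed

text \<open>
The form in which regularity will be used: \<open>W s z\<close> is the value on the line with label \<open>z\<close>, and \<open>s\<close>
is either time or space. For fixed \<open>z\<close> it is continuous and dominated, and the label itself moves with
\<open>s\<close>, which is a translation.
\<close>

lemma continuous_into_Lp_glide:
  fixes W :: "real \<Rightarrow> real \<Rightarrow> real"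
  assumes p: "0 < p" and S: "S \<in> sets lebesgue"
    and [measurable]: "\<And>s. W s \<in> borel_measurable borel" "M \<in> borel_measurable borel"
    and dom: "\<And>s. s \<in> I \<Longrightarrow> AE z in lborel. \<bar>W s z\<bar> \<le> M z" and M: "pmass p M < \<infinity>"
    and cont: "AE z in lborel. continuous_on I (\<lambda>s. W s z)"
  shows "continuous_into_Lp p I S (\<lambda>s x. W s (x + s))"
proof -
  have fin: "pmass p (W s) < \<infinity>" if "s \<in> I" for s
  proof -
    have "pmass p (W s) \<le> pmass p M"
      unfolding pmass_def
    proof (rule nn_integral_mono_AE)
      show "AE z in lborel. ennreal (\<bar>W s z\<bar> powr p) \<le> ennreal (\<bar>M z\<bar> powr p)"
        using dom[OF that] by eventually_elim (use p in \<open>auto intro!: ennreal_leI powr_mono2\<close>)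
    qed
    with M show ?thesis by simp
  qed
  have lim: "(\<lambda>n. pmass p (\<lambda>x. W (X n) (x + X n) - W t (x + t))) \<longlonglongrightarrow> 0"
    if t: "t \<in> I" and X: "\<And>n. X n \<in> I" "X \<longlonglongrightarrow> t" for t X
  proof (rule tendsto_zero_by_approximation[where K="ennreal (2 powr p)" and a="\<lambda>_. 0"
      and v="\<lambda>_ n. pmass p (\<lambda>z. W (X n) z - W t z) + pmass p (\<lambda>y. W t (y + (X n - t)) - W t y)"])
    fix n
    have "pmass p (\<lambda>x. W (X n) (x + X n) - W t (x + t))
        = pmass p (\<lambda>x. (W (X n) (x + X n) - W t (x + X n)) + (W t (x + X n) - W t (x + t)))"
      by simp
    also have "\<dots> \<le> ennreal (2 powr p) * (pmass p (\<lambda>x. W (X n) (x + X n) - W t (x + X n)) + pmass p (\<lambda>x. W t (x + X n) - W t (x + t)))"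
      by (rule pmass_add_le[OF p]) measurable
    also have "pmass p (\<lambda>x. W (X n) (x + X n) - W t (x + X n)) = pmass p (\<lambda>z. W (X n) z - W t z)"
      by (rule pmass_shift[of "\<lambda>z. W (X n) z - W t z"]) measurable
    also have "pmass p (\<lambda>x. W t (x + X n) - W t (x + t)) = pmass p (\<lambda>y. W t (y + (X n - t)) - W t y)"
      using pmass_shift[of "\<lambda>y. W t (y + (X n - t)) - W t y" p t] by (simp add: algebra_simps)
    finally show "pmass p (\<lambda>x. W (X n) (x + X n) - W t (x + t))
      \<le> ennreal (2 powr p) * (0 + (pmass p (\<lambda>z. W (X n) z - W t z) + pmass p (\<lambda>y. W t (y + (X n - t)) - W t y)))" by simp
  next
    have "(\<lambda>n. pmass p (\<lambda>z. W (X n) z - W t z)) \<longlonglongrightarrow> 0"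
    proof (rule pmass_dominated_convergence[OF p, where M="\<lambda>z. 2 * M z"])
      show "AE z in lborel. \<bar>W (X n) z - W t z\<bar> \<le> 2 * M z" for n
        using dom[OF X(1)[of n]] dom[OF t] by eventually_elim linarith
      have "pmass p (\<lambda>z. 2 * M z) = ennreal (2 powr p) * pmass p M"
        unfolding pmass_def by (subst nn_integral_cmult[symmetric]) (auto simp: abs_mult powr_mult ennreal_mult)
      then show "pmass p (\<lambda>z. 2 * M z) < \<infinity>" using M by (simp add: ennreal_mult_less_top)
      show "AE z in lborel. (\<lambda>n. W (X n) z - W t z) \<longlonglongrightarrow> 0"
        using cont
      proof eventually_elim
        case (elim z)
        have "(\<lambda>n. W (X n) z) \<longlonglongrightarrow> W t z"
          using continuous_on_tendsto_compose[OF elim X(2) t] X(1) by simp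
        then show ?case by (rule LIM_zero)
      qed
    qed measurable
    moreover have "(\<lambda>n. pmass p (\<lambda>y. W t (y + (X n - t)) - W t y)) \<longlonglongrightarrow> 0"
      using pmass_translation_continuous[OF p assms(3)[of t] fin[OF t]] LIM_zero[OF X(2)]
      unfolding translation_continuous_def by simp
    ultimately show "(\<lambda>n. pmass p (\<lambda>z. W (X n) z - W t z) + pmass p (\<lambda>y. W t (y + (X n - t)) - W t y)) \<longlonglongrightarrow> 0"
      using tendsto_add_zero by fastforce
  qed auto
  show ?thesis
    unfolding continuous_into_Lp_def
  proof safe
    fix t assume t: "t \<in> I"
    show "(\<lambda>x. W t (x + t)) \<in> Lp_space p S"
      using fin[OF t] by (intro Lp_norm_le_pmass p S) (auto simp: pmass_shift)
    show "((\<lambda>s. Lp_norm p S (\<lambda>x. W s (x + s) - W t (x + t))) \<longlongrightarrow> 0) (at t within I)"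
      unfolding tendsto_at_iff_sequentially o_def
    proof (intro allI impI)
      fix X assume X: "\<forall>n. X n \<in> I - {t}" "X \<longlonglongrightarrow> t"
      let ?m = "\<lambda>n. pmass p (\<lambda>x. W (X n) (x + X n) - W t (x + t))"
      have m: "?m \<longlonglongrightarrow> 0" using X t by (intro lim) auto
      then have "(\<lambda>n. enn2real (?m n)) \<longlonglongrightarrow> 0" by (intro tendsto_enn2real) auto
      then have conv: "(\<lambda>n. enn2real (?m n) powr (1 / p)) \<longlonglongrightarrow> 0"
        using p by (intro tendsto_zero_powrI[where b="1 / p"]) auto
      have up: "\<forall>\<^sub>F n in sequentially. Lp_norm p S (\<lambda>x. W (X n) (x + X n) - W t (x + t)) \<le> enn2real (?m n) powr (1 / p)"
        using order_tendstoD(2)[OF m zero_less_one]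
      proof eventually_elim
        case (elim n)
        then have "?m n < \<infinity>" by (rule order.strict_trans) simp
        then show ?case by (intro Lp_norm_le_pmass p S) measurable
      qed
      have lo: "\<forall>\<^sub>F n in sequentially. 0 \<le> Lp_norm p S (\<lambda>x. W (X n) (x + X n) - W t (x + t))"
        by (simp add: Lp_norm_def)
      show "(\<lambda>n. Lp_norm p S (\<lambda>x. W (X n) (x + X n) - W t (x + t))) \<longlonglongrightarrow> 0"
        by (rule tendsto_sandwich[OF lo up tendsto_const conv])
    qed
  qed
qed

section \<open>The signed solution\<close>

text \<open>
Young's inequality, read as: the graph of \<open>y powr p\<close> lies above its tangent at \<open>m\<close>.
\<close>

lemma powr_tangent:
  fixes p m y :: real
  assumes "1 < p" "0 \<le> m" "0 \<le> y"
  shows "p * m powr (p - 1) * y \<le> (p - 1) * m powr p + y powr p"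
proof -
  define q where "q = p / (p - 1)"
  have q: "1 < q" "1 / q + 1 / p = 1" using assms by (auto simp: q_def field_simps)
  have "m powr (p - 1) * y \<le> (m powr (p - 1)) powr q / q + y powr p / p"
    using assms q by (intro Youngs_inequality) auto
  also have "(m powr (p - 1)) powr q = m powr p" using assms by (simp add: powr_powr q_def)
  finally have "p * (m powr (p - 1) * y) \<le> p * (m powr p / q + y powr p / p)"
    using assms by (intro mult_left_mono) auto
  also have "\<dots> = (p - 1) * m powr p + y powr p" using assms by (simp add: q_def distrib_left)
  finally show ?thesis by (simp add: mult.assoc)
qed

lemma integral_enn2real:
  fixes F :: "'a \<Rightarrow> ennreal"
  assumes [measurable]: "F \<in> borel_measurable M" and fin: "(\<integral>\<^sup>+x. F x \<partial>M) < \<infinity>"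
  shows "integrable M (\<lambda>x. enn2real (F x))" and "(LINT x|M. enn2real (F x)) = enn2real (\<integral>\<^sup>+x. F x \<partial>M)"
proof -
  have "AE x in M. F x \<noteq> \<infinity>"
    using fin by (intro nn_integral_noteq_infinite) auto
  then have eq: "(\<integral>\<^sup>+x. ennreal (enn2real (F x)) \<partial>M) = (\<integral>\<^sup>+x. F x \<partial>M)"
    by (intro nn_integral_cong_AE, eventually_elim) (simp add: less_top)
  show "integrable M (\<lambda>x. enn2real (F x))"
    using fin eq by (intro integrableI_nonneg) auto
  show "(LINT x|M. enn2real (F x)) = enn2real (\<integral>\<^sup>+x. F x \<partial>M)"
    by (subst integral_eq_nn_integral) (auto simp: eq)
qed

lemma continuous_into_Lp_cong:
  assumes "continuous_into_Lp p I S u" and eq: "\<And>t x. t \<in> I \<Longrightarrow> x \<in> S \<Longrightarrow> u t x = u' t x"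
  shows "continuous_into_Lp p I S u'"
proof -
  have Lp: "u' t \<in> Lp_space p S" if "t \<in> I" "u t \<in> Lp_space p S" for t
  proof -
    have "(u' t \<in> borel_measurable (lebesgue_on S)) = (u t \<in> borel_measurable (lebesgue_on S))"
      using eq[OF that(1)] by (intro measurable_cong) simp
    moreover have "integrable (lebesgue_on S) (\<lambda>x. \<bar>u' t x\<bar> powr p) = integrable (lebesgue_on S) (\<lambda>x. \<bar>u t x\<bar> powr p)"
      using eq[OF that(1)] by (intro Bochner_Integration.integrable_cong) auto
    ultimately show ?thesis using that(2) by (simp add: Lp_space_def)
  qed
  have norm: "Lp_norm p S (\<lambda>x. u' s x - u' t x) = Lp_norm p S (\<lambda>x. u s x - u t x)" if "s \<in> I" "t \<in> I" for s t
    unfolding Lp_norm_def using eq that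
    by (intro arg_cong[where f="\<lambda>a. a powr (1 / p)"] Bochner_Integration.integral_cong) auto
  show ?thesis
    unfolding continuous_into_Lp_def
  proof safe
    fix t assume t: "t \<in> I"
    show "u' t \<in> Lp_space p S" using assms(1) t by (auto simp: continuous_into_Lp_def intro: Lp)
    have "((\<lambda>s. Lp_norm p S (\<lambda>x. u s x - u t x)) \<longlongrightarrow> 0) (at t within I)"
      using assms(1) t by (auto simp: continuous_into_Lp_def)
    then show "((\<lambda>s. Lp_norm p S (\<lambda>x. u' s x - u' t x)) \<longlongrightarrow> 0) (at t within I)"
      by (rule tendsto_cong[THEN iffD1, rotated]) (auto simp: eventually_at_filter norm t)
  qed
qed

text \<open>
The coefficient \<open>c k\<close> acts where component \<open>k\<close> enters the strip, so \<open>c False\<close> is \<open>c1\<close> and \<open>c True\<close>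
is \<open>c0\<close> of the original system. The datum \<open>f0 True\<close> is reflected.
\<close>

locale initial_data = weighted_coupling +
  fixes c :: "bool \<Rightarrow> real" and f0 :: "bool \<Rightarrow> real \<Rightarrow> real" and p :: real
  assumes c_le: "\<And>k. \<bar>c k\<bar> \<le> q\<^sup>2" and p: "1 < p"
    and f0_measurable [measurable]: "\<And>k. f0 k \<in> borel_measurable borel"
    and f0_finite: "\<And>k. (\<integral>\<^sup>+x\<in>{0..1}. ennreal (\<bar>f0 k x\<bar> powr p) \<partial>lborel) < \<infinity>"
begin

definition signed_datum :: "bool \<Rightarrow> bool \<Rightarrow> real \<Rightarrow> ennreal" where
  "signed_datum k s z = ennreal (if s then f0 k z else - f0 k z)"

text \<open>
In general not the positive and the negative part of the solution, but two non-negative functions whose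
difference it is: they solve the same equation, with the two parts of the datum.
\<close>

definition signed_part :: "bool \<Rightarrow> bool \<Rightarrow> real \<Rightarrow> real \<Rightarrow> ennreal" where
  "signed_part = sol c signed_datum"

text \<open>
Dominates the \<open>p\<close>-th power of the solution, see \<open>v_powr_le\<close>.
\<close>

definition majorant :: "bool \<Rightarrow> real \<Rightarrow> real \<Rightarrow> ennreal" where
  "majorant = R (\<lambda>k z. ennreal (\<bar>f0 k z\<bar> powr p))"

text \<open>
The reflected solution. Where one of the two functions is infinite, \<open>enn2real\<close> replaces it by \<open>0\<close>; such points lie
only on lines with infinite exit value, which form a null set.
\<close>

definition v :: "bool \<Rightarrow> real \<Rightarrow> real \<Rightarrow> real" where
  "v k t x = exp (- lam * t) * (enn2real (signed_part k True t x) - enn2real (signed_part k False t x))"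

lemma signed_datum_measurable [measurable]: "signed_datum k s \<in> borel_measurable borel"
  unfolding signed_datum_def by measurable

lemma signed_part_measurable [measurable]: "case_prod (signed_part k s) \<in> borel2"
  unfolding signed_part_def by measurable

lemma majorant_measurable [measurable]: "case_prod (majorant k) \<in> borel2"
  unfolding majorant_def by measurable

lemma v_measurable [measurable]: "case_prod (v k) \<in> borel2"
  unfolding v_def split_beta' by measurable

lemma signed_part_comparison:
  assumes "0 \<le> t" "0 \<le> x" "x \<le> 1" "0 \<le> m"
  shows "ennreal (p * m powr (p - 1)) * (signed_part k True t x + signed_part k False t x)
     \<le> ennreal ((p - 1) * m powr p * exp (lam * t)) + majorant k t x"
  unfolding signed_part_def majorant_def
proof (rule sol_comparison)
  show "q\<^sup>2 \<le> 1" using q by (simp add: power_le_one)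
  fix k z
  have "signed_datum k True z + signed_datum k False z = ennreal \<bar>f0 k z\<bar>"
    unfolding signed_datum_def by (cases "0 \<le> f0 k z") (auto simp: ennreal_neg)
  then show "ennreal (p * m powr (p - 1)) * (signed_datum k True z + signed_datum k False z) \<le> ennreal ((p - 1) * m powr p) + ennreal (\<bar>f0 k z\<bar> powr p)"
    using powr_tangent[OF p assms(4), of "\<bar>f0 k z\<bar>"] p by (auto simp flip: ennreal_plus ennreal_mult intro!: ennreal_leI)
qed (use assms p c_le in auto)

text \<open>
The tangent at \<open>m = 1\<close>: the sum of the parts is at most a constant plus \<open>majorant\<close>.
\<close>

lemma signed_part_finite:
  assumes "0 \<le> t" "0 \<le> x" "x \<le> 1" "majorant k t x < \<infinity>"
  shows "signed_part k s t x < \<infinity>"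
proof -
  have "ennreal p * (signed_part k True t x + signed_part k False t x) < \<infinity>"
    using signed_part_comparison[OF assms(1-3), of 1 k] assms(4) by (auto intro: order.strict_trans1)
  then have "signed_part k True t x + signed_part k False t x < \<infinity>" using p by (auto simp: ennreal_mult_less_top)
  then show ?thesis by (cases s) auto
qed

text \<open>
The comparison at \<open>m = \<bar>v k t x\<bar>\<close>, where the tangent touches the graph.
\<close>

lemma v_powr_le:
  assumes "0 \<le> t" "0 \<le> x" "x \<le> 1"
  shows "ennreal (\<bar>v k t x\<bar> powr p) \<le> ennreal (exp (- lam * t)) * majorant k t x"
proof (cases "majorant k t x < \<infinity>")
  case True
  define m where "m = \<bar>v k t x\<bar>"
  define S where "S = enn2real (signed_part k True t x) + enn2real (signed_part k False t x)"
  define r where "r = enn2real (majorant k t x)"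
  have signed_part: "signed_part k s t x = ennreal (enn2real (signed_part k s t x))" for s
    using signed_part_finite[OF assms True, of s] by (simp add: less_top)
  have majorant: "majorant k t x = ennreal r" using True by (simp add: r_def less_top)
  have r0: "0 \<le> r" by (simp add: r_def)
  have "signed_part k True t x + signed_part k False t x = ennreal S"
    unfolding S_def by (subst (1 2) signed_part) simp
  then have "ennreal (p * m powr (p - 1)) * ennreal S \<le> ennreal ((p - 1) * m powr p * exp (lam * t)) + ennreal r"
    using signed_part_comparison[OF assms, of m k] majorant by (simp add: m_def)
  then have "p * m powr (p - 1) * S \<le> (p - 1) * m powr p * exp (lam * t) + r"
    using p r0 by (simp add: S_def flip: ennreal_plus ennreal_mult)
  then have "exp (- lam * t) * (p * m powr (p - 1) * S) \<le> exp (- lam * t) * ((p - 1) * m powr p * exp (lam * t) + r)"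
    by (rule mult_left_mono) simp
  then have le: "p * m powr (p - 1) * (exp (- lam * t) * S) \<le> (p - 1) * m powr p + exp (- lam * t) * r"
    by (simp add: algebra_simps flip: exp_add)
  have "\<bar>enn2real (signed_part k True t x) - enn2real (signed_part k False t x)\<bar> \<le> S"
    unfolding S_def using enn2real_nonneg[of "signed_part k True t x"] enn2real_nonneg[of "signed_part k False t x"] by linarith
  then have "m \<le> exp (- lam * t) * S"
    unfolding m_def v_def abs_mult by (intro mult_mono) auto
  then have "p * m powr (p - 1) * m \<le> p * m powr (p - 1) * (exp (- lam * t) * S)"
    using p by (intro mult_left_mono) auto
  moreover have "p * m powr (p - 1) * m = p * m powr p"
    by (cases "m = 0") (auto simp: m_def powr_diff)
  moreover have "(p - 1) * m powr p = p * m powr p - m powr p"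
    by (simp add: algebra_simps)
  ultimately have "m powr p \<le> exp (- lam * t) * r"
    using le by linarith
  then show ?thesis
    using r0 by (simp add: majorant m_def flip: ennreal_mult')
next
  case False
  then show ?thesis by (simp add: not_less top_unique ennreal_mult_top)
qed

lemma majorant_char:
  "majorant k t x = transport (inflow (\<lambda>_. q\<^sup>2) (\<lambda>k _ z. ennreal (\<bar>f0 k z\<bar> powr p)) (\<lambda>k _. majorant k) k True) (src majorant k) t x"
proof -
  let ?r = "\<lambda>k _::bool. \<lambda>z. ennreal (\<bar>f0 k z\<bar> powr p)"
  have "majorant k t x = picard (\<lambda>_. q\<^sup>2) ?r (sol (\<lambda>_. q\<^sup>2) ?r) k True t x"
    unfolding majorant_def by (subst sol_fixpoint) auto
  also have "inflow (\<lambda>_. q\<^sup>2) ?r (sol (\<lambda>_. q\<^sup>2) ?r) k True = inflow (\<lambda>_. q\<^sup>2) ?r (\<lambda>k _. majorant k) k True"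
    by (auto simp: inflow_def majorant_def)
  then have "picard (\<lambda>_. q\<^sup>2) ?r (sol (\<lambda>_. q\<^sup>2) ?r) k True = transport (inflow (\<lambda>_. q\<^sup>2) ?r (\<lambda>k _. majorant k) k True) (src majorant k)"
    by (simp add: picard_def majorant_def)
  finally show ?thesis .
qed

lemma majorant_le_exit: "t \<le> z \<Longrightarrow> majorant k t (z - t) \<le> majorant k z 0"
  by (subst (1 2) majorant_char) (rule transport_le_exit)

lemma signed_part_char: "signed_part k s t (z - t) = inflow c signed_datum signed_part k s z
     + (\<integral>\<^sup>+\<tau>\<in>{entry z..t}. src (\<lambda>k. signed_part k s) k \<tau> (z - \<tau>) \<partial>lborel)"
proof -
  have "signed_part k s = picard c signed_datum signed_part k s" unfolding signed_part_def by (rule sol_fixpoint) measurable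
  then have "signed_part k s t (z - t) = transport (inflow c signed_datum signed_part k s) (src (\<lambda>k. signed_part k s) k) t (z - t)"
    by (simp add: picard_def)
  then show ?thesis by (simp add: transport_def)
qed

definition v_in :: "bool \<Rightarrow> real \<Rightarrow> real" where
  "v_in k z = (if z < 1 then f0 k z else c k * v (\<not> k) (z - 1) 0)"

definition v_src :: "bool \<Rightarrow> real \<Rightarrow> real \<Rightarrow> real" where
  "v_src k t x = - al k t x * (v k t x - v (\<not> k) t (1 - x))"

text \<open>
The parts solve the equation in the variables multiplied by \<open>exp (lam * t)\<close>. Integration by parts
against \<open>exp (- lam * t)\<close> removes this factor and produces the loss term; on a line with finite exit
value all integrals are finite, and the difference of the two parts gives the rule for \<open>v\<close>.
\<close>

lemma v_char:
  assumes z: "0 \<le> z" "majorant k z 0 < \<infinity>" and t: "entry z \<le> t" "t \<le> z"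
  shows "set_integrable lborel {entry z..t} (\<lambda>\<tau>. v_src k \<tau> (z - \<tau>))"
    and "v k t (z - t) = v_in k z + (LINT \<tau>:{entry z..t}|lborel. v_src k \<tau> (z - \<tau>))"
proof -
  let ?I = "{entry z..t}"
  let ?D = "\<lambda>s \<tau>. signed_part k s \<tau> (z - \<tau>)"
  let ?H = "\<lambda>s \<tau>. src (\<lambda>k. signed_part k s) k \<tau> (z - \<tau>)"
  let ?E = "\<lambda>\<tau>. exp (- lam * \<tau>)"
  have entry0: "0 \<le> entry z" by (simp add: entry_def)
  have strip: "0 \<le> \<tau> \<and> 0 \<le> z - \<tau> \<and> z - \<tau> \<le> 1" if "entry z \<le> \<tau>" "\<tau> \<le> z" for \<tau>
    using that by (auto simp: entry_def)
  have fin: "?D s \<tau> < \<infinity>" if "entry z \<le> \<tau>" "\<tau> \<le> z" for s \<tau>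
    using strip[OF that] majorant_le_exit[of \<tau> z k] that z(2) by (intro signed_part_finite) (auto intro: order.strict_trans1)
  have mH [measurable]: "(\<lambda>\<tau>. ?H s \<tau>) \<in> borel_measurable borel" for s
    unfolding src_def by measurable
  have parts: "ennreal (?E t) * ?D s t + (\<integral>\<^sup>+\<tau>\<in>?I. ennreal (lam * ?E \<tau>) * ?D s \<tau> \<partial>lborel)
      = ennreal (?E (entry z)) * inflow c signed_datum signed_part k s z + (\<integral>\<^sup>+\<tau>\<in>?I. ennreal (?E \<tau>) * ?H s \<tau> \<partial>lborel)" for s
    unfolding signed_part_char
    by (rule nn_integral_by_parts)
       (use t lam_pos in \<open>auto intro!: derivative_eq_intros\<close>)
  have finI: "inflow c signed_datum signed_part k s z < \<infinity>" "(\<integral>\<^sup>+\<tau>\<in>?I. ?H s \<tau> \<partial>lborel) < \<infinity>" for s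
    using fin[OF t, of s] by (auto simp: signed_part_char)
  have finH: "(\<integral>\<^sup>+\<tau>\<in>?I. ennreal (?E \<tau>) * ?H s \<tau> \<partial>lborel) < \<infinity>" for s
  proof -
    have "(\<integral>\<^sup>+\<tau>\<in>?I. ennreal (?E \<tau>) * ?H s \<tau> \<partial>lborel) \<le> (\<integral>\<^sup>+\<tau>\<in>?I. 1 * ?H s \<tau> \<partial>lborel)"
    proof (intro nn_integral_mono)
      fix \<tau>
      show "ennreal (?E \<tau>) * ?H s \<tau> * indicator ?I \<tau> \<le> 1 * ?H s \<tau> * indicator ?I \<tau>"
      proof (cases "\<tau> \<in> ?I")
        case True
        then have "?E \<tau> \<le> 1" using entry0 lam_pos by simp
        then show ?thesis by (intro mult_right_mono) auto
      qed simp
    qed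
    then show ?thesis using finI(2)[of s] by (simp add: order.strict_trans1)
  qed
  have finD: "(\<integral>\<^sup>+\<tau>\<in>?I. ennreal (lam * ?E \<tau>) * ?D s \<tau> \<partial>lborel) < \<infinity>" for s
  proof -
    have "ennreal (?E (entry z)) * inflow c signed_datum signed_part k s z + (\<integral>\<^sup>+\<tau>\<in>?I. ennreal (?E \<tau>) * ?H s \<tau> \<partial>lborel) < \<infinity>"
      using finI(1)[of s] finH[of s] by (simp add: ennreal_mult_less_top)
    then show ?thesis unfolding parts[of s, symmetric] by simp
  qed
  \<comment> \<open>From here on everything is finite and can be rewritten with real integrals.\<close>
  define h where "h s \<tau> = indicator ?I \<tau> * (?E \<tau> * enn2real (?H s \<tau>))" for s \<tau>
  define d where "d s \<tau> = indicator ?I \<tau> * (lam * ?E \<tau> * enn2real (?D s \<tau>))" for s \<tau>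
  have hE: "h s = (\<lambda>\<tau>. enn2real (ennreal (?E \<tau>) * ?H s \<tau> * indicator ?I \<tau>))" for s
    by (auto simp: h_def enn2real_mult indicator_def)
  have dE: "d s = (\<lambda>\<tau>. enn2real (ennreal (lam * ?E \<tau>) * ?D s \<tau> * indicator ?I \<tau>))" for s
    using lam_pos by (auto simp: d_def enn2real_mult indicator_def)
  have int: "integrable lborel (h s)" "integrable lborel (d s)" for s
    unfolding hE dE using finH[of s] finD[of s] by (auto intro!: integral_enn2real(1))
  have real_parts: "?E t * enn2real (?D s t) + (LINT \<tau>|lborel. d s \<tau>)
      = ?E (entry z) * enn2real (inflow c signed_datum signed_part k s z) + (LINT \<tau>|lborel. h s \<tau>)" for s
  proof -
    have "enn2real (ennreal (?E t) * ?D s t + (\<integral>\<^sup>+\<tau>\<in>?I. ennreal (lam * ?E \<tau>) * ?D s \<tau> \<partial>lborel))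
        = ?E t * enn2real (?D s t) + (LINT \<tau>|lborel. d s \<tau>)"
      unfolding dE using finD[of s] fin[OF t, of s]
      by (subst integral_enn2real(2)) (auto simp: enn2real_plus enn2real_mult ennreal_mult_less_top)
    moreover have "enn2real (ennreal (?E (entry z)) * inflow c signed_datum signed_part k s z + (\<integral>\<^sup>+\<tau>\<in>?I. ennreal (?E \<tau>) * ?H s \<tau> \<partial>lborel))
        = ?E (entry z) * enn2real (inflow c signed_datum signed_part k s z) + (LINT \<tau>|lborel. h s \<tau>)"
      unfolding hE using finH[of s] finI(1)[of s]
      by (subst integral_enn2real(2)) (auto simp: enn2real_plus enn2real_mult ennreal_mult_less_top)
    ultimately show ?thesis using parts[of s] by simp
  qed
  have AE_src: "AE \<tau> in lborel. (h True \<tau> - h False \<tau>) - (d True \<tau> - d False \<tau>)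
      = indicator ?I \<tau> * v_src k \<tau> (z - \<tau>)"
  proof -
    have "AE \<tau> in lborel. ?H s \<tau> * indicator ?I \<tau> \<noteq> \<infinity>" for s
      using finI(2)[of s] by (intro nn_integral_noteq_infinite) auto
    then have "AE \<tau> in lborel. ?H True \<tau> * indicator ?I \<tau> \<noteq> \<infinity> \<and> ?H False \<tau> * indicator ?I \<tau> \<noteq> \<infinity>"
      by auto
    then show ?thesis
    proof eventually_elim
      case (elim \<tau>)
      show ?case
      proof (cases "\<tau> \<in> ?I")
        case True
        have H: "enn2real (?H s \<tau>) = (lam - al k \<tau> (z - \<tau>)) * enn2real (signed_part k s \<tau> (z - \<tau>))
            + al k \<tau> (z - \<tau>) * enn2real (signed_part (\<not> k) s \<tau> (1 - (z - \<tau>)))" for s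
        proof -
          have "?H s \<tau> < \<infinity>" using elim True by (cases s) (auto simp: less_top)
          then show ?thesis
            using al_nonneg[of k \<tau> "z - \<tau>"] al_le[of k \<tau> "z - \<tau>"]
            by (simp add: src_def enn2real_plus enn2real_mult)
        qed
        show ?thesis using True by (simp add: h_def d_def H v_src_def v_def algebra_simps)
      qed (simp add: h_def d_def)
    qed
  qed
  have mV [measurable]: "(\<lambda>\<tau>. v_src k \<tau> (z - \<tau>)) \<in> borel_measurable borel"
    unfolding v_src_def by measurable
  have mh [measurable]: "h s \<in> borel_measurable borel" "d s \<in> borel_measurable borel" for s
    using int[of s] by (auto dest: borel_measurable_integrable)
  show "set_integrable lborel ?I (\<lambda>\<tau>. v_src k \<tau> (z - \<tau>))"
  proof -
    have "integrable lborel (\<lambda>\<tau>. (h True \<tau> - h False \<tau>) - (d True \<tau> - d False \<tau>))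
        = integrable lborel (\<lambda>\<tau>. indicator ?I \<tau> * v_src k \<tau> (z - \<tau>))"
      using AE_src by (intro integrable_cong_AE) auto
    then show ?thesis using int by (simp add: set_integrable_def)
  qed
  have "(LINT \<tau>:?I|lborel. v_src k \<tau> (z - \<tau>)) = (LINT \<tau>|lborel. (h True \<tau> - h False \<tau>) - (d True \<tau> - d False \<tau>))"
    unfolding set_lebesgue_integral_def using AE_src by (intro integral_cong_AE) auto
  also have "\<dots> = (?E t * enn2real (?D True t) - ?E (entry z) * enn2real (inflow c signed_datum signed_part k True z))
      - (?E t * enn2real (?D False t) - ?E (entry z) * enn2real (inflow c signed_datum signed_part k False z))"
    using int real_parts[of True] real_parts[of False] by simp
  also have "\<dots> = v k t (z - t) - ?E (entry z) * (enn2real (inflow c signed_datum signed_part k True z) - enn2real (inflow c signed_datum signed_part k False z))"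
    by (simp add: v_def algebra_simps)
  also have "?E (entry z) * (enn2real (inflow c signed_datum signed_part k True z) - enn2real (inflow c signed_datum signed_part k False z)) = v_in k z"
    by (cases "0 \<le> f0 k z"; cases "c k < 0")
       (auto simp: v_in_def inflow_def entry_def signed_datum_def v_def enn2real_mult ennreal_neg algebra_simps)
  finally show "v k t (z - t) = v_in k z + (LINT \<tau>:?I|lborel. v_src k \<tau> (z - \<tau>))" by simp
qed

text \<open>
At \<open>x = 1\<close> the line has only just entered, so the boundary condition holds at every time.
\<close>

lemma v_trace_in: "0 \<le> t \<Longrightarrow> v k t 1 = c k * v (\<not> k) t 0"
proof -
  assume t: "0 \<le> t"
  have U1: "signed_part k s t 1 = ennreal \<bar>c k\<bar> * signed_part (\<not> k) (s \<noteq> (c k < 0)) t 0" for s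
  proof -
    have "{entry (t + 1)..t} = {t}" using t by (auto simp: entry_def)
    moreover have "(\<integral>\<^sup>+\<tau>\<in>{t}. src (\<lambda>k. signed_part k s) k \<tau> (t + 1 - \<tau>) \<partial>lborel) = 0"
      by (intro nn_integral_null_set) auto
    ultimately show ?thesis using signed_part_char[of k s t "t + 1"] t by (simp add: inflow_def)
  qed
  show ?thesis
    by (cases "c k < 0") (auto simp: v_def U1 enn2real_mult algebra_simps)
qed

lemma v_decay:
  assumes t: "0 \<le> t"
  shows "(\<Sum>k\<in>UNIV. \<integral>\<^sup>+x\<in>{0..1}. ennreal (\<bar>v k t x\<bar> powr p) \<partial>lborel)
    \<le> ennreal (exp (- eps * t) / q) * (\<Sum>k\<in>UNIV. \<integral>\<^sup>+x\<in>{0..1}. ennreal (\<bar>f0 k x\<bar> powr p) \<partial>lborel)"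
proof -
  let ?S = "\<Sum>k\<in>UNIV. \<integral>\<^sup>+x\<in>{0..1}. majorant k t x \<partial>lborel"
  have "(\<Sum>k\<in>UNIV. \<integral>\<^sup>+x\<in>{0..1}. ennreal (\<bar>v k t x\<bar> powr p) \<partial>lborel)
      \<le> (\<Sum>k\<in>UNIV. \<integral>\<^sup>+x\<in>{0..1}. ennreal (exp (- lam * t)) * majorant k t x \<partial>lborel)"
  proof (intro sum_mono nn_integral_mono)
    fix k x
    show "ennreal (\<bar>v k t x\<bar> powr p) * indicator {0..1} x \<le> ennreal (exp (- lam * t)) * majorant k t x * indicator {0..1} x"
      using v_powr_le[OF t, of x k] by (cases "x \<in> {0..1}") auto
  qed
  also have "\<dots> = ennreal (exp (- lam * t)) * ?S"
    unfolding sum_distrib_left by (subst nn_integral_cmult[symmetric]) (auto simp: mult.assoc)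
  also have "\<dots> = ennreal (exp (- eps * t) / q) * (ennreal (q * exp ((eps - lam) * t)) * ?S)"
    using q by (simp add: mult.assoc[symmetric] algebra_simps flip: ennreal_mult exp_add)
  also have "\<dots> \<le> ennreal (exp (- eps * t) / q) * (\<Sum>k\<in>UNIV. \<integral>\<^sup>+x\<in>{0..1}. ennreal (\<bar>f0 k x\<bar> powr p) \<partial>lborel)"
    unfolding majorant_def using f0_finite t by (intro mult_left_mono sol_decay) (auto simp: UNIV_bool)
  finally show ?thesis .
qed

lemma majorant_exit_finite: "(\<integral>\<^sup>+z\<in>{0..T}. majorant k z 0 \<partial>lborel) < \<infinity>"
proof (cases "0 \<le> T")
  case True
  then show ?thesis
    unfolding majorant_def using f0_finite by (intro sol_outflow_finite) (auto simp: UNIV_bool)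
qed simp

lemma AE_majorant_exit: "AE z in lborel. 0 \<le> z \<longrightarrow> majorant k z 0 < \<infinity>"
proof -
  have "AE z in lborel. majorant k z 0 * indicator {0..real n} z \<noteq> \<infinity>" for n
    using majorant_exit_finite[of k "real n"] by (intro nn_integral_noteq_infinite) auto
  then have "AE z in lborel. \<forall>n. majorant k z 0 * indicator {0..real n} z \<noteq> \<infinity>"
    by (simp add: AE_all_countable)
  then show ?thesis
  proof eventually_elim
    case (elim z)
    obtain n where "z \<le> real n" using real_arch_simple by blast
    then show ?case using elim[rule_format, of n] by (auto simp: indicator_def less_top)
  qed
qed

end

section \<open>Regularity of the solution\<close>

lemma AE_lebesgue_on_iff:
  "S \<in> sets lebesgue \<Longrightarrow> (AE x in lebesgue_on S. P x) \<longleftrightarrow> (AE x in lborel. x \<in> S \<longrightarrow> P x)"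
  by (simp add: AE_restrict_space_iff AE_completion_iff)

text \<open>
Completeness of Lebesgue measure.
\<close>

lemma lebesgue_measurable_AE_eq:
  fixes f g :: "'a::euclidean_space \<Rightarrow> real"
  assumes [measurable]: "g \<in> borel_measurable borel" and eq: "AE x in lborel. f x = g x"
  shows "f \<in> borel_measurable lebesgue"
proof (rule measurableI)
  fix B :: "real set" assume [measurable]: "B \<in> sets borel"
  show "f -` B \<inter> space lebesgue \<in> sets lebesgue"
  proof (rule completion.in_sets_AE[where A="g -` B"])
    show "AE x in lebesgue. (x \<in> g -` B) = (x \<in> f -` B \<inter> space lebesgue)"
      using AE_completion[OF eq] by eventually_elim simp
    have "g -` B \<inter> space borel \<in> sets borel" by measurable
    then show "g -` B \<in> sets lebesgue" by simp
  qed simp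
qed simp

text \<open>
Passes from a coefficient along a line to its Borel representative; completeness of Lebesgue measure
makes the left integrand measurable.
\<close>

lemma LINT_lebesgue_on_cong:
  fixes f g :: "real \<Rightarrow> real"
  assumes [measurable]: "I \<in> sets borel" "g \<in> borel_measurable borel"
    and eq: "AE s in lborel. s \<in> I \<longrightarrow> f s = g s"
  shows "(LINT s|lebesgue_on I. f s) = (LINT s:I|lborel. g s)"
proof -
  have eq': "AE s in lborel. indicator I s *\<^sub>R f s = indicator I s *\<^sub>R g s"
    using eq by eventually_elim (auto simp: indicator_def)
  have "(LINT s|lebesgue_on I. f s) = (LINT s|lebesgue. indicator I s *\<^sub>R f s)"
    by (rule integral_restrict_space) simp
  also have "\<dots> = (LINT s|lebesgue. indicator I s *\<^sub>R g s)"
  proof (rule integral_cong_AE)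
    show "(\<lambda>s. indicator I s *\<^sub>R f s) \<in> borel_measurable lebesgue"
      using _ eq' by (rule lebesgue_measurable_AE_eq) measurable
    show "(\<lambda>s. indicator I s *\<^sub>R g s) \<in> borel_measurable lebesgue"
      by (rule measurable_completion) measurable
  qed (rule AE_completion[OF eq'])
  also have "\<dots> = (LINT s:I|lborel. g s)"
    unfolding set_lebesgue_integral_def by (rule integral_completion) measurable
  finally show ?thesis .
qed

lemma ex_borel_representative:
  fixes f :: "'a::euclidean_space \<Rightarrow> real"
  assumes [measurable]: "S \<in> sets borel" and f: "f \<in> borel_measurable (lebesgue_on S)"
  obtains g where "g \<in> borel_measurable borel" "AE x in lborel. x \<in> S \<longrightarrow> f x = g x" "\<And>x. x \<notin> S \<Longrightarrow> g x = 0"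
proof -
  have "(\<lambda>x. if x \<in> S then f x else 0) \<in> borel_measurable lebesgue"
    using f by (subst borel_measurable_if) auto
  then obtain g where g: "g \<in> borel_measurable lborel" "AE x in lborel. (if x \<in> S then f x else 0) = g x"
    using completion_ex_borel_measurable_real by blast
  show thesis
  proof (rule that[of "\<lambda>x. if x \<in> S then g x else 0"])
    show "(\<lambda>x. if x \<in> S then g x else 0) \<in> borel_measurable borel"
      using g(1) by measurable
    show "AE x in lborel. x \<in> S \<longrightarrow> f x = (if x \<in> S then g x else 0)"
      using g(2) by eventually_elim (auto split: if_splits)
  qed simp
qed

lemma AE_lborel_pairI:
  fixes P :: "real \<Rightarrow> real \<Rightarrow> bool"
  assumes "{w. P (fst w) (snd w)} \<in> sets borel" and "\<And>t. AE x in lborel. P t x"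
  shows "AE w in lborel. P (fst w) (snd w)"
  using lborel_pair.AE_pair_measure[of "\<lambda>w. P (fst w) (snd w)", unfolded lborel_prod] assms
  by simp

lemma AE_line_label:
  fixes P :: "real \<Rightarrow> bool"
  assumes "AE z in lborel. P z" and "e \<noteq> 0"
  shows "AE w in lborel. P (fst w + (d + e * snd w))"
proof -
  obtain N where N: "{z. \<not> P z} \<subseteq> N" "emeasure lborel N = 0" "N \<in> sets lborel"
    using AE_E[OF assms(1)] by auto
  have [measurable]: "N \<in> sets borel" using N by simp
  have N': "AE z in lborel. z \<notin> N" using N by (intro AE_not_in) (auto simp: null_sets_def)
  have "AE w in lborel. fst w + (d + e * snd w) \<notin> N"
  proof (rule AE_lborel_pairI)
    have "Measurable.pred (borel \<Otimes>\<^sub>M borel) (\<lambda>w::real \<times> real. fst w + (d + e * snd w) \<notin> N)" by measurable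
    then show "{w::real \<times> real. fst w + (d + e * snd w) \<notin> N} \<in> sets borel"
      by (simp add: pred_def borel_prod space_pair_measure)
    fix t
    show "AE x in lborel. t + (d + e * x) \<notin> N"
      using AE_borel_affine[OF assms(2) _ N', of "t + d"] by (simp add: add.assoc)
  qed
  then show ?thesis by eventually_elim (use N in auto)
qed

text \<open>
A null set of the plane meets almost every line \<open>t + x = z\<close> in a null set. The case \<open>e = - 1\<close> concerns
the lines that rise to the right.
\<close>

lemma AE_slices:
  fixes Q :: "real \<Rightarrow> real \<Rightarrow> bool"
  assumes "AE w in lborel. Q (fst w) (snd w)" and e: "e = 1 \<or> e = (-1::real)"
  shows "AE z in lborel. AE s in lborel. Q s (d + e * (z - s))"
proof -
  obtain N where N: "{w. \<not> Q (fst w) (snd w)} \<subseteq> N" "emeasure lborel N = 0" "N \<in> sets (lborel :: (real \<times> real) measure)"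
    using AE_E[OF assms(1)] by auto
  have [measurable]: "N \<in> sets (borel \<Otimes>\<^sub>M borel)" using N(3) unfolding borel_prod by simp
  define k :: "real \<Rightarrow> real \<Rightarrow> ennreal" where "k s x = indicator N (s, d + e * x)" for s x
  have kint: "(\<integral>\<^sup>+x. k s x \<partial>lborel) = (\<integral>\<^sup>+x. indicator N (s, x) \<partial>lborel)" for s
    using nn_integral_real_affine[of "\<lambda>x. indicator N (s, x)" e d] e
    unfolding k_def by (auto simp: add.commute)
  have [measurable]: "case_prod k \<in> borel2"
    unfolding k_def split_beta' by measurable
  have "(\<integral>\<^sup>+z. (\<integral>\<^sup>+s. k s (z - s) \<partial>lborel) \<partial>lborel) = (\<integral>\<^sup>+s. (\<integral>\<^sup>+x. k s x \<partial>lborel) \<partial>lborel)"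
    by (rule nn_integral_shear) measurable
  also have "\<dots> = emeasure lborel N"
    using lborel_pair.emeasure_pair_measure_alt kint N(3)
    by (simp add: lborel.emeasure_pair_measure lborel_prod[symmetric])
  finally have "(\<integral>\<^sup>+z. (\<integral>\<^sup>+s. k s (z - s) \<partial>lborel) \<partial>lborel) = 0" using N by simp
  then have "AE z in lborel. (\<integral>\<^sup>+s. k s (z - s) \<partial>lborel) = 0"
    by (subst (asm) nn_integral_0_iff_AE) auto
  then show ?thesis
  proof eventually_elim
    case (elim z)
    then have "AE s in lborel. k s (z - s) = 0"
      by (subst (asm) nn_integral_0_iff_AE) auto
    then show ?case
    proof eventually_elim
      case (elim s)
      then have "(s, d + e * (z - s)) \<notin> N" by (simp add: k_def indicator_eq_0_iff)
      then have "(s, d + e * (z - s)) \<notin> {w. \<not> Q (fst w) (snd w)}" using N(1) by blast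
      then show ?case by simp
    qed
  qed
qed

lemma AE_pair_lborel:
  fixes Q :: "real \<Rightarrow> real \<Rightarrow> bool"
  assumes "AE w in lborel. Q (fst w) (snd w)"
  shows "AE t in lborel. AE x in lborel. Q t x"
  using lborel_pair.AE_pair[of "\<lambda>w. Q (fst w) (snd w)", unfolded lborel_prod] assms by simp

lemma continuous_into_Lp_flip_param:
  assumes "continuous_into_Lp p {0..1} S u"
  shows "continuous_into_Lp p {0..1} S (\<lambda>x. u (1 - x))"
  unfolding continuous_into_Lp_def
proof safe
  fix t :: real assume t: "t \<in> {0..1}"
  then show "u (1 - t) \<in> Lp_space p S" using assms by (auto simp: continuous_into_Lp_def)
  have "((\<lambda>s. Lp_norm p S (\<lambda>x. u s x - u (1 - t) x)) \<longlongrightarrow> 0) (at (1 - t) within {0..1})"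
    using assms t by (auto simp: continuous_into_Lp_def)
  moreover have "filterlim (\<lambda>s. 1 - s) (at (1 - t) within {0..1}) (at t within {0..1})"
    unfolding filterlim_at by (auto intro!: tendsto_intros simp: eventually_at_filter)
  ultimately show "((\<lambda>s. Lp_norm p S (\<lambda>x. u (1 - s) x - u (1 - t) x)) \<longlongrightarrow> 0) (at t within {0..1})"
    by (rule filterlim_compose)
qed

lemma Lp_space_borel_iff:
  assumes "S \<in> sets lebesgue" and [measurable]: "f \<in> borel_measurable borel"
  shows "f \<in> Lp_space p S \<longleftrightarrow> (\<integral>\<^sup>+x. ennreal (\<bar>f x\<bar> powr p) * indicator S x \<partial>lborel) < \<infinity>"
  using borel_imp_lebesgue_on[OF assms(2), of S]
  by (auto simp: Lp_space_def integrable_iff_bounded nn_integral_lebesgue_on[OF assms(1)])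

lemma continuous_into_Lp_flip_space:
  fixes u :: "real \<Rightarrow> real \<Rightarrow> real"
  assumes u: "continuous_into_Lp p I {0<..<1} u" and [measurable]: "\<And>t. u t \<in> borel_measurable borel"
  shows "continuous_into_Lp p I {0<..<1} (\<lambda>t x. u t (1 - x))"
proof -
  let ?S = "{0<..<1::real}"
  have eq: "(\<integral>\<^sup>+x. ennreal (\<bar>f (1 - x)\<bar> powr p) * indicator ?S x \<partial>lborel) = (\<integral>\<^sup>+x. ennreal (\<bar>f x\<bar> powr p) * indicator ?S x \<partial>lborel)"
    if [measurable]: "f \<in> borel_measurable borel" for f :: "real \<Rightarrow> real"
  proof -
    have "(\<integral>\<^sup>+x. ennreal (\<bar>f (1 - x)\<bar> powr p) * indicator ?S x \<partial>lborel)
        = (\<integral>\<^sup>+x. ennreal (\<bar>f (1 - x)\<bar> powr p) * indicator ?S (1 - x) \<partial>lborel)"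
      by (intro nn_integral_cong) (auto simp: indicator_def)
    also have "\<dots> = (\<integral>\<^sup>+x. ennreal (\<bar>f x\<bar> powr p) * indicator ?S x \<partial>lborel)"
      by (rule nn_integral_flip[where f="\<lambda>x. ennreal (\<bar>f x\<bar> powr p) * indicator ?S x"]) measurable
    finally show ?thesis .
  qed
  have norm: "Lp_norm p ?S (\<lambda>x. f (1 - x)) = Lp_norm p ?S f" if [measurable]: "f \<in> borel_measurable borel" for f :: "real \<Rightarrow> real"
    by (subst (1 2) Lp_norm_eq) (auto intro!: borel_imp_lebesgue_on simp: nn_integral_lebesgue_on eq)
  have space: "(\<lambda>x. f (1 - x)) \<in> Lp_space p ?S \<longleftrightarrow> f \<in> Lp_space p ?S" if [measurable]: "f \<in> borel_measurable borel" for f :: "real \<Rightarrow> real"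
    by (subst (1 2) Lp_space_borel_iff) (auto simp: eq)
  show ?thesis
    using u unfolding continuous_into_Lp_def
    by (simp add: space norm[of "\<lambda>x. u s x - u t x" for s t])
qed

context initial_data begin

lemma v_continuous_on_char:
  assumes z: "0 \<le> z" "majorant k z 0 < \<infinity>"
  shows "continuous_on {entry z..z} (\<lambda>t. v k t (z - t))"
proof -
  let ?F = "\<lambda>\<tau>. v_src k \<tau> (z - \<tau>)"
  have le: "entry z \<le> z" using z by (auto simp: entry_def)
  have "?F integrable_on {entry z..z}"
    using v_char(1)[OF z le order_refl] by (rule set_borel_integral_eq_integral(1))
  then have "continuous_on {entry z..z} (\<lambda>t. v_in k z + integral {entry z..t} ?F)"
    by (intro continuous_intros indefinite_integral_continuous_1)
  then show ?thesis
    by (rule continuous_on_cong[THEN iffD1, OF refl, rotated])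
       (use v_char[OF z] in \<open>auto simp: set_borel_integral_eq_integral(2)\<close>)
qed

text \<open>
The solution on the line with label \<open>z\<close>, with \<open>t\<close> clipped to the time interval on which the line lies in
the strip. Thus it is defined for all \<open>t\<close> and continuous in \<open>t\<close>.
\<close>

definition on_char :: "real \<Rightarrow> bool \<Rightarrow> real \<Rightarrow> real \<Rightarrow> real" where
  "on_char T k t z = (let t' = max (entry z) (min t z) in
     if 0 \<le> z \<and> z \<le> T + 1 then v k t' (z - t') else 0)"

lemma on_char_measurable: "case_prod (on_char T k) \<in> borel2"
  unfolding on_char_def Let_def split_beta' by measurable

lemma on_char_eq:
  assumes "0 \<le> t" "t \<le> T" "0 \<le> x" "x \<le> 1"
  shows "on_char T k t (x + t) = v k t x"
proof -
  have "max (entry (x + t)) (min t (x + t)) = t" using assms by (auto simp: entry_def)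
  then show ?thesis using assms by (simp add: on_char_def)
qed

lemma on_char_continuous:
  assumes "0 \<le> z \<longrightarrow> majorant k z 0 < \<infinity>"
  shows "continuous_on A (\<lambda>t. on_char T k t z)"
proof (cases "0 \<le> z \<and> z \<le> T + 1")
  case True
  then have "continuous_on {entry z..z} (\<lambda>t. v k t (z - t))"
    using assms by (intro v_continuous_on_char) auto
  then have "continuous_on A (\<lambda>t. v k (max (entry z) (min t z)) (z - max (entry z) (min t z)))"
    by (rule continuous_on_compose2[where f="\<lambda>t. max (entry z) (min t z)"])
       (use True in \<open>auto intro!: continuous_intros simp: entry_def\<close>)
  then show ?thesis using True by (simp add: on_char_def Let_def)
next
  case False
  then have "on_char T k t z = 0" for t by (auto simp: on_char_def Let_def)
  then show ?thesis by simp
qed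

text \<open>
A bound in \<open>Lp\<close> for the solution along the whole line with label \<open>z\<close>.
\<close>

definition exit_bound :: "real \<Rightarrow> bool \<Rightarrow> real \<Rightarrow> real" where
  "exit_bound T k z = (if 0 \<le> z \<and> z \<le> T + 1 then enn2real (majorant k z 0) powr (1 / p) else 0)"

lemma exit_bound_measurable [measurable]: "exit_bound T k \<in> borel_measurable borel"
  unfolding exit_bound_def by measurable

lemma pmass_exit_bound: "pmass p (exit_bound T k) < \<infinity>"
proof -
  have "pmass p (exit_bound T k) \<le> (\<integral>\<^sup>+z\<in>{0..T + 1}. majorant k z 0 \<partial>lborel)"
    unfolding pmass_def
  proof (intro nn_integral_mono)
    fix z
    have "ennreal (enn2real (majorant k z 0)) \<le> majorant k z 0"
      by (cases "majorant k z 0 = top") (auto simp: less_top)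
    then show "ennreal (\<bar>exit_bound T k z\<bar> powr p) \<le> majorant k z 0 * indicator {0..T + 1} z"
      using p by (auto simp: exit_bound_def powr_powr)
  qed
  then show ?thesis using majorant_exit_finite by (rule order.strict_trans1)
qed

lemma on_char_le:
  assumes "0 \<le> z \<longrightarrow> majorant k z 0 < \<infinity>"
  shows "\<bar>on_char T k t z\<bar> \<le> exit_bound T k z"
proof (cases "0 \<le> z \<and> z \<le> T + 1")
  case True
  define t' where "t' = max (entry z) (min t z)"
  have t': "0 \<le> t'" "t' \<le> z" "z - t' \<le> 1" using True by (auto simp: t'_def entry_def)
  have "ennreal (\<bar>v k t' (z - t')\<bar> powr p) \<le> ennreal (exp (- lam * t')) * majorant k t' (z - t')"
    using t' by (intro v_powr_le) auto
  also have "\<dots> \<le> 1 * majorant k z 0"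
    using t' lam_pos by (intro mult_mono majorant_le_exit) (auto simp: ennreal_le_1)
  finally have "\<bar>v k t' (z - t')\<bar> powr p \<le> enn2real (majorant k z 0)"
    using assms True by (simp add: ennreal_le_iff2 less_top flip: ennreal_enn2real_if)
      (metis enn2real_ennreal enn2real_mono powr_ge_zero)
  then have "(\<bar>v k t' (z - t')\<bar> powr p) powr (1 / p) \<le> enn2real (majorant k z 0) powr (1 / p)"
    using p by (intro powr_mono2) auto
  then show ?thesis using True p by (simp add: on_char_def exit_bound_def t'_def Let_def powr_powr)
next
  case False
  then show ?thesis by (auto simp: on_char_def exit_bound_def Let_def)
qed

lemma v_continuous_time: "continuous_into_Lp p {0..T} {0<..<1} (v k)"
proof -
  have [measurable]: "on_char T k t \<in> borel_measurable borel" for t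
    using on_char_measurable by measurable
  have "continuous_into_Lp p {0..T} {0<..<1} (\<lambda>t x. on_char T k t (x + t))"
  proof (rule continuous_into_Lp_glide[where M="exit_bound T k"])
    show "AE z in lborel. \<bar>on_char T k t z\<bar> \<le> exit_bound T k z" for t
      using AE_majorant_exit by eventually_elim (rule on_char_le)
    show "AE z in lborel. continuous_on {0..T} (\<lambda>t. on_char T k t z)"
      using AE_majorant_exit by eventually_elim (rule on_char_continuous)
  qed (use p pmass_exit_bound in auto)
  then show ?thesis by (rule continuous_into_Lp_cong) (auto simp: on_char_eq)
qed

text \<open>
On the line with label \<open>z\<close> the point \<open>x\<close> is reached at time \<open>z - x\<close>, so the same bound and the
same continuity serve, with the roles of time and space exchanged.
\<close>

lemma v_continuous_space: "continuous_into_Lp p {0..1} {0<..<T} (\<lambda>x t. v k t x)"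
proof -
  have [measurable]: "(\<lambda>z. on_char T k (z - x) z) \<in> borel_measurable borel" for x
    using on_char_measurable by measurable
  have "continuous_into_Lp p {0..1} {0<..<T} (\<lambda>x t. (\<lambda>x z. on_char T k (z - x) z) x (t + x))"
  proof (rule continuous_into_Lp_glide[where M="exit_bound T k"])
    show "AE z in lborel. \<bar>on_char T k (z - x) z\<bar> \<le> exit_bound T k z" for x
      using AE_majorant_exit by eventually_elim (rule on_char_le)
    show "AE z in lborel. continuous_on {0..1} (\<lambda>x. on_char T k (z - x) z)"
      using AE_majorant_exit[of k]
    proof (rule AE_mp, intro AE_I2 impI)
      fix z assume "0 \<le> z \<longrightarrow> majorant k z 0 < \<infinity>"
      then show "continuous_on {0..1} (\<lambda>x. on_char T k (z - x) z)"
        by (intro continuous_on_compose2[OF on_char_continuous[of z k UNIV T]])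
           (auto intro!: continuous_intros)
    qed
  qed (use p pmass_exit_bound in auto)
  then show ?thesis
  proof (rule continuous_into_Lp_cong)
    fix x t :: real assume "x \<in> {0..1}" "t \<in> {0<..<T}"
    then show "on_char T k (t + x - x) (t + x) = v k t x"
      using on_char_eq[of t T x k] by (simp add: add.commute)
  qed
qed

end

section \<open>The reflected form of broad solutions, and existence\<close>

lemma AE_real_affine:
  fixes P :: "real \<Rightarrow> bool"
  assumes "AE z in lborel. P z" and "e \<noteq> 0"
  shows "AE x in lborel. P (d + e * x)"
proof -
  obtain N where N: "{z. \<not> P z} \<subseteq> N" "emeasure lborel N = 0" "N \<in> sets lborel"
    using AE_E[OF assms(1)] by auto
  have [measurable]: "N \<in> sets borel" using N by simp
  have "AE z in lborel. z \<notin> N" using N by (intro AE_not_in) (auto simp: null_sets_def)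
  then have "AE x in lborel. d + e * x \<notin> N"
    by (intro AE_borel_affine[OF assms(2)]) measurable
  then show ?thesis by eventually_elim (use N in auto)
qed

lemma AE_reflect_space:
  fixes Q :: "real \<Rightarrow> real \<Rightarrow> bool"
  assumes "AE w in lborel. Q (fst w) (snd w)"
  shows "AE w in lborel. Q (fst w) (1 - snd w)"
proof -
  obtain N where N: "{w. \<not> Q (fst w) (snd w)} \<subseteq> N" "emeasure lborel N = 0" "N \<in> sets (lborel :: (real \<times> real) measure)"
    using AE_E[OF assms] by auto
  have [measurable]: "N \<in> sets (borel \<Otimes>\<^sub>M borel)" using N(3) unfolding borel_prod by simp
  have "AE w in lborel. (fst w, snd w) \<notin> N"
    using AE_not_in[of N lborel] N by (auto simp: null_sets_def)
  then have "AE t in lborel. AE x in lborel. (t, x) \<notin> N" by (rule AE_pair_lborel)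
  then have "AE t in lborel. AE x in lborel. (t, 1 - x) \<notin> N"
  proof eventually_elim
    case (elim t)
    show ?case using AE_real_affine[OF elim, of "-1" 1] by simp
  qed
  moreover have "{w::real \<times> real. (fst w, 1 - snd w) \<notin> N} \<in> sets borel"
  proof -
    have "Measurable.pred (borel \<Otimes>\<^sub>M borel) (\<lambda>w::real \<times> real. (fst w, 1 - snd w) \<notin> N)" by measurable
    then show ?thesis by (simp add: pred_def borel_prod space_pair_measure)
  qed
  ultimately have "AE w in lborel. (fst w, 1 - snd w) \<notin> N"
    using lborel_pair.AE_pair_measure[of "\<lambda>w. (fst w, 1 - snd w) \<notin> N", unfolded lborel_prod] by simp
  then show ?thesis
  proof eventually_elim
    case (elim w)
    then have "(fst w, 1 - snd w) \<notin> {w. \<not> Q (fst w) (snd w)}" using N(1) by blast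
    then show ?case by simp
  qed
qed

definition reflect :: "bool \<Rightarrow> (real \<Rightarrow> real \<Rightarrow> 'a) \<Rightarrow> real \<Rightarrow> real \<Rightarrow> 'a" where
  "reflect k u t x = u t (if k then 1 - x else x)"

text \<open>
The characteristic rule for component \<open>k\<close> of the reflected unknowns, in terms of the label
\<open>z = x + t\<close>; \<open>b k\<close> is half of \<open>a\<close> seen from component \<open>k\<close>.
\<close>

definition char_rule :: "real \<Rightarrow> (bool \<Rightarrow> real \<Rightarrow> real \<Rightarrow> real) \<Rightarrow> (bool \<Rightarrow> real \<Rightarrow> real) \<Rightarrow>
    (bool \<Rightarrow> real \<Rightarrow> real \<Rightarrow> real) \<Rightarrow> bool \<Rightarrow> bool" where
  "char_rule T b f0 y k \<longleftrightarrow> (AE w in lborel. in_strip T (fst w) (snd w) \<longrightarrow>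
     (let t = fst w; z = snd w + t;
          S = (\<lambda>s. - b k s (z - s) * (y k s (z - s) - y (\<not> k) s (1 - (z - s)))) in
       (z < 1 \<longrightarrow> y k t (snd w) = f0 k z + (LINT s|lebesgue_on {0..t}. S s)) \<and>
       (z > 1 \<longrightarrow> y k t (snd w) = y k (z - 1) 1 + (LINT s|lebesgue_on {z - 1..t}. S s))))"

text \<open>
The two pairs of rules become one rule with an index. For \<open>\<xi>\<close> the point \<open>x\<close> is replaced by
\<open>1 - x\<close>, which preserves null sets.
\<close>

lemma broad_solution_upto_iff:
  fixes a :: "real \<times> real \<Rightarrow> real"
  defines "b \<equiv> \<lambda>k. reflect k (\<lambda>t x. a (t, x) / 2)"
  shows "broad_solution_upto p c0 c1 a \<rho>0 \<xi>0 T \<rho> \<xi> \<longleftrightarrow>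
    broad_class p T \<rho> \<and> broad_class p T \<xi> \<and>
    (\<forall>k. char_rule T b (\<lambda>k z. if k then \<xi>0 (1 - z) else \<rho>0 z) (\<lambda>k. reflect k (if k then \<xi> else \<rho>)) k) \<and>
    (AE t in lborel. t \<in> {0<..<T} \<longrightarrow> \<xi> t 0 = c0 * \<rho> t 0) \<and>
    (AE t in lborel. t \<in> {0<..<T} \<longrightarrow> \<rho> t 1 = c1 * \<xi> t 1)"
proof -
  let ?S = "{0<..<T} \<times> {0<..<1::real}"
  let ?F = "\<lambda>t x. - (1/2) * a (t, x) * (\<rho> t x - \<xi> t x)"
  let ?G = "\<lambda>t x. (1/2) * a (t, x) * (\<rho> t x - \<xi> t x)"
  let ?y = "\<lambda>k. reflect k (if k then \<xi> else \<rho>)"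
  let ?f0 = "\<lambda>k z. if k then \<xi>0 (1 - z) else \<rho>0 z"
  define P where "P t x \<longleftrightarrow> (x + t < 1 \<longrightarrow> \<rho> t x = \<rho>0 (x + t) + (LINT s|lebesgue_on {0..t}. ?F s (x + t - s))) \<and>
     (x + t > 1 \<longrightarrow> \<rho> t x = \<rho> (t + x - 1) 1 + (LINT s|lebesgue_on {t + x - 1..t}. ?F s (x + t - s)))" for t x
  define P' where "P' t x \<longleftrightarrow> (x > t \<longrightarrow> \<xi> t x = \<xi>0 (x - t) + (LINT s|lebesgue_on {0..t}. ?G s (x - t + s))) \<and>
     (x < t \<longrightarrow> \<xi> t x = \<xi> (t - x) 0 + (LINT s|lebesgue_on {t - x..t}. ?G s (x - t + s)))" for t x
  let ?in = "\<lambda>t x. 0 < t \<and> t < T \<and> 0 < x \<and> x < (1::real)"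
  have S: "?S \<in> sets lebesgue" by (simp add: borel_prod[symmetric])
  have "char_rule T b ?f0 ?y False \<longleftrightarrow> (AE w in lborel. ?in (fst w) (snd w) \<longrightarrow> P (fst w) (snd w))"
    unfolding char_rule_def P_def Let_def b_def reflect_def by (simp add: algebra_simps)
  moreover have "char_rule T b ?f0 ?y True \<longleftrightarrow> (AE w in lborel. ?in (fst w) (1 - snd w) \<longrightarrow> P' (fst w) (1 - snd w))"
  proof -
    have eq: "1 - (x + t - s) = 1 - x - t + s" "1 - x - t + s = s + 1 - (t + x)" "t - (1 - x) = x + t - 1" "1 - (x + t) = 1 - x - t" for x t s :: real
      by auto
    have sub: "?G s (1 - (x + t - s)) = - (a (s, 1 - (x + t - s)) / 2) * (\<xi> s (1 - (x + t - s)) - \<rho> s (1 - (x + t - s)))" for s x t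
      by (simp add: algebra_simps)
    have "P' t (1 - x) \<longleftrightarrow> (x + t < 1 \<longrightarrow> \<xi> t (1 - x) = \<xi>0 (1 - (x + t)) + (LINT s|lebesgue_on {0..t}. ?G s (1 - (x + t - s)))) \<and>
     (x + t > 1 \<longrightarrow> \<xi> t (1 - x) = \<xi> (x + t - 1) 0 + (LINT s|lebesgue_on {x + t - 1..t}. ?G s (1 - (x + t - s))))" for t x
      unfolding P'_def by (intro conj_cong imp_cong) (auto simp: algebra_simps)
    then show ?thesis
      unfolding char_rule_def Let_def b_def reflect_def sub by (simp add: conj_commute)
  qed
  moreover have "(AE w in lborel. ?in (fst w) (1 - snd w) \<longrightarrow> P' (fst w) (1 - snd w))
      \<longleftrightarrow> (AE w in lborel. ?in (fst w) (snd w) \<longrightarrow> P' (fst w) (snd w))"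
    using AE_reflect_space[of "\<lambda>t x. ?in t x \<longrightarrow> P' t x"] AE_reflect_space[of "\<lambda>t x. ?in t (1 - x) \<longrightarrow> P' t (1 - x)"]
    by (intro iffI) simp_all
  moreover have "(AE (t, x) in lebesgue_on ?S. P t x \<and> P' t x)
      \<longleftrightarrow> (AE w in lborel. ?in (fst w) (snd w) \<longrightarrow> P (fst w) (snd w)) \<and> (AE w in lborel. ?in (fst w) (snd w) \<longrightarrow> P' (fst w) (snd w))"
    unfolding AE_lebesgue_on_iff[OF S] AE_conj_iff[symmetric] by (intro AE_cong) auto
  moreover have "(\<forall>k. X k) \<longleftrightarrow> X False \<and> X True" for X by (metis (full_types))
  ultimately have rule: "(AE (t, x) in lebesgue_on ?S. P t x \<and> P' t x) \<longleftrightarrow> (\<forall>k. char_rule T b ?f0 ?y k)"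
    by simp
  have "broad_solution_upto p c0 c1 a \<rho>0 \<xi>0 T \<rho> \<xi> \<longleftrightarrow>
    broad_class p T \<rho> \<and> broad_class p T \<xi> \<and> (AE (t, x) in lebesgue_on ?S. P t x \<and> P' t x) \<and>
     (AE t in lebesgue_on {0<..<T}. \<xi> t 0 = c0 * \<rho> t 0) \<and>
     (AE t in lebesgue_on {0<..<T}. \<rho> t 1 = c1 * \<xi> t 1)"
    unfolding broad_solution_upto_def P_def P'_def Let_def conj_assoc ..
  then show ?thesis unfolding rule by (simp add: AE_lebesgue_on_iff)
qed

context initial_data begin

text \<open>
Almost every point lies on a line that has a finite exit value and along which coefficient and datum agree
with their Borel representatives.
\<close>

lemma v_char_rule:
  assumes b: "AE w in lborel. 0 < fst w \<longrightarrow> 0 < snd w \<longrightarrow> snd w < 1 \<longrightarrow> b k (fst w) (snd w) = al k (fst w) (snd w)"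
    and g0: "AE z in lborel. 0 < z \<longrightarrow> z < 1 \<longrightarrow> g0 k z = f0 k z"
  shows "char_rule T b g0 v k"
proof -
  have lift: "AE w in lborel. P (snd w + fst w)" if "AE z in lborel. P z" for P :: "real \<Rightarrow> bool"
    using AE_line_label[OF that, of 1 0] by (simp add: add.commute)
  have "AE z in lborel. AE s in lborel. 0 < s \<longrightarrow> 0 < z - s \<longrightarrow> z - s < 1 \<longrightarrow> b k s (z - s) = al k s (z - s)"
    using AE_slices[of "\<lambda>t x. 0 < t \<longrightarrow> 0 < x \<longrightarrow> x < 1 \<longrightarrow> b k t x = al k t x" 1 0] b by simp
  from lift[OF this] lift[OF AE_majorant_exit[of k]] lift[OF g0] show ?thesis
    unfolding char_rule_def Let_def
  proof eventually_elim
    case (elim w)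
    define t where "t = fst w"
    define x where "x = snd w"
    define z where "z = x + t"
    let ?S = "\<lambda>s. - b k s (z - s) * (v k s (z - s) - v (\<not> k) s (1 - (z - s)))"
    have "(z < 1 \<longrightarrow> v k t x = g0 k z + (LINT s|lebesgue_on {0..t}. ?S s)) \<and>
        (1 < z \<longrightarrow> v k t x = v k (z - 1) 1 + (LINT s|lebesgue_on {z - 1..t}. ?S s))"
      if tx: "0 < t" "t < T" "0 < x" "x < 1"
    proof -
      have z: "0 \<le> z" "entry z \<le> t" "t \<le> z" "z - t = x" using tx by (auto simp: z_def entry_def)
      have fin: "majorant k z 0 < \<infinity>" using elim(2) z by (simp add: z_def t_def x_def)
      have [measurable]: "(\<lambda>s. v_src k s (z - s)) \<in> borel_measurable borel"
        unfolding v_src_def by measurable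
      have "AE s in lborel. s \<in> {entry z..t} \<longrightarrow>
          ?S s = v_src k s (z - s)"
        using elim(1)[folded t_def x_def, folded z_def] AE_lborel_singleton[of "entry z"]
      proof eventually_elim
        case (elim s)
        then show ?case using tx by (auto simp: v_src_def z_def entry_def)
      qed
      then have "(LINT s|lebesgue_on {entry z..t}. ?S s)
          = (LINT s:{entry z..t}|lborel. v_src k s (z - s))"
        by (intro LINT_lebesgue_on_cong) measurable
      then have main: "v k t x = v_in k z
          + (LINT s|lebesgue_on {entry z..t}. ?S s)"
        using v_char(2)[OF z(1) fin z(2,3)] z(4) by simp
      have g0: "g0 k z = f0 k z" if "z < 1"
        using elim(3) that tx by (simp add: z_def t_def x_def)
      show ?thesis
      proof (intro conjI impI)
        assume "z < 1"
        then have "entry z = 0" "v_in k z = g0 k z" using g0 by (auto simp: entry_def v_in_def)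
        then show "v k t x = g0 k z + (LINT s|lebesgue_on {0..t}. ?S s)"
          using main by simp
      next
        assume "1 < z"
        then have "entry z = z - 1" "v_in k z = v k (z - 1) 1"
          using v_trace_in[of "z - 1" k] by (auto simp: entry_def v_in_def)
        then show "v k t x = v k (z - 1) 1 + (LINT s|lebesgue_on {z - 1..t}. ?S s)"
          using main by simp
      qed
    qed
    then show ?case unfolding t_def x_def z_def by auto
  qed
qed

lemma v_broad_class: "broad_class p T (reflect k (v k))"
proof -
  have [measurable]: "v k t \<in> borel_measurable borel" for t by measurable
  have "(\<lambda>w. reflect k (v k) (fst w) (snd w)) \<in> borel2"
    unfolding reflect_def by measurable
  then have "(\<lambda>(t, x). reflect k (v k) t x) \<in> borel_measurable (lebesgue_on ({0<..<T} \<times> {0<..<1}))"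
    unfolding borel_prod split_beta' by (rule borel_imp_lebesgue_on)
  moreover have "continuous_into_Lp p {0..T} {0<..<1} (reflect k (v k))"
    using v_continuous_time[of T k] continuous_into_Lp_flip_space[OF v_continuous_time[of T k]]
    unfolding reflect_def by (cases k) auto
  moreover have "continuous_into_Lp p {0..1} {0<..<T} (\<lambda>x t. reflect k (v k) t x)"
    using v_continuous_space[of T k] continuous_into_Lp_flip_param[OF v_continuous_space[of T k]]
    unfolding reflect_def by (cases k) auto
  ultimately show ?thesis by (simp add: broad_class_def)
qed

lemma v_broad_solution:
  assumes a: "AE w in lborel. 0 < fst w \<longrightarrow> 0 < snd w \<longrightarrow> snd w < 1 \<longrightarrow> a w = 2 * al False (fst w) (snd w)"
    and \<rho>0: "AE z in lborel. 0 < z \<longrightarrow> z < 1 \<longrightarrow> \<rho>0 z = f0 False z"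
    and \<xi>0: "AE z in lborel. 0 < z \<longrightarrow> z < 1 \<longrightarrow> \<xi>0 z = f0 True (1 - z)"
  shows "broad_solution p (c True) (c False) a \<rho>0 \<xi>0 (reflect False (v False)) (reflect True (v True))"
  unfolding broad_solution_def broad_solution_upto_iff
proof (intro allI impI conjI v_broad_class)
  fix T :: real and k assume "0 < T"
  let ?b = "\<lambda>k. reflect k (\<lambda>t x. a (t, x) / 2)"
  have eq: "(\<lambda>k. reflect k (if k then reflect True (v True) else reflect False (v False))) = v"
    by (auto simp: reflect_def fun_eq_iff)
  show "char_rule T ?b (\<lambda>k z. if k then \<xi>0 (1 - z) else \<rho>0 z)
      (\<lambda>k. reflect k (if k then reflect True (v True) else reflect False (v False))) k"
    unfolding eq
  proof (rule v_char_rule)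
    show "AE w in lborel. 0 < fst w \<longrightarrow> 0 < snd w \<longrightarrow> snd w < 1 \<longrightarrow> ?b k (fst w) (snd w) = al k (fst w) (snd w)"
    proof (cases k)
      case False
      then show ?thesis using a by (simp add: reflect_def mult.commute)
    next
      case True
      have "AE w in lborel. 0 < fst w \<longrightarrow> 0 < 1 - snd w \<longrightarrow> 1 - snd w < 1 \<longrightarrow> a (fst w, 1 - snd w) = 2 * al False (fst w) (1 - snd w)"
        using AE_reflect_space[of "\<lambda>t x. 0 < t \<longrightarrow> 0 < x \<longrightarrow> x < 1 \<longrightarrow> a (t, x) = 2 * al False t x"] a by simp
      then show ?thesis
        by eventually_elim (use True al_reflect[of True] in \<open>auto simp: reflect_def\<close>)
    qed
    have "AE z in lborel. 0 < 1 - z \<longrightarrow> 1 - z < 1 \<longrightarrow> \<xi>0 (1 - z) = f0 True z"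
      using AE_real_affine[OF \<xi>0, of "-1" 1] by simp
    then show "AE z in lborel. 0 < z \<longrightarrow> z < 1 \<longrightarrow> (if k then \<xi>0 (1 - z) else \<rho>0 z) = f0 k z"
      using \<rho>0 by eventually_elim (cases k, auto)
  qed
  show "AE t in lborel. t \<in> {0<..<T} \<longrightarrow> reflect True (v True) t 0 = c True * reflect False (v False) t 0"
    using v_trace_in[of _ True] by (auto simp: reflect_def)
  show "AE t in lborel. t \<in> {0<..<T} \<longrightarrow> reflect False (v False) t 1 = c False * reflect True (v True) t 1"
    using v_trace_in[of _ False] by (auto simp: reflect_def)
qed

end

section \<open>An L1 Gronwall estimate for the transport system\<close>

lemma Lp_space_diff:
  assumes "0 < p" "f \<in> Lp_space p S" "g \<in> Lp_space p S"
  shows "(\<lambda>x. f x - g x) \<in> Lp_space p S"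
proof -
  have [measurable]: "f \<in> borel_measurable (lebesgue_on S)" "g \<in> borel_measurable (lebesgue_on S)"
    using assms by (auto simp: Lp_space_def)
  have "integrable (lebesgue_on S) (\<lambda>x. 2 powr p * (\<bar>f x\<bar> powr p + \<bar>g x\<bar> powr p))"
    using assms by (auto simp: Lp_space_def)
  then have "integrable (lebesgue_on S) (\<lambda>x. \<bar>f x - g x\<bar> powr p)"
  proof (rule Bochner_Integration.integrable_bound)
    show "AE x in lebesgue_on S. norm (\<bar>f x - g x\<bar> powr p) \<le> norm (2 powr p * (\<bar>f x\<bar> powr p + \<bar>g x\<bar> powr p))"
      using abs_add_powr_le[OF assms(1), of "f x" "- g x" for x] by (intro AE_I2) simp
  qed measurable
  then show ?thesis by (simp add: Lp_space_def)
qed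

text \<open>
Instead of the inequality of Hoelder: \<open>y \<le> \<eta> + \<eta> powr (1 - p) * y powr p\<close> for every \<open>\<eta> > 0\<close>, and
\<open>\<eta>\<close> is chosen as the norm of \<open>f\<close> in \<open>Lp\<close>.
\<close>

lemma Lp_imp_L1:
  fixes f :: "'a::euclidean_space \<Rightarrow> real"
  assumes p: "1 < p" and S: "S \<in> lmeasurable" and f: "f \<in> Lp_space p S"
  shows "integrable (lebesgue_on S) f"
    and "(LINT x|lebesgue_on S. \<bar>f x\<bar>) \<le> (measure lebesgue S + 1) * Lp_norm p S f"
proof -
  interpret finite_measure "lebesgue_on S" by (rule finite_measure_lebesgue_on[OF S])
  have S': "S \<in> sets lebesgue" using S by (rule fmeasurableD)
  have [measurable]: "f \<in> borel_measurable (lebesgue_on S)" and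
    int: "integrable (lebesgue_on S) (\<lambda>x. \<bar>f x\<bar> powr p)" using f by (auto simp: Lp_space_def)
  have pw: "y \<le> \<eta> + \<eta> powr (1 - p) * y powr p" if "0 < \<eta>" "0 \<le> y" for \<eta> y :: real
  proof (cases "y \<le> \<eta>")
    case True
    then show ?thesis using that by (simp add: add_increasing2)
  next
    case False
    have "y = y powr (1 - p) * y powr p" using False that by (simp flip: powr_add)
    also have "\<dots> \<le> \<eta> powr (1 - p) * y powr p"
      using False that p by (intro mult_right_mono powr_mono2') auto
    finally show ?thesis using that by linarith
  qed
  have dom: "integrable (lebesgue_on S) (\<lambda>x. \<eta> + \<eta> powr (1 - p) * \<bar>f x\<bar> powr p)" for \<eta>
    using int by simp
  show int_f: "integrable (lebesgue_on S) f"
    by (rule Bochner_Integration.integrable_bound[OF dom[of 1]])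
       (use pw[of 1 "\<bar>f x\<bar>" for x] in \<open>auto intro!: AE_I2\<close>)
  let ?N = "Lp_norm p S f"
  have Np: "?N powr p = (LINT x|lebesgue_on S. \<bar>f x\<bar> powr p)"
    unfolding Lp_norm_def using p by (simp add: powr_powr integral_nonneg_AE)
  show "(LINT x|lebesgue_on S. \<bar>f x\<bar>) \<le> (measure lebesgue S + 1) * ?N"
  proof (cases "?N = 0")
    case True
    then have "(LINT x|lebesgue_on S. \<bar>f x\<bar> powr p) = 0" using Np p by simp
    then have "AE x in lebesgue_on S. \<bar>f x\<bar> powr p = 0"
      using integral_nonneg_eq_0_iff_AE[OF int] by simp
    then have "AE x in lebesgue_on S. \<bar>f x\<bar> = 0" by eventually_elim simp
    then have "(LINT x|lebesgue_on S. \<bar>f x\<bar>) = (LINT x|lebesgue_on S. 0)"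
      by (intro integral_cong_AE) auto
    then show ?thesis using True by simp
  next
    case False
    then have N: "0 < ?N" by (simp add: Lp_norm_def)
    have "(LINT x|lebesgue_on S. \<bar>f x\<bar>) \<le> (LINT x|lebesgue_on S. ?N + ?N powr (1 - p) * \<bar>f x\<bar> powr p)"
      using int_f by (intro integral_mono dom pw N) auto
    also have "\<dots> = measure lebesgue S * ?N + ?N powr (1 - p) * ?N powr p"
      using int S' by (simp add: Np measure_restrict_space)
    also have "?N powr (1 - p) * ?N powr p = ?N" using N by (simp flip: powr_add)
    finally show ?thesis by (simp add: algebra_simps)
  qed
qed

text \<open>
Uniqueness only uses this consequence of \<open>continuous_into_Lp\<close>, which is stable under differences by
the triangle inequality for integrals.
\<close>

definition L1_continuous :: "real set \<Rightarrow> real set \<Rightarrow> (real \<Rightarrow> real \<Rightarrow> real) \<Rightarrow> bool" where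
  "L1_continuous I S u \<longleftrightarrow>
     (\<forall>t\<in>I. integrable (lebesgue_on S) (u t)) \<and>
     (\<forall>t\<in>I. ((\<lambda>s. LINT x|lebesgue_on S. \<bar>u s x - u t x\<bar>) \<longlongrightarrow> 0) (at t within I))"

lemma continuous_into_Lp_imp_L1:
  assumes p: "1 < p" and S: "S \<in> lmeasurable" and u: "continuous_into_Lp p I S u"
  shows "L1_continuous I S u"
  unfolding L1_continuous_def
proof (intro conjI ballI)
  fix t assume t: "t \<in> I"
  then show "integrable (lebesgue_on S) (u t)"
    using u Lp_imp_L1(1)[OF p S] by (auto simp: continuous_into_Lp_def)
  have lim: "((\<lambda>s. (measure lebesgue S + 1) * Lp_norm p S (\<lambda>x. u s x - u t x)) \<longlongrightarrow> 0) (at t within I)"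
    using u t by (intro tendsto_mult_right_zero) (auto simp: continuous_into_Lp_def)
  have up: "\<forall>\<^sub>F s in at t within I. (LINT x|lebesgue_on S. \<bar>u s x - u t x\<bar>)
      \<le> (measure lebesgue S + 1) * Lp_norm p S (\<lambda>x. u s x - u t x)"
    unfolding eventually_at_filter
    using u t p by (intro always_eventually allI impI Lp_imp_L1(2) S Lp_space_diff) (auto simp: continuous_into_Lp_def)
  have lo: "\<forall>\<^sub>F s in at t within I. 0 \<le> (LINT x|lebesgue_on S. \<bar>u s x - u t x\<bar>)" by simp
  show "((\<lambda>s. LINT x|lebesgue_on S. \<bar>u s x - u t x\<bar>) \<longlongrightarrow> 0) (at t within I)"
    by (rule tendsto_sandwich[OF lo up tendsto_const lim])
qed

lemma L1_continuous_diff: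
  assumes u: "L1_continuous I S u" and v: "L1_continuous I S v"
  shows "L1_continuous I S (\<lambda>t x. u t x - v t x)"
  unfolding L1_continuous_def
proof (intro conjI ballI)
  fix t assume t: "t \<in> I"
  have int: "integrable (lebesgue_on S) (u s)" "integrable (lebesgue_on S) (v s)" if "s \<in> I" for s
    using u v that by (auto simp: L1_continuous_def)
  show "integrable (lebesgue_on S) (\<lambda>x. u t x - v t x)" using int[OF t] by simp
  have lim: "((\<lambda>s. (LINT x|lebesgue_on S. \<bar>u s x - u t x\<bar>) + (LINT x|lebesgue_on S. \<bar>v s x - v t x\<bar>)) \<longlongrightarrow> 0) (at t within I)"
    using u v t by (intro tendsto_add_zero) (auto simp: L1_continuous_def)
  have le: "(LINT x|lebesgue_on S. \<bar>u s x - v s x - (u t x - v t x)\<bar>)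
      \<le> (LINT x|lebesgue_on S. \<bar>u s x - u t x\<bar>) + (LINT x|lebesgue_on S. \<bar>v s x - v t x\<bar>)" if "s \<in> I" for s
  proof -
    have "(LINT x|lebesgue_on S. \<bar>u s x - v s x - (u t x - v t x)\<bar>)
        \<le> (LINT x|lebesgue_on S. \<bar>u s x - u t x\<bar> + \<bar>v s x - v t x\<bar>)"
      using int[OF t] int[OF that] by (intro integral_mono) auto
    also have "\<dots> = (LINT x|lebesgue_on S. \<bar>u s x - u t x\<bar>) + (LINT x|lebesgue_on S. \<bar>v s x - v t x\<bar>)"
      using int[OF t] int[OF that] by (intro Bochner_Integration.integral_add) auto
    finally show ?thesis .
  qed
  have up: "\<forall>\<^sub>F s in at t within I. (LINT x|lebesgue_on S. \<bar>u s x - v s x - (u t x - v t x)\<bar>)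
      \<le> (LINT x|lebesgue_on S. \<bar>u s x - u t x\<bar>) + (LINT x|lebesgue_on S. \<bar>v s x - v t x\<bar>)"
    unfolding eventually_at_filter using le by (intro always_eventually) auto
  have lo: "\<forall>\<^sub>F s in at t within I. 0 \<le> (LINT x|lebesgue_on S. \<bar>u s x - v s x - (u t x - v t x)\<bar>)" by simp
  show "((\<lambda>s. LINT x|lebesgue_on S. \<bar>u s x - v s x - (u t x - v t x)\<bar>) \<longlongrightarrow> 0) (at t within I)"
    by (rule tendsto_sandwich[OF lo up tendsto_const lim])
qed

lemma L1_continuous_bounded:
  assumes u: "L1_continuous I S u" and I: "compact I"
  obtains K where "\<And>t. t \<in> I \<Longrightarrow> (LINT x|lebesgue_on S. \<bar>u t x\<bar>) \<le> K"
proof -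
  let ?N = "\<lambda>t. LINT x|lebesgue_on S. \<bar>u t x\<bar>"
  have int: "integrable (lebesgue_on S) (u s)" if "s \<in> I" for s
    using u that by (auto simp: L1_continuous_def)
  have "continuous_on I ?N"
    unfolding continuous_on_def
  proof
    fix t assume t: "t \<in> I"
    have lim: "((\<lambda>s. LINT x|lebesgue_on S. \<bar>u s x - u t x\<bar>) \<longlongrightarrow> 0) (at t within I)"
      using u t by (auto simp: L1_continuous_def)
    have le: "\<bar>?N s - ?N t\<bar> \<le> (LINT x|lebesgue_on S. \<bar>u s x - u t x\<bar>)" if "s \<in> I" for s
    proof -
      have "?N s - ?N t = (LINT x|lebesgue_on S. \<bar>u s x\<bar> - \<bar>u t x\<bar>)"
        using int[OF t] int[OF that] by (intro Bochner_Integration.integral_diff[symmetric]) auto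
      moreover have "\<bar>LINT x|lebesgue_on S. \<bar>u s x\<bar> - \<bar>u t x\<bar>\<bar> \<le> (LINT x|lebesgue_on S. \<bar>\<bar>u s x\<bar> - \<bar>u t x\<bar>\<bar>)"
        by (rule integral_abs_bound)
      moreover have "\<dots> \<le> (LINT x|lebesgue_on S. \<bar>u s x - u t x\<bar>)"
        using int[OF t] int[OF that] by (intro integral_mono) auto
      ultimately show ?thesis by linarith
    qed
    have "((\<lambda>s. ?N s - ?N t) \<longlongrightarrow> 0) (at t within I)"
      by (rule Lim_null_comparison[OF _ lim]) (use le in \<open>auto simp: eventually_at_filter\<close>)
    then show "(?N \<longlongrightarrow> ?N t) (at t within I)" by (simp add: LIM_zero_iff)
  qed
  then have "bounded (?N ` I)" using I by (intro compact_imp_bounded compact_continuous_image)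
  then obtain K where "\<And>t. t \<in> I \<Longrightarrow> norm (?N t) \<le> K" unfolding bounded_iff by blast
  then show thesis by (intro that[of K]) (use abs_le_D1 in fastforce)
qed

lemma AE_approach:
  fixes a b t0 :: real
  assumes ae: "AE t in lborel. a < t \<longrightarrow> t < b \<longrightarrow> P t" and ab: "a < b" and t0: "t0 \<in> {a..b}"
  obtains X :: "nat \<Rightarrow> real" where "\<And>n. X n \<noteq> t0" "\<And>n. a < X n" "\<And>n. X n < b" "\<And>n. P (X n)" "X \<longlonglongrightarrow> t0"
proof -
  have "\<exists>x. x \<noteq> t0 \<and> a < x \<and> x < b \<and> P x \<and> \<bar>x - t0\<bar> < inverse (Suc n)" for n
  proof (rule ccontr)
    assume no: "\<nexists>x. x \<noteq> t0 \<and> a < x \<and> x < b \<and> P x \<and> \<bar>x - t0\<bar> < inverse (Suc n)"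
    define l where "l = max a (t0 - inverse (Suc n))"
    define r where "r = min b (t0 + inverse (Suc n))"
    have "0 < inverse (real (Suc n))" by simp
    then have lr: "l < r" using ab t0 unfolding l_def r_def atLeastAtMost_iff by linarith
    have "AE x in lborel. x \<notin> {l<..<r}"
      using ae AE_lborel_singleton[of t0]
    proof eventually_elim
      case (elim x)
      show ?case
      proof
        assume "x \<in> {l<..<r}"
        then have "a < x" "x < b" "\<bar>x - t0\<bar> < inverse (Suc n)" by (auto simp: l_def r_def)
        then show False using no elim by blast
      qed
    qed
    then have "emeasure lborel {l<..<r} = 0"
      by (subst (asm) AE_iff_measurable[where N="{l<..<r}"]) auto
    then show False using lr by simp
  qed
  then obtain X where X: "\<And>n. X n \<noteq> t0 \<and> a < X n \<and> X n < b \<and> P (X n) \<and> \<bar>X n - t0\<bar> < inverse (Suc n)" by metis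
  have "(\<lambda>n. X n - t0) \<longlonglongrightarrow> 0"
    by (rule Lim_null_comparison[OF _ LIMSEQ_inverse_real_of_nat])
       (use X in \<open>auto intro!: always_eventually less_imp_le\<close>)
  then have "X \<longlonglongrightarrow> t0" by (simp add: LIM_zero_iff)
  then show thesis using X by (intro that[of X]) auto
qed

text \<open>
Every parameter is a limit of parameters at which \<open>u\<close> vanishes, since the latter have full measure.
\<close>

lemma L1_continuous_vanish:
  assumes u: "L1_continuous {a..b} S u" and S: "S \<in> sets lebesgue" and ab: "a < b" and t0: "t0 \<in> {a..b}"
    and ae: "AE t in lborel. a < t \<longrightarrow> t < b \<longrightarrow> (AE x in lborel. x \<in> S \<longrightarrow> u t x = 0)"
  shows "AE x in lborel. x \<in> S \<longrightarrow> u t0 x = 0"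
proof -
  obtain X where X: "\<And>n. X n \<noteq> t0" "\<And>n. a < X n" "\<And>n. X n < b"
      "\<And>n. AE x in lborel. x \<in> S \<longrightarrow> u (X n) x = 0" "X \<longlonglongrightarrow> t0"
    using AE_approach[OF ae ab t0] by metis
  have int: "integrable (lebesgue_on S) (u s)" if "s \<in> {a..b}" for s
    using u that by (auto simp: L1_continuous_def)
  have Xin: "X n \<in> {a..b}" for n using X(2)[of n] X(3)[of n] by simp
  have "(\<lambda>n. LINT x|lebesgue_on S. \<bar>u (X n) x - u t0 x\<bar>) \<longlonglongrightarrow> 0"
    using u t0 X Xin unfolding L1_continuous_def tendsto_at_iff_sequentially o_def by auto
  moreover have "(LINT x|lebesgue_on S. \<bar>u (X n) x - u t0 x\<bar>) = (LINT x|lebesgue_on S. \<bar>u t0 x\<bar>)" for n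
  proof (rule integral_cong_AE)
    show "AE x in lebesgue_on S. \<bar>u (X n) x - u t0 x\<bar> = \<bar>u t0 x\<bar>"
      unfolding AE_lebesgue_on_iff[OF S] using X(4)[of n] by eventually_elim auto
  qed (use int[OF t0] int[OF Xin[of n]] in \<open>auto dest: borel_measurable_integrable\<close>)
  ultimately have "(LINT x|lebesgue_on S. \<bar>u t0 x\<bar>) = 0" by (simp add: LIMSEQ_const_iff)
  then have "AE x in lebesgue_on S. \<bar>u t0 x\<bar> = 0"
    using int[OF t0] by (subst (asm) integral_nonneg_eq_0_iff_AE) auto
  then show ?thesis by (simp add: AE_lebesgue_on_iff[OF S])
qed

text \<open>
\<open>\<delta>\<close> stands for the modulus of a difference of solutions, \<open>\<theta>\<close> for its trace at \<open>x = 0\<close>, and \<open>D\<close>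
for the bound that the characteristic rules give. With the weight \<open>w\<close> the energy identity for \<open>D\<close>
produces \<open>2 * lam + 1\<close> times the mass, of which the source takes at most \<open>2 * lam\<close>; the outflow exceeds
the inflow by the factor \<open>1 - \<kappa>\<close>. Finite mass must therefore vanish.
\<close>

lemma transport_gronwall:
  fixes \<delta> :: "bool \<Rightarrow> real \<Rightarrow> real \<Rightarrow> ennreal" and \<theta> :: "bool \<Rightarrow> real \<Rightarrow> ennreal" and lam \<kappa> T :: real
  defines "D \<equiv> \<lambda>k. transport (\<lambda>z. if z < 1 then 0 else ennreal \<kappa> * \<theta> (\<not> k) (z - 1))
      (\<lambda>t x. ennreal lam * (\<delta> k t x + \<delta> (\<not> k) t (1 - x)))"
  defines "w \<equiv> \<lambda>t. exp (- ((2 * lam + 1) * t))"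
  assumes [measurable]: "\<And>k. case_prod (\<delta> k) \<in> borel2" "\<And>k. \<theta> k \<in> borel_measurable borel"
    and lam: "0 \<le> lam" and \<kappa>: "0 \<le> \<kappa>" "\<kappa> < 1" and T: "0 \<le> T"
    and inside: "\<And>k. AE z in lborel. in_strip T (fst z) (snd z) \<longrightarrow> \<delta> k (fst z) (snd z) \<le> D k (fst z) (snd z)"
    and trace: "\<And>k. (\<integral>\<^sup>+t\<in>{0..T}. ennreal (w t) * \<theta> k t \<partial>lborel) \<le> (\<integral>\<^sup>+t\<in>{0..T}. ennreal (w t) * D k t 0 \<partial>lborel)"
    and fin_\<theta>: "\<And>k. (\<integral>\<^sup>+t\<in>{0..T}. \<theta> k t \<partial>lborel) < \<infinity>"
    and fin_\<delta>: "\<And>k. (\<integral>\<^sup>+t\<in>{0..T}. (\<integral>\<^sup>+x\<in>{0..1}. \<delta> k t x \<partial>lborel) \<partial>lborel) < \<infinity>"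
  shows "(\<integral>\<^sup>+t\<in>{0..T}. (\<integral>\<^sup>+x\<in>{0..1}. \<delta> k t x \<partial>lborel) \<partial>lborel) = 0"
proof -
  let ?\<mu> = "2 * lam + 1"
  let ?g = "\<lambda>k z. if z < 1 then 0 else ennreal \<kappa> * \<theta> (\<not> k) (z - 1)"
  let ?h = "\<lambda>k t x. ennreal lam * (\<delta> k t x + \<delta> (\<not> k) t (1 - x))"
  have mh [measurable]: "case_prod (?h k) \<in> borel2" for k
    unfolding split_beta' by measurable
  have mg [measurable]: "?g k \<in> borel_measurable borel" for k by measurable
  have mD [measurable]: "case_prod (D k) \<in> borel2" for k
    unfolding D_def by (intro transport_measurable mh mg)
  have [measurable]: "w \<in> borel_measurable borel" unfolding w_def by measurable
  have w1: "0 < w t" "0 \<le> t \<Longrightarrow> w t \<le> 1" for t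
    using lam by (auto simp: w_def)
  have w_deriv: "(w has_real_derivative - (?\<mu> * w t)) (at t)" for t
    unfolding w_def by (auto intro!: derivative_eq_intros simp: algebra_simps)
  define B where "B = (\<Sum>k\<in>UNIV. \<integral>\<^sup>+t\<in>{0..T}. ennreal (w t) * \<theta> k t \<partial>lborel)"
  define J where "J = (\<Sum>k\<in>UNIV. \<integral>\<^sup>+t\<in>{0..T}. ennreal (w t) * D k t 0 \<partial>lborel)"
  define E where "E k = (\<integral>\<^sup>+t\<in>{0..T}. (\<integral>\<^sup>+x\<in>{0..1}. ennreal (w t) * \<delta> k t x \<partial>lborel) \<partial>lborel)" for k
  define E\<^sub>D where "E\<^sub>D k = (\<integral>\<^sup>+t\<in>{0..T}. (\<integral>\<^sup>+x\<in>{0..1}. ennreal (w t) * D k t x \<partial>lborel) \<partial>lborel)" for k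
  have energy: "(\<integral>\<^sup>+t\<in>{0..T}. ennreal (w t) * D k t 0 \<partial>lborel) + ennreal ?\<mu> * E\<^sub>D k
     \<le> ennreal \<kappa> * (\<integral>\<^sup>+t\<in>{0..T}. ennreal (w t) * \<theta> (\<not> k) t \<partial>lborel) + ennreal lam * (E k + E (\<not> k))" for k
  proof -
    have balance: "(\<integral>\<^sup>+t\<in>{0..T}. ennreal (w t) * D k t 0 \<partial>lborel)
       + (\<integral>\<^sup>+x\<in>{0..1}. ennreal (w T) * D k T x \<partial>lborel)
       + (\<integral>\<^sup>+t\<in>{0..T}. (\<integral>\<^sup>+x\<in>{0..1}. ennreal (?\<mu> * w t) * D k t x \<partial>lborel) \<partial>lborel)
     = (\<integral>\<^sup>+x\<in>{0..1}. ennreal (w 0) * ?g k x \<partial>lborel)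
       + (\<integral>\<^sup>+t\<in>{0..T}. ennreal (w t) * ?g k (t + 1) \<partial>lborel)
       + (\<integral>\<^sup>+t\<in>{0..T}. (\<integral>\<^sup>+x\<in>{0..1}. ennreal (w t) * ?h k t x \<partial>lborel) \<partial>lborel)"
      unfolding D_def
      by (rule transport_energy[where \<Phi>="\<lambda>t _. w t" and \<Psi>="\<lambda>t _. ?\<mu> * w t"])
         (use T lam w1 w_deriv in \<open>auto intro!: mg mh mult_nonneg_nonneg less_imp_le\<close>)
    have decay: "(\<integral>\<^sup>+t\<in>{0..T}. (\<integral>\<^sup>+x\<in>{0..1}. ennreal (?\<mu> * w t) * D k t x \<partial>lborel) \<partial>lborel) = ennreal ?\<mu> * E\<^sub>D k"
    proof -
      have "ennreal ?\<mu> * E\<^sub>D k = (\<integral>\<^sup>+t. ennreal ?\<mu> * ((\<integral>\<^sup>+x\<in>{0..1}. ennreal (w t) * D k t x \<partial>lborel) * indicator {0..T} t) \<partial>lborel)"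
        unfolding E\<^sub>D_def by (rule nn_integral_cmult[symmetric]) measurable
      also have "\<dots> = (\<integral>\<^sup>+t\<in>{0..T}. (\<integral>\<^sup>+x\<in>{0..1}. ennreal (?\<mu> * w t) * D k t x \<partial>lborel) \<partial>lborel)"
        using lam w1 by (intro nn_integral_cong)
          (simp add: nn_integral_cmult[symmetric] ennreal_mult' less_imp_le mult.assoc[symmetric])
      finally show ?thesis by simp
    qed
    have initial: "(\<integral>\<^sup>+x\<in>{0..1}. ennreal (w 0) * ?g k x \<partial>lborel) = 0"
    proof -
      have "(\<integral>\<^sup>+x\<in>{0..1}. ennreal (w 0) * ?g k x \<partial>lborel) = (\<integral>\<^sup>+x. 0 \<partial>(lborel::real measure))"
        using AE_lborel_singleton[of 1] by (intro nn_integral_cong_AE, eventually_elim) (auto simp: indicator_def)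
      then show ?thesis by simp
    qed
    have inflow: "(\<integral>\<^sup>+t\<in>{0..T}. ennreal (w t) * ?g k (t + 1) \<partial>lborel) = ennreal \<kappa> * (\<integral>\<^sup>+t\<in>{0..T}. ennreal (w t) * \<theta> (\<not> k) t \<partial>lborel)"
      by (subst nn_integral_cmult[symmetric]) (auto intro!: nn_integral_cong simp: indicator_def ac_simps)
    have source: "(\<integral>\<^sup>+t\<in>{0..T}. (\<integral>\<^sup>+x\<in>{0..1}. ennreal (w t) * ?h k t x \<partial>lborel) \<partial>lborel) = ennreal lam * (E k + E (\<not> k))"
    proof -
      have "(\<integral>\<^sup>+x\<in>{0..1}. ennreal (w t) * ?h k t x \<partial>lborel)
          = ennreal lam * ((\<integral>\<^sup>+x\<in>{0..1}. ennreal (w t) * \<delta> k t x \<partial>lborel) + (\<integral>\<^sup>+x\<in>{0..1}. ennreal (w t) * \<delta> (\<not> k) t x \<partial>lborel))" for t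
      proof -
        have "(\<integral>\<^sup>+x\<in>{0..1}. ennreal (w t) * \<delta> (\<not> k) t x \<partial>lborel)
            = (\<integral>\<^sup>+x. ennreal (w t) * \<delta> (\<not> k) t (1 - x) * indicator {0..1} (1 - x) \<partial>lborel)"
          by (rule nn_integral_flip[symmetric]) measurable
        also have "\<dots> = (\<integral>\<^sup>+x\<in>{0..1}. ennreal (w t) * \<delta> (\<not> k) t (1 - x) \<partial>lborel)"
          by (intro nn_integral_cong) (auto simp: indicator_def)
        finally have flip: "(\<integral>\<^sup>+x\<in>{0..1}. ennreal (w t) * \<delta> (\<not> k) t x \<partial>lborel)
            = (\<integral>\<^sup>+x\<in>{0..1}. ennreal (w t) * \<delta> (\<not> k) t (1 - x) \<partial>lborel)" .
        have "(\<integral>\<^sup>+x\<in>{0..1}. ennreal (w t) * ?h k t x \<partial>lborel)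
            = (\<integral>\<^sup>+x. ennreal lam * (ennreal (w t) * \<delta> k t x * indicator {0..1} x
                + ennreal (w t) * \<delta> (\<not> k) t (1 - x) * indicator {0..1} x) \<partial>lborel)"
          by (intro nn_integral_cong) (simp add: algebra_simps)
        also have "\<dots> = ennreal lam * (\<integral>\<^sup>+x. ennreal (w t) * \<delta> k t x * indicator {0..1} x
                + ennreal (w t) * \<delta> (\<not> k) t (1 - x) * indicator {0..1} x \<partial>lborel)"
          by (rule nn_integral_cmult) simp
        also have "(\<integral>\<^sup>+x. ennreal (w t) * \<delta> k t x * indicator {0..1} x
                + ennreal (w t) * \<delta> (\<not> k) t (1 - x) * indicator {0..1} x \<partial>lborel)
            = (\<integral>\<^sup>+x\<in>{0..1}. ennreal (w t) * \<delta> k t x \<partial>lborel)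
            + (\<integral>\<^sup>+x\<in>{0..1}. ennreal (w t) * \<delta> (\<not> k) t (1 - x) \<partial>lborel)"
          by (rule nn_integral_add) simp_all
        finally show ?thesis unfolding flip .
      qed
      then have "(\<integral>\<^sup>+t\<in>{0..T}. (\<integral>\<^sup>+x\<in>{0..1}. ennreal (w t) * ?h k t x \<partial>lborel) \<partial>lborel)
        = (\<integral>\<^sup>+t. ennreal lam * ((\<integral>\<^sup>+x\<in>{0..1}. ennreal (w t) * \<delta> k t x \<partial>lborel) * indicator {0..T} t
             + (\<integral>\<^sup>+x\<in>{0..1}. ennreal (w t) * \<delta> (\<not> k) t x \<partial>lborel) * indicator {0..T} t) \<partial>lborel)"
        by (intro nn_integral_cong) (simp add: distrib_right mult.assoc)
      also have "\<dots> = ennreal lam * (\<integral>\<^sup>+t. (\<integral>\<^sup>+x\<in>{0..1}. ennreal (w t) * \<delta> k t x \<partial>lborel) * indicator {0..T} t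
             + (\<integral>\<^sup>+x\<in>{0..1}. ennreal (w t) * \<delta> (\<not> k) t x \<partial>lborel) * indicator {0..T} t \<partial>lborel)"
        by (rule nn_integral_cmult) simp
      also have "(\<integral>\<^sup>+t. (\<integral>\<^sup>+x\<in>{0..1}. ennreal (w t) * \<delta> k t x \<partial>lborel) * indicator {0..T} t
             + (\<integral>\<^sup>+x\<in>{0..1}. ennreal (w t) * \<delta> (\<not> k) t x \<partial>lborel) * indicator {0..T} t \<partial>lborel) = E k + E (\<not> k)"
        unfolding E_def by (rule nn_integral_add) simp_all
      finally show ?thesis .
    qed
    have drop: "a + e \<le> r" if "a + d + e = r" for a d e r :: ennreal
      unfolding that[symmetric] by (intro add_mono) auto
    show ?thesis
      by (rule drop) (use balance in \<open>unfold decay initial inflow source add_0_left\<close>)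
  qed
  have BJ: "B \<le> J" unfolding B_def J_def by (intro sum_mono trace)
  have EE: "E k \<le> E\<^sub>D k" for k
  proof -
    have "AE t in lborel. AE x in lborel. in_strip T t x \<longrightarrow> \<delta> k t x \<le> D k t x"
      using AE_pair_lborel[of "\<lambda>t x. in_strip T t x \<longrightarrow> \<delta> k t x \<le> D k t x"] inside[of k] by simp
    then have "AE t in lborel. (\<integral>\<^sup>+x\<in>{0..1}. ennreal (w t) * \<delta> k t x \<partial>lborel) * indicator {0..T} t
        \<le> (\<integral>\<^sup>+x\<in>{0..1}. ennreal (w t) * D k t x \<partial>lborel) * indicator {0..T} t"
      using AE_lborel_singleton[of 0] AE_lborel_singleton[of T]
    proof eventually_elim
      case (elim t)
      show ?case
      proof (cases "0 < t \<and> t < T")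
        case True
        have "AE x in lborel. ennreal (w t) * \<delta> k t x * indicator {0..1} x \<le> ennreal (w t) * D k t x * indicator {0..1} x"
          using elim(1) AE_lborel_singleton[of 0] AE_lborel_singleton[of 1]
          by eventually_elim (use True in \<open>auto simp: indicator_def intro!: mult_left_mono\<close>)
        then show ?thesis by (intro mult_right_mono nn_integral_mono_AE) auto
      qed (use elim in \<open>auto simp: indicator_def\<close>)
    qed
    then show ?thesis unfolding E_def E\<^sub>D_def by (rule nn_integral_mono_AE)
  qed
  have E_fin: "E k < \<infinity>" for k
  proof -
    have "E k \<le> (\<integral>\<^sup>+t\<in>{0..T}. (\<integral>\<^sup>+x\<in>{0..1}. \<delta> k t x \<partial>lborel) \<partial>lborel)"
      unfolding E_def
    proof (intro nn_integral_mono)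
      fix t
      show "(\<integral>\<^sup>+x\<in>{0..1}. ennreal (w t) * \<delta> k t x \<partial>lborel) * indicator {0..T} t
          \<le> (\<integral>\<^sup>+x\<in>{0..1}. \<delta> k t x \<partial>lborel) * indicator {0..T} t"
      proof (cases "t \<in> {0..T}")
        case True
        then have "ennreal (w t) \<le> 1" using w1(2)[of t] by simp
        then have "ennreal (w t) * \<delta> k t x \<le> 1 * \<delta> k t x" for x by (intro mult_right_mono) auto
        then show ?thesis by (intro mult_right_mono nn_integral_mono) auto
      qed simp
    qed
    then show ?thesis using fin_\<delta>[of k] by (rule order.strict_trans1)
  qed
  have B_fin: "B < \<infinity>"
  proof -
    have "(\<integral>\<^sup>+t\<in>{0..T}. ennreal (w t) * \<theta> k t \<partial>lborel) < \<infinity>" for k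
    proof -
      have "(\<integral>\<^sup>+t\<in>{0..T}. ennreal (w t) * \<theta> k t \<partial>lborel) \<le> (\<integral>\<^sup>+t\<in>{0..T}. \<theta> k t \<partial>lborel)"
      proof (intro nn_integral_mono)
        fix t
        show "ennreal (w t) * \<theta> k t * indicator {0..T} t \<le> \<theta> k t * indicator {0..T} t"
        proof (cases "t \<in> {0..T}")
          case True
          then have "ennreal (w t) * \<theta> k t \<le> 1 * \<theta> k t" using w1(2)[of t] by (intro mult_right_mono) auto
          then show ?thesis by (intro mult_right_mono) auto
        qed simp
      qed
      then show ?thesis using fin_\<theta>[of k] by (rule order.strict_trans1)
    qed
    then show ?thesis by (simp add: B_def)
  qed
  let ?E = "\<Sum>k\<in>UNIV. E k"
  have "J + ennreal ?\<mu> * ?E \<le> J + ennreal ?\<mu> * (\<Sum>k\<in>UNIV. E\<^sub>D k)"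
    by (intro add_mono mult_left_mono sum_mono EE) auto
  also have "\<dots> = (\<Sum>k\<in>UNIV. (\<integral>\<^sup>+t\<in>{0..T}. ennreal (w t) * D k t 0 \<partial>lborel) + ennreal ?\<mu> * E\<^sub>D k)"
    by (simp add: J_def sum.distrib sum_distrib_left)
  also have "\<dots> \<le> (\<Sum>k\<in>UNIV. ennreal \<kappa> * (\<integral>\<^sup>+t\<in>{0..T}. ennreal (w t) * \<theta> (\<not> k) t \<partial>lborel) + ennreal lam * (E k + E (\<not> k)))"
    by (rule sum_mono) (rule energy)
  also have "\<dots> = ennreal \<kappa> * B + ennreal lam * (?E + ?E)"
    unfolding B_def sum.distrib sum_distrib_left[symmetric]
    by (simp only: sum_bool_flip[of E] sum_bool_flip[of "\<lambda>k. \<integral>\<^sup>+t\<in>{0..T}. ennreal (w t) * \<theta> k t \<partial>lborel"])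
  finally have main: "B + ennreal ?\<mu> * ?E \<le> ennreal \<kappa> * B + ennreal lam * (?E + ?E)"
    using BJ by (meson add_right_mono order_trans)
  define br where "br = enn2real B"
  define er where "er = enn2real ?E"
  have "?E < \<infinity>" using E_fin[of True] E_fin[of False] by (simp add: UNIV_bool)
  then have r: "B = ennreal br" "0 \<le> br" "?E = ennreal er" "0 \<le> er"
    using B_fin by (simp_all add: br_def er_def less_top)
  \<comment> \<open>All quantities are finite, so the inequality can be solved for the mass \<open>er\<close>.\<close>
  have "br + ?\<mu> * er \<le> \<kappa> * br + lam * (er + er)"
    using main r lam \<kappa> by (simp flip: ennreal_plus ennreal_mult)
  moreover have "\<kappa> * br \<le> br" using \<kappa> r by (simp add: mult_left_le_one_le)
  ultimately have "er = 0" using r by (simp add: algebra_simps)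
  then have "E k = 0" using r(3) by (auto simp: UNIV_bool) (metis (full_types))
  then have "AE t in lborel. (\<integral>\<^sup>+x\<in>{0..1}. ennreal (w t) * \<delta> k t x \<partial>lborel) * indicator {0..T} t = 0"
    unfolding E_def by (subst (asm) nn_integral_0_iff_AE) auto
  then have "AE t in lborel. (\<integral>\<^sup>+x\<in>{0..1}. \<delta> k t x \<partial>lborel) * indicator {0..T} t = 0"
  proof eventually_elim
    case (elim t)
    have "(\<integral>\<^sup>+x\<in>{0..1}. ennreal (w t) * \<delta> k t x \<partial>lborel) = ennreal (w t) * (\<integral>\<^sup>+x\<in>{0..1}. \<delta> k t x \<partial>lborel)"
      by (subst nn_integral_cmult[symmetric]) (auto simp: mult.assoc)
    then show ?case using elim w1(1)[of t] by simp
  qed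
  then show ?thesis by (subst nn_integral_0_iff_AE) auto
qed

section \<open>Differences of two solutions\<close>

text \<open>
If the difference is integrable, the two functions are integrable or not at the same time, and in the
second case both integrals are \<open>0\<close>. This covers lines on which the sources of the solutions are not
integrable.
\<close>

lemma set_integral_diff_le:
  fixes g g' :: "real \<Rightarrow> real" and h :: "real \<Rightarrow> ennreal"
  assumes [measurable]: "I \<in> sets borel" "g \<in> borel_measurable borel" "g' \<in> borel_measurable borel"
    and le: "AE s in lborel. s \<in> I \<longrightarrow> ennreal \<bar>g' s - g s\<bar> \<le> h s"
  shows "ennreal \<bar>(LINT s:I|lborel. g' s) - (LINT s:I|lborel. g s)\<bar> \<le> (\<integral>\<^sup>+s\<in>I. h s \<partial>lborel)"
proof (cases "(\<integral>\<^sup>+s\<in>I. h s \<partial>lborel) < \<infinity>")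
  case True
  let ?d = "\<lambda>s. indicator I s *\<^sub>R (g' s - g s)"
  have le': "(\<integral>\<^sup>+s. ennreal (norm (?d s)) \<partial>lborel) \<le> (\<integral>\<^sup>+s\<in>I. h s \<partial>lborel)"
  proof (rule nn_integral_mono_AE)
    show "AE s in lborel. ennreal (norm (?d s)) \<le> h s * indicator I s"
      using le by eventually_elim (auto simp: indicator_def)
  qed
  then have "(\<integral>\<^sup>+s. ennreal (norm (?d s)) \<partial>lborel) < \<infinity>"
    using True by (rule order.strict_trans1)
  then have d: "integrable lborel ?d" by (intro integrableI_bounded) measurable
  then have ds: "set_integrable lborel I (\<lambda>s. g' s - g s)" by (simp add: set_integrable_def)
  show ?thesis
  proof (cases "set_integrable lborel I g")
    case g: True
    have g': "set_integrable lborel I g'" using set_integral_add(1)[OF ds g] by simp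
    have "(LINT s:I|lborel. g' s) - (LINT s:I|lborel. g s) = (LINT s|lborel. ?d s)"
      using g g' by (subst set_integral_diff(2)[symmetric]) (auto simp: set_lebesgue_integral_def)
    then show ?thesis
      using integral_norm_bound_ennreal[OF d] le' by (simp add: order_trans)
  next
    case g: False
    have "\<not> set_integrable lborel I g'"
      using set_integral_diff(1)[OF _ ds, of g'] g by auto
    with g have "(LINT s:I|lborel. g' s) = 0" "(LINT s:I|lborel. g s) = 0"
      unfolding set_lebesgue_integral_def set_integrable_def by (auto intro: not_integrable_integral_eq)
    then show ?thesis by simp
  qed
next
  case False
  then show ?thesis by (simp add: not_less top_unique)
qed

text \<open>
Near \<open>x = 0\<close> the value at \<open>(t, x)\<close> is at most the exit value of the same line, reached at time \<open>t + x\<close>.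
Integrating in time costs a factor \<open>exp (\<mu> * x)\<close> and the last \<open>x\<close> units of time, both of which
disappear as \<open>x\<close> tends to \<open>0\<close>.
\<close>

lemma trace_le_outflow:
  fixes d :: "real \<Rightarrow> real \<Rightarrow> real" and \<theta> :: "real \<Rightarrow> ennreal" and \<mu> :: real
  assumes u: "L1_continuous {0..1} {0<..<T} (\<lambda>x t. d t x)"
    and [measurable]: "\<theta> \<in> borel_measurable borel" "g \<in> borel_measurable borel" "case_prod h \<in> borel2"
    and \<theta>: "AE t in lborel. 0 < t \<longrightarrow> t < T \<longrightarrow> \<theta> t = ennreal \<bar>d t 0\<bar>"
    and le: "AE x in lborel. 0 < x \<longrightarrow> x < 1 \<longrightarrow> (AE t in lborel. 0 < t \<longrightarrow> t < T \<longrightarrow> ennreal \<bar>d t x\<bar> \<le> transport g h t x)"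
    and \<mu>: "0 \<le> \<mu>"
  shows "(\<integral>\<^sup>+t\<in>{0..T}. ennreal (exp (- (\<mu> * t))) * \<theta> t \<partial>lborel)
    \<le> (\<integral>\<^sup>+t\<in>{0..T}. ennreal (exp (- (\<mu> * t))) * transport g h t 0 \<partial>lborel)"
proof -
  let ?D = "transport g h" and ?M = "lebesgue_on {0<..<T}"
  let ?w = "\<lambda>t. ennreal (exp (- (\<mu> * t)))"
  define J where "J = (\<integral>\<^sup>+t\<in>{0..T}. ?w t * ?D t 0 \<partial>lborel)"
  have [measurable]: "(\<lambda>t. ?D t 0) \<in> borel_measurable borel" by measurable
  obtain X where X: "\<And>n. X n \<noteq> 0" "\<And>n. 0 < X n" "\<And>n. X n < 1"
      "\<And>n. AE t in lborel. 0 < t \<longrightarrow> t < T \<longrightarrow> ennreal \<bar>d t (X n)\<bar> \<le> ?D t (X n)" "X \<longlonglongrightarrow> 0"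
    using AE_approach[OF le zero_less_one, of 0] by auto
  have int: "integrable ?M (\<lambda>t. d t x)" if "x \<in> {0..1}" for x
    using u that by (auto simp: L1_continuous_def)
  have meas: "(\<lambda>t. d t x) \<in> borel_measurable ?M" if "x \<in> {0..1}" for x
    using int[OF that] by (rule borel_measurable_integrable)
  have part: "(\<integral>\<^sup>+t\<in>{0..T'}. ?w t * \<theta> t \<partial>lborel) \<le> J" if T': "T' < T" for T'
  proof (cases "J < \<infinity>")
    case True
    have bound: "(\<integral>\<^sup>+t\<in>{0..T'}. ?w t * \<theta> t \<partial>lborel)
        \<le> J * ennreal (exp (\<mu> * x)) + ennreal (LINT t|?M. \<bar>d t x - d t 0\<bar>)"
      if x: "0 < x" "x < 1" "x < T - T'" and ae: "AE t in lborel. 0 < t \<longrightarrow> t < T \<longrightarrow> ennreal \<bar>d t x\<bar> \<le> ?D t x" for x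
    proof -
      have [measurable]: "(\<lambda>t. d t x) \<in> borel_measurable ?M" "(\<lambda>t. d t 0) \<in> borel_measurable ?M"
        using meas x by auto
      have mI [measurable]: "(\<lambda>t. indicator {0..T'} t * ?w t) \<in> borel_measurable ?M"
        by (rule borel_imp_lebesgue_on) measurable
      have "(\<integral>\<^sup>+t\<in>{0..T'}. ?w t * \<theta> t \<partial>lborel) = (\<integral>\<^sup>+t. ?w t * \<theta> t * indicator {0..T'} t * indicator {0<..<T} t \<partial>lborel)"
        using AE_lborel_singleton[of 0]
        by (intro nn_integral_cong_AE, eventually_elim) (use T' in \<open>auto simp: indicator_def\<close>)
      also have "\<dots> = (\<integral>\<^sup>+t. ?w t * \<theta> t * indicator {0..T'} t \<partial>?M)"
        by (rule nn_integral_lebesgue_on[symmetric]) simp_all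
      also have "\<dots> \<le> (\<integral>\<^sup>+t. (indicator {0..T'} t * ?w t) * ennreal \<bar>d t x\<bar> + ennreal \<bar>d t x - d t 0\<bar> \<partial>?M)"
      proof (rule nn_integral_mono_AE)
        have "AE t in lborel. t \<in> {0<..<T} \<longrightarrow> ?w t * \<theta> t * indicator {0..T'} t
            \<le> (indicator {0..T'} t * ?w t) * ennreal \<bar>d t x\<bar> + ennreal \<bar>d t x - d t 0\<bar>"
          using \<theta>
        proof eventually_elim
          case (elim t)
          have "exp (- (\<mu> * t)) * \<bar>d t 0\<bar> \<le> exp (- (\<mu> * t)) * \<bar>d t x\<bar> + \<bar>d t x - d t 0\<bar>" if "0 < t"
          proof -
            have "exp (- (\<mu> * t)) * \<bar>d t 0\<bar> \<le> exp (- (\<mu> * t)) * (\<bar>d t x\<bar> + \<bar>d t x - d t 0\<bar>)"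
              by (intro mult_left_mono) auto
            moreover have "exp (- (\<mu> * t)) * \<bar>d t x - d t 0\<bar> \<le> 1 * \<bar>d t x - d t 0\<bar>"
              using that \<mu> by (intro mult_right_mono) auto
            ultimately show ?thesis by (simp add: distrib_left)
          qed
          then show ?case
            using elim by (auto simp: indicator_def simp flip: ennreal_mult ennreal_plus)
        qed
        then show "AE t in ?M. ?w t * \<theta> t * indicator {0..T'} t
            \<le> (indicator {0..T'} t * ?w t) * ennreal \<bar>d t x\<bar> + ennreal \<bar>d t x - d t 0\<bar>"
          by (simp add: AE_lebesgue_on_iff)
      qed
      also have "\<dots> = (\<integral>\<^sup>+t. (indicator {0..T'} t * ?w t) * ennreal \<bar>d t x\<bar> \<partial>?M) + (\<integral>\<^sup>+t. ennreal \<bar>d t x - d t 0\<bar> \<partial>?M)"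
        by (rule nn_integral_add) measurable
      also have "(\<integral>\<^sup>+t. ennreal \<bar>d t x - d t 0\<bar> \<partial>?M) = ennreal (LINT t|?M. \<bar>d t x - d t 0\<bar>)"
        using int[of x] int[of 0] x by (intro nn_integral_eq_integral) auto
      also have "(\<integral>\<^sup>+t. (indicator {0..T'} t * ?w t) * ennreal \<bar>d t x\<bar> \<partial>?M) \<le> (\<integral>\<^sup>+t. (indicator {0..T'} t * ?w t) * ?D (x + t) 0 \<partial>?M)"
      proof (rule nn_integral_mono_AE)
        have "AE t in lborel. t \<in> {0<..<T} \<longrightarrow> (indicator {0..T'} t * ?w t) * ennreal \<bar>d t x\<bar> \<le> (indicator {0..T'} t * ?w t) * ?D (x + t) 0"
          using ae
        proof eventually_elim
          case (elim t)
          have "?D t x \<le> ?D (x + t) 0" using transport_le_exit[of t "x + t" g h] x by simp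
          then show ?case using elim by (auto intro!: mult_left_mono intro: order_trans)
        qed
        then show "AE t in ?M. (indicator {0..T'} t * ?w t) * ennreal \<bar>d t x\<bar> \<le> (indicator {0..T'} t * ?w t) * ?D (x + t) 0"
          by (simp add: AE_lebesgue_on_iff)
      qed
      also have "(\<integral>\<^sup>+t. (indicator {0..T'} t * ?w t) * ?D (x + t) 0 \<partial>?M)
          = (\<integral>\<^sup>+t. (indicator {0..T'} t * ?w t) * ?D (x + t) 0 * indicator {0<..<T} t \<partial>lborel)"
        by (rule nn_integral_lebesgue_on) simp_all
      also have "\<dots> \<le> (\<integral>\<^sup>+t. ennreal (exp (\<mu> * x)) * (?w (t + x) * ?D (t + x) 0 * indicator {0..T} (t + x)) \<partial>lborel)"
      proof (intro nn_integral_mono)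
        fix t
        have "?w t = ennreal (exp (\<mu> * x)) * ?w (t + x)"
          by (simp add: algebra_simps flip: ennreal_mult exp_add)
        then show "(indicator {0..T'} t * ?w t) * ?D (x + t) 0 * indicator {0<..<T} t
            \<le> ennreal (exp (\<mu> * x)) * (?w (t + x) * ?D (t + x) 0 * indicator {0..T} (t + x))"
          using x by (auto simp: indicator_def add.commute mult.assoc)
      qed
      also have "\<dots> = ennreal (exp (\<mu> * x)) * (\<integral>\<^sup>+t. ?w (t + x) * ?D (t + x) 0 * indicator {0..T} (t + x) \<partial>lborel)"
        by (rule nn_integral_cmult) measurable
      also have "(\<integral>\<^sup>+t. ?w (t + x) * ?D (t + x) 0 * indicator {0..T} (t + x) \<partial>lborel) = J"
        unfolding J_def by (rule nn_integral_shift[where f="\<lambda>t. ?w t * ?D t 0 * indicator {0..T} t"]) measurable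
      finally show ?thesis by (simp add: mult.commute)
    qed
    have "(\<lambda>n. LINT t|?M. \<bar>d t (X n) - d t 0\<bar>) \<longlonglongrightarrow> 0"
      using u X less_imp_le[OF X(2)] less_imp_le[OF X(3)] unfolding L1_continuous_def tendsto_at_iff_sequentially o_def by auto
    then have "(\<lambda>n. ennreal (LINT t|?M. \<bar>d t (X n) - d t 0\<bar>)) \<longlonglongrightarrow> ennreal 0"
      by (rule tendsto_ennrealI)
    moreover have "(\<lambda>n. J * ennreal (exp (\<mu> * X n))) \<longlonglongrightarrow> J * ennreal (exp (\<mu> * 0))"
      using True X(5) by (intro ennreal_tendsto_cmult tendsto_ennrealI tendsto_intros) auto
    ultimately have "(\<lambda>n. J * ennreal (exp (\<mu> * X n)) + ennreal (LINT t|?M. \<bar>d t (X n) - d t 0\<bar>)) \<longlonglongrightarrow> J * ennreal (exp (\<mu> * 0)) + ennreal 0"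
      by (intro tendsto_add)
    moreover have "\<forall>\<^sub>F n in sequentially. (\<integral>\<^sup>+t\<in>{0..T'}. ?w t * \<theta> t \<partial>lborel)
        \<le> J * ennreal (exp (\<mu> * X n)) + ennreal (LINT t|?M. \<bar>d t (X n) - d t 0\<bar>)"
      using order_tendstoD(2)[OF X(5), of "T - T'"] T'
      by (auto elim!: eventually_mono intro!: bound X)
    ultimately have "(\<integral>\<^sup>+t\<in>{0..T'}. ?w t * \<theta> t \<partial>lborel) \<le> J * ennreal (exp (\<mu> * 0)) + ennreal 0"
      by (rule tendsto_lowerbound) simp
    then show ?thesis by simp
  next
    case False
    then show ?thesis by (simp add: not_less top_unique)
  qed
  \<comment> \<open>The estimate up to every \<open>T' < T\<close> gives the one up to \<open>T\<close> by monotone convergence.\<close>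
  let ?F = "\<lambda>n t. ?w t * \<theta> t * indicator {0..T - inverse (Suc n)} t"
  have "(\<integral>\<^sup>+t\<in>{0..T}. ?w t * \<theta> t \<partial>lborel) \<le> (\<integral>\<^sup>+t. (SUP n. ?F n t) \<partial>lborel)"
  proof (rule nn_integral_mono_AE)
    show "AE t in lborel. ?w t * \<theta> t * indicator {0..T} t \<le> (SUP n. ?F n t)"
      using AE_lborel_singleton[of T]
    proof eventually_elim
      case (elim t)
      show ?case
      proof (cases "t \<in> {0..T}")
        case True
        then have "0 < T - t" using elim by auto
        then obtain n where "inverse (Suc n) < T - t" using reals_Archimedean by blast
        then have eq: "?w t * \<theta> t * indicator {0..T} t = ?F n t" using True by simp
        show ?thesis unfolding eq by (rule SUP_upper) simp
      qed simp
    qed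
  qed
  also have "\<dots> = (SUP n. \<integral>\<^sup>+t. ?F n t \<partial>lborel)"
  proof (rule nn_integral_monotone_convergence_SUP)
    show "incseq ?F"
    proof (intro incseq_SucI le_funI mult_left_mono)
      fix n t
      have "inverse (real (Suc (Suc n))) \<le> inverse (real (Suc n))" by (intro le_imp_inverse_le) auto
      then show "indicator {0..T - inverse (real (Suc n))} t \<le> (indicator {0..T - inverse (real (Suc (Suc n)))} t :: ennreal)"
        unfolding atLeastAtMost_def by (intro indicator_leI) (unfold Int_iff atLeast_iff atMost_iff, linarith)
    qed simp
  qed measurable
  also have "\<dots> \<le> J" by (intro SUP_least part) simp
  finally show ?thesis unfolding J_def .
qed

text \<open>
The data cancel, the inflow is estimated by the trace of the other component, and the sources differ by at
most \<open>lam\<close> times the sum of the differences at the point and at its mirror point.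
\<close>

lemma char_rule_difference:
  fixes b y y' bB yB yB' :: "bool \<Rightarrow> real \<Rightarrow> real \<Rightarrow> real" and \<theta> :: "bool \<Rightarrow> real \<Rightarrow> ennreal"
  defines "\<delta> \<equiv> \<lambda>k t x. ennreal \<bar>yB' k t x - yB k t x\<bar>"
  assumes rule: "char_rule T b f0 y k" and rule': "char_rule T b f0 y' k"
    and [measurable]: "\<And>k. case_prod (bB k) \<in> borel2"
      "\<And>k. case_prod (yB k) \<in> borel2" "\<And>k. case_prod (yB' k) \<in> borel2"
    and rep: "\<And>k. AE w in lborel. in_strip T (fst w) (snd w) \<longrightarrow>
        b k (fst w) (snd w) = bB k (fst w) (snd w) \<and> y k (fst w) (snd w) = yB k (fst w) (snd w) \<and> y' k (fst w) (snd w) = yB' k (fst w) (snd w)"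
    and b_le: "\<And>k t x. \<bar>bB k t x\<bar> \<le> lam"
    and inflow: "AE t in lborel. 0 < t \<longrightarrow> t < T \<longrightarrow> ennreal \<bar>y' k t 1 - y k t 1\<bar> \<le> ennreal \<kappa> * \<theta> (\<not> k) t"
  shows "AE w in lborel. in_strip T (fst w) (snd w) \<longrightarrow>
    \<delta> k (fst w) (snd w) \<le> transport (\<lambda>z. if z < 1 then 0 else ennreal \<kappa> * \<theta> (\<not> k) (z - 1))
       (\<lambda>t x. ennreal lam * (\<delta> k t x + \<delta> (\<not> k) t (1 - x))) (fst w) (snd w)"
proof -
  let ?S = "\<lambda>z s. - b k s (z - s) * (y k s (z - s) - y (\<not> k) s (1 - (z - s)))"
  let ?S' = "\<lambda>z s. - b k s (z - s) * (y' k s (z - s) - y' (\<not> k) s (1 - (z - s)))"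
  let ?B = "\<lambda>z s. - bB k s (z - s) * (yB k s (z - s) - yB (\<not> k) s (1 - (z - s)))"
  let ?B' = "\<lambda>z s. - bB k s (z - s) * (yB' k s (z - s) - yB' (\<not> k) s (1 - (z - s)))"
  let ?h = "\<lambda>t x. ennreal lam * (\<delta> k t x + \<delta> (\<not> k) t (1 - x))"
  have lift: "AE w in lborel. P (snd w + fst w)" if "AE z in lborel. P z" for P :: "real \<Rightarrow> bool"
    using AE_line_label[OF that, of 1 0] by (simp add: add.commute)
  let ?in = "\<lambda>s x. 0 < s \<and> s < T \<and> 0 < x \<and> x < (1::real)"
  have "AE z in lborel. AE s in lborel. ?in s (z - s) \<longrightarrow> b k s (z - s) = bB k s (z - s) \<and> y k s (z - s) = yB k s (z - s) \<and> y' k s (z - s) = yB' k s (z - s)"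
    using AE_slices[of "\<lambda>t x. ?in t x \<longrightarrow> b k t x = bB k t x \<and> y k t x = yB k t x \<and> y' k t x = yB' k t x" 1 0] rep[of k] by simp
  moreover have "AE z in lborel. AE s in lborel. ?in s (1 - (z - s)) \<longrightarrow> y (\<not> k) s (1 - (z - s)) = yB (\<not> k) s (1 - (z - s)) \<and> y' (\<not> k) s (1 - (z - s)) = yB' (\<not> k) s (1 - (z - s))"
  proof -
    have "AE w in lborel. ?in (fst w) (snd w) \<longrightarrow> y (\<not> k) (fst w) (snd w) = yB (\<not> k) (fst w) (snd w) \<and> y' (\<not> k) (fst w) (snd w) = yB' (\<not> k) (fst w) (snd w)"
      using rep[of "\<not> k"] by eventually_elim auto
    from AE_slices[of "\<lambda>t x. ?in t x \<longrightarrow> y (\<not> k) t x = yB (\<not> k) t x \<and> y' (\<not> k) t x = yB' (\<not> k) t x", OF this, of "-1" 1]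
    show ?thesis by (simp only: mult_minus1 add_uminus_conv_diff simp_thms)
  qed
  ultimately have "AE z in lborel. AE s in lborel. ?in s (z - s) \<longrightarrow> ?S z s = ?B z s \<and> ?S' z s = ?B' z s"
  proof eventually_elim
    case (elim z)
    from elim show ?case by eventually_elim auto
  qed
  note slices = lift[OF this]
  have "AE z in lborel. 0 < z - 1 \<longrightarrow> z - 1 < T \<longrightarrow> ennreal \<bar>y' k (z - 1) 1 - y k (z - 1) 1\<bar> \<le> ennreal \<kappa> * \<theta> (\<not> k) (z - 1)"
    using AE_real_affine[OF inflow, of 1 "-1"] by simp
  note inflow' = lift[OF this]
  from slices inflow' lift[OF AE_lborel_singleton[of 1]] rule[unfolded char_rule_def Let_def] rule'[unfolded char_rule_def Let_def] rep[of k]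
  show ?thesis
  proof eventually_elim
    case (elim w)
    define t where "t = fst w"
    define x where "x = snd w"
    define z where "z = x + t"
    show ?case
    proof
      assume "in_strip T (fst w) (snd w)"
      then have tx: "0 < t" "t < T" "0 < x" "x < 1" by (auto simp: t_def x_def)
      have ae: "AE s in lborel. ?in s (z - s) \<longrightarrow> ?S z s = ?B z s \<and> ?S' z s = ?B' z s"
        using elim(1) unfolding z_def t_def x_def .
      have meas: "(\<lambda>s. ?B z s) \<in> borel_measurable borel" "(\<lambda>s. ?B' z s) \<in> borel_measurable borel"
        by measurable
      have int: "(LINT s|lebesgue_on {entry z..t}. ?S z s) = (LINT s:{entry z..t}|lborel. ?B z s)"
          "(LINT s|lebesgue_on {entry z..t}. ?S' z s) = (LINT s:{entry z..t}|lborel. ?B' z s)"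
      proof -
        have "AE s in lborel. s \<in> {entry z..t} \<longrightarrow> ?S z s = ?B z s \<and> ?S' z s = ?B' z s"
          using ae AE_lborel_singleton[of "entry z"]
        proof eventually_elim
          case (elim s)
          then show ?case using tx by (auto simp: z_def entry_def)
        qed
        then have ae1: "AE s in lborel. s \<in> {entry z..t} \<longrightarrow> ?S z s = ?B z s"
          and ae2: "AE s in lborel. s \<in> {entry z..t} \<longrightarrow> ?S' z s = ?B' z s"
          by (eventually_elim, blast)+
        show "(LINT s|lebesgue_on {entry z..t}. ?S z s) = (LINT s:{entry z..t}|lborel. ?B z s)"
          by (rule LINT_lebesgue_on_cong[OF _ meas(1) ae1]) simp
        show "(LINT s|lebesgue_on {entry z..t}. ?S' z s) = (LINT s:{entry z..t}|lborel. ?B' z s)"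
          by (rule LINT_lebesgue_on_cong[OF _ meas(2) ae2]) simp
      qed
      \<comment> \<open>The coefficient multiplies \<open>?p - ?q\<close>, the differences of the two components at mirror points.\<close>
      have pw: "ennreal \<bar>?B' z s - ?B z s\<bar> \<le> ?h s (z - s)" for s
      proof -
        let ?p = "yB' k s (z - s) - yB k s (z - s)" and ?q = "yB' (\<not> k) s (1 - (z - s)) - yB (\<not> k) s (1 - (z - s))"
        have "?B' z s - ?B z s = - bB k s (z - s) * (?p - ?q)" by (simp add: algebra_simps)
        then have "\<bar>?B' z s - ?B z s\<bar> = \<bar>bB k s (z - s)\<bar> * \<bar>?p - ?q\<bar>" by (simp add: abs_mult)
        also have "\<dots> \<le> lam * (\<bar>?p\<bar> + \<bar>?q\<bar>)" using b_le[of k s "z - s"] by (intro mult_mono) auto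
        finally have "ennreal \<bar>?B' z s - ?B z s\<bar> \<le> ennreal (lam * (\<bar>?p\<bar> + \<bar>?q\<bar>))" by (rule ennreal_leI)
        also have "\<dots> = ?h s (z - s)"
          using order_trans[OF abs_ge_zero b_le[of k s "z - s"]] by (simp add: \<delta>_def ennreal_mult)
        finally show ?thesis .
      qed
      have diff: "ennreal \<bar>(LINT s|lebesgue_on {entry z..t}. ?S' z s) - (LINT s|lebesgue_on {entry z..t}. ?S z s)\<bar>
          \<le> (\<integral>\<^sup>+s\<in>{entry z..t}. ?h s (z - s) \<partial>lborel)"
        unfolding int by (rule set_integral_diff_le[OF _ meas]) (use pw in auto)
      have d: "\<delta> k t x = ennreal \<bar>y' k t x - y k t x\<bar>" using elim(6) tx by (simp add: \<delta>_def t_def x_def)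
      show "\<delta> k (fst w) (snd w) \<le> transport (\<lambda>z. if z < 1 then 0 else ennreal \<kappa> * \<theta> (\<not> k) (z - 1)) ?h (fst w) (snd w)"
        unfolding t_def[symmetric] x_def[symmetric] transport_def z_def[symmetric] d
      proof (cases "z < 1")
        case True
        then have "y' k t x - y k t x = (LINT s|lebesgue_on {entry z..t}. ?S' z s) - (LINT s|lebesgue_on {entry z..t}. ?S z s)"
          using elim(4,5) tx by (simp add: z_def t_def x_def entry_def)
        then show "ennreal \<bar>y' k t x - y k t x\<bar> \<le> (if z < 1 then 0 else ennreal \<kappa> * \<theta> (\<not> k) (z - 1)) + (\<integral>\<^sup>+s\<in>{entry z..t}. ?h s (z - s) \<partial>lborel)"
          using True diff by simp
      next
        case False
        then have z: "1 < z" using elim(3) by (simp add: z_def t_def x_def)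
        then have "y' k t x - y k t x = (y' k (z - 1) 1 - y k (z - 1) 1) + ((LINT s|lebesgue_on {entry z..t}. ?S' z s) - (LINT s|lebesgue_on {entry z..t}. ?S z s))"
          using elim(4,5) tx by (simp add: z_def t_def x_def entry_def)
        then have "\<bar>y' k t x - y k t x\<bar> \<le> \<bar>y' k (z - 1) 1 - y k (z - 1) 1\<bar> + \<bar>(LINT s|lebesgue_on {entry z..t}. ?S' z s) - (LINT s|lebesgue_on {entry z..t}. ?S z s)\<bar>"
          by linarith
        then have "ennreal \<bar>y' k t x - y k t x\<bar> \<le> ennreal \<bar>y' k (z - 1) 1 - y k (z - 1) 1\<bar> + ennreal \<bar>(LINT s|lebesgue_on {entry z..t}. ?S' z s) - (LINT s|lebesgue_on {entry z..t}. ?S z s)\<bar>"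
          by (simp flip: ennreal_plus)
        also have "\<dots> \<le> ennreal \<kappa> * \<theta> (\<not> k) (z - 1) + (\<integral>\<^sup>+s\<in>{entry z..t}. ?h s (z - s) \<partial>lborel)"
          using elim(2) z tx by (intro add_mono diff) (simp add: z_def t_def x_def)
        finally show "ennreal \<bar>y' k t x - y k t x\<bar> \<le> (if z < 1 then 0 else ennreal \<kappa> * \<theta> (\<not> k) (z - 1)) + (\<integral>\<^sup>+s\<in>{entry z..t}. ?h s (z - s) \<partial>lborel)"
          using False by simp
      qed
    qed
  qed
qed

section \<open>Uniqueness of broad solutions\<close>

lemma AE_pair_swap:
  fixes Q :: "real \<Rightarrow> real \<Rightarrow> bool"
  assumes "AE w in lborel. Q (fst w) (snd w)"
  shows "AE x in lborel. AE t in lborel. Q t x"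
proof -
  obtain N where N: "{w. \<not> Q (fst w) (snd w)} \<subseteq> N" "emeasure lborel N = 0" "N \<in> sets (lborel :: (real \<times> real) measure)"
    using AE_E[OF assms] by auto
  have [measurable]: "N \<in> sets (borel \<Otimes>\<^sub>M borel)" using N(3) unfolding borel_prod by simp
  have "AE w in lborel. (fst w, snd w) \<notin> N"
    using AE_not_in[of N lborel] N by (auto simp: null_sets_def)
  then have "AE t in lborel. AE x in lborel. (t, x) \<notin> N" by (rule AE_pair_lborel)
  then have "AE x in lborel. AE t in lborel. (t, x) \<notin> N"
    by (subst (asm) lborel_pair.AE_commute) measurable
  then show ?thesis
  proof eventually_elim
    case (elim x)
    then show ?case
    proof eventually_elim
      case (elim t)
      then have "(t, x) \<notin> {w. \<not> Q (fst w) (snd w)}" using N(1) by blast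
      then show ?case by simp
    qed
  qed
qed

lemma AE_reflect_eq:
  fixes u v :: "real \<Rightarrow> real \<Rightarrow> 'a"
  assumes "AE w in lborel. in_strip T (fst w) (snd w) \<longrightarrow> u (fst w) (snd w) = v (fst w) (snd w)"
  shows "AE w in lborel. in_strip T (fst w) (snd w) \<longrightarrow> reflect k u (fst w) (snd w) = reflect k v (fst w) (snd w)"
proof (cases k)
  case True
  have "AE w in lborel. 0 < fst w \<and> fst w < T \<and> 0 < 1 - snd w \<and> 1 - snd w < 1 \<longrightarrow> u (fst w) (1 - snd w) = v (fst w) (1 - snd w)"
    by (rule AE_reflect_space[of "\<lambda>t x. in_strip T t x \<longrightarrow> u t x = v t x", OF assms])
  then show ?thesis by eventually_elim (use True in \<open>auto simp: reflect_def\<close>)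
next
  case False
  with assms show ?thesis by (simp add: reflect_def)
qed

lemma AE_zero_of_double_integral:
  fixes \<delta> :: "real \<Rightarrow> real \<Rightarrow> ennreal"
  assumes [measurable]: "case_prod \<delta> \<in> borel2"
    and zero: "(\<integral>\<^sup>+t\<in>{0..T}. (\<integral>\<^sup>+x\<in>{0..1}. \<delta> t x \<partial>lborel) \<partial>lborel) = 0"
  shows "AE w in lborel. in_strip T (fst w) (snd w) \<longrightarrow> \<delta> (fst w) (snd w) = 0"
proof -
  let ?Q = "\<lambda>t x. in_strip T t x \<longrightarrow> \<delta> t x = 0"
  have "AE t in lborel. (\<integral>\<^sup>+x\<in>{0..1}. \<delta> t x \<partial>lborel) * indicator {0..T} t = 0"
    using zero by (subst (asm) nn_integral_0_iff_AE) auto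
  then have "AE t in lborel. AE x in lborel. ?Q t x"
  proof eventually_elim
    case (elim t)
    show ?case
    proof (cases "0 < t \<and> t < T")
      case True
      then have "(\<integral>\<^sup>+x\<in>{0..1}. \<delta> t x \<partial>lborel) = 0" using elim by simp
      then have "AE x in lborel. \<delta> t x * indicator {0..1} x = 0"
        by (subst (asm) nn_integral_0_iff_AE) auto
      then show ?thesis by eventually_elim auto
    qed auto
  qed
  moreover have "{w. ?Q (fst w) (snd w)} \<in> sets borel"
  proof -
    have "Measurable.pred (borel \<Otimes>\<^sub>M borel) (\<lambda>w. ?Q (fst w) (snd w))" by measurable
    then show ?thesis by (simp add: pred_def borel_prod space_pair_measure)
  qed
  ultimately show ?thesis
    using lborel_pair.AE_pair_measure[of "\<lambda>w. ?Q (fst w) (snd w)", unfolded lborel_prod] by simp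
qed

lemma strip_lmeasurable: "{0<..<T::real} \<in> lmeasurable"
  by (rule lmeasurable_open) auto

lemma broad_class_L1:
  assumes "1 < p" "broad_class p T u"
  shows "L1_continuous {0..T} {0<..<1} u" and "L1_continuous {0..1} {0<..<T} (\<lambda>x t. reflect k u t x)"
proof -
  show "L1_continuous {0..T} {0<..<1} u"
    using assms by (intro continuous_into_Lp_imp_L1[OF _ strip_lmeasurable]) (auto simp: broad_class_def)
  have "continuous_into_Lp p {0..1} {0<..<T} (\<lambda>x t. reflect k u t x)"
    using assms(2) continuous_into_Lp_flip_param[of p "{0<..<T}" "\<lambda>x t. u t x"]
    unfolding broad_class_def reflect_def by (cases k) auto
  then show "L1_continuous {0..1} {0<..<T} (\<lambda>x t. reflect k u t x)"
    using assms(1) by (intro continuous_into_Lp_imp_L1[OF _ strip_lmeasurable])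
qed

text \<open>
Equality almost everywhere in the strip extends to every time and to every point, including the
endpoints, by continuity.
\<close>

lemma broad_eqI:
  assumes p: "1 < p" and cls: "\<And>T. 0 < T \<Longrightarrow> broad_class p T u" "\<And>T. 0 < T \<Longrightarrow> broad_class p T v"
    and eq: "\<And>T. 0 < T \<Longrightarrow> AE w in lborel. in_strip T (fst w) (snd w) \<longrightarrow> u (fst w) (snd w) = v (fst w) (snd w)"
  shows "broad_eq u v"
  unfolding broad_eq_def
proof (intro conjI allI impI ballI)
  fix t :: real assume t: "0 \<le> t"
  have T: "0 < t + 1" using t by simp
  have "AE x in lborel. x \<in> {0<..<1} \<longrightarrow> u t x - v t x = 0"
  proof (rule L1_continuous_vanish[where a=0 and b="t + 1" and u="\<lambda>t x. u t x - v t x"])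
    show "L1_continuous {0..t + 1} {0<..<1} (\<lambda>t x. u t x - v t x)"
      by (intro L1_continuous_diff broad_class_L1(1)[OF p] cls T)
    have "AE s in lborel. AE x in lborel. 0 < s \<and> s < t + 1 \<and> 0 < x \<and> x < 1 \<longrightarrow> u s x = v s x"
      by (rule AE_pair_lborel[OF eq[OF T]])
    then show "AE s in lborel. 0 < s \<longrightarrow> s < t + 1 \<longrightarrow> (AE x in lborel. x \<in> {0<..<1} \<longrightarrow> u s x - v s x = 0)"
    proof eventually_elim
      case (elim s)
      show ?case using elim by (auto elim!: eventually_mono)
    qed
  qed (use t in auto)
  then show "AE x in lebesgue_on {0<..<1}. u t x = v t x" by (simp add: AE_lebesgue_on_iff)
next
  fix x :: real assume x: "x \<in> {0..1}"
  have "AE t in lborel. t \<in> {0<..<real (Suc n)} \<longrightarrow> u t x - v t x = 0" for n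
  proof (rule L1_continuous_vanish[where a=0 and b=1 and u="\<lambda>x t. u t x - v t x", OF _ _ _ x])
    have T: "0 < real (Suc n)" by simp
    show "L1_continuous {0..1} {0<..<real (Suc n)} (\<lambda>x t. u t x - v t x)"
      using broad_class_L1(2)[OF p cls(1)[OF T], of False] broad_class_L1(2)[OF p cls(2)[OF T], of False]
      by (intro L1_continuous_diff) (simp_all add: reflect_def)
    have "AE x in lborel. AE t in lborel. 0 < t \<and> t < real (Suc n) \<and> 0 < x \<and> x < 1 \<longrightarrow> u t x = v t x"
      by (rule AE_pair_swap[OF eq[OF T]])
    then show "AE x in lborel. 0 < x \<longrightarrow> x < 1 \<longrightarrow> (AE t in lborel. t \<in> {0<..<real (Suc n)} \<longrightarrow> u t x - v t x = 0)"
    proof eventually_elim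
      case (elim x)
      show ?case using elim by (auto elim!: eventually_mono)
    qed
  qed auto
  then have "AE t in lborel. \<forall>n. t \<in> {0<..<real (Suc n)} \<longrightarrow> u t x - v t x = 0"
    unfolding AE_all_countable by blast
  then have "AE t in lborel. t \<in> {0<..} \<longrightarrow> u t x = v t x"
  proof eventually_elim
    case (elim t)
    obtain n where "t < real n" using reals_Archimedean2 by blast
    then have "t < real (Suc n)" by simp
    then show ?case using elim[rule_format, of n] by auto
  qed
  then show "AE t in lebesgue_on {0<..}. u t x = v t x" by (simp add: AE_lebesgue_on_iff)
qed

text \<open>
A continuous curve in \<open>L1\<close> is bounded on a compact interval of time.
\<close>

lemma double_integral_diff_finite:
  assumes p: "1 < p" and cls: "broad_class p T u" "broad_class p T u'"
    and [measurable]: "case_prod uB \<in> borel2" "case_prod uB' \<in> borel2"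
    and rep: "AE w in lborel. in_strip T (fst w) (snd w) \<longrightarrow>
       u (fst w) (snd w) = uB (fst w) (snd w) \<and> u' (fst w) (snd w) = uB' (fst w) (snd w)"
  shows "(\<integral>\<^sup>+t\<in>{0..T}. (\<integral>\<^sup>+x\<in>{0..1}. ennreal \<bar>reflect k uB' t x - reflect k uB t x\<bar> \<partial>lborel) \<partial>lborel) < \<infinity>"
proof -
  have L1: "L1_continuous {0..T} {0<..<1} (\<lambda>t x. u' t x - u t x)"
    by (intro L1_continuous_diff broad_class_L1(1)[OF p] cls)
  obtain K where K: "\<And>t. t \<in> {0..T} \<Longrightarrow> (LINT x|lebesgue_on {0<..<1}. \<bar>u' t x - u t x\<bar>) \<le> K"
    using L1_continuous_bounded[OF L1 compact_Icc] by blast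
  have flip: "(\<integral>\<^sup>+x\<in>{0..1}. ennreal \<bar>reflect k uB' t x - reflect k uB t x\<bar> \<partial>lborel) = (\<integral>\<^sup>+x\<in>{0..1}. ennreal \<bar>uB' t x - uB t x\<bar> \<partial>lborel)" for t
  proof (cases k)
    case True
    have "(\<integral>\<^sup>+x\<in>{0..1}. ennreal \<bar>uB' t x - uB t x\<bar> \<partial>lborel)
        = (\<integral>\<^sup>+x. ennreal \<bar>uB' t (1 - x) - uB t (1 - x)\<bar> * indicator {0..1} (1 - x) \<partial>lborel)"
      by (rule nn_integral_flip[symmetric]) measurable
    also have "\<dots> = (\<integral>\<^sup>+x\<in>{0..1}. ennreal \<bar>uB' t (1 - x) - uB t (1 - x)\<bar> \<partial>lborel)"
      by (intro nn_integral_cong) (auto simp: indicator_def)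
    finally show ?thesis using True by (simp add: reflect_def)
  qed (simp add: reflect_def)
  have "AE t in lborel. AE x in lborel. in_strip T t x \<longrightarrow> u t x = uB t x \<and> u' t x = uB' t x"
    by (rule AE_pair_lborel[of "\<lambda>t x. in_strip T t x \<longrightarrow> u t x = uB t x \<and> u' t x = uB' t x", OF rep])
  then have "AE t in lborel. (\<integral>\<^sup>+x\<in>{0..1}. ennreal \<bar>uB' t x - uB t x\<bar> \<partial>lborel) * indicator {0..T} t \<le> ennreal K * indicator {0..T} t"
    using AE_lborel_singleton[of 0] AE_lborel_singleton[of T]
  proof eventually_elim
    case (elim t)
    show ?case
    proof (cases "0 < t \<and> t < T")
      case True
      have eq: "AE x in lborel. x \<in> {0<..<1} \<longrightarrow> u' t x - u t x = uB' t x - uB t x"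
        using elim(1) by eventually_elim (use True in auto)
      have "(\<integral>\<^sup>+x\<in>{0..1}. ennreal \<bar>uB' t x - uB t x\<bar> \<partial>lborel) = (\<integral>\<^sup>+x. ennreal \<bar>uB' t x - uB t x\<bar> * indicator {0<..<1} x \<partial>lborel)"
        using AE_lborel_singleton[of 0] AE_lborel_singleton[of 1]
        by (intro nn_integral_cong_AE, eventually_elim) (auto simp: indicator_def)
      also have "\<dots> = (\<integral>\<^sup>+x. ennreal \<bar>uB' t x - uB t x\<bar> \<partial>lebesgue_on {0<..<1})"
        by (rule nn_integral_lebesgue_on[symmetric]) simp_all
      also have "\<dots> = (\<integral>\<^sup>+x. ennreal \<bar>u' t x - u t x\<bar> \<partial>lebesgue_on {0<..<1})"
      proof (rule nn_integral_cong_AE)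
        show "AE x in lebesgue_on {0<..<1}. ennreal \<bar>uB' t x - uB t x\<bar> = ennreal \<bar>u' t x - u t x\<bar>"
          unfolding AE_lebesgue_on_iff[OF fmeasurableD[OF strip_lmeasurable]]
          using eq by eventually_elim simp
      qed
      also have "\<dots> = ennreal (LINT x|lebesgue_on {0<..<1}. \<bar>u' t x - u t x\<bar>)"
        using L1 True by (intro nn_integral_eq_integral) (auto simp: L1_continuous_def)
      also have "\<dots> \<le> ennreal K" using K[of t] True by (intro ennreal_leI) auto
      finally show ?thesis using True by simp
    qed (use elim in \<open>auto simp: indicator_def\<close>)
  qed
  then have "(\<integral>\<^sup>+t\<in>{0..T}. (\<integral>\<^sup>+x\<in>{0..1}. ennreal \<bar>uB' t x - uB t x\<bar> \<partial>lborel) \<partial>lborel) \<le> (\<integral>\<^sup>+t. ennreal K * indicator {0..T} t \<partial>lborel)"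
    by (rule nn_integral_mono_AE)
  also have "\<dots> < \<infinity>"
    by (simp add: nn_integral_cmult_indicator ennreal_mult_less_top emeasure_lborel_Icc_eq)
  finally show ?thesis unfolding flip .
qed

lemma broad_solution_upto_unique:
  assumes p: "1 < p" and c: "\<bar>c0\<bar> \<le> \<kappa>" "\<bar>c1\<bar> \<le> \<kappa>" "\<kappa> < 1" and T: "0 < T" and lam: "0 \<le> lam"
    and aB [measurable]: "aB \<in> borel_measurable borel" and aB_le: "\<And>z. \<bar>aB z\<bar> \<le> 2 * lam"
    and a: "AE w in lborel. in_strip T (fst w) (snd w) \<longrightarrow> a w = aB w"
    and sol: "broad_solution_upto p c0 c1 a \<rho>0 \<xi>0 T \<rho> \<xi>" and sol': "broad_solution_upto p c0 c1 a \<rho>0 \<xi>0 T \<rho>' \<xi>'"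
  shows "AE w in lborel. in_strip T (fst w) (snd w) \<longrightarrow>
     (if k then \<xi>' else \<rho>') (fst w) (snd w) = (if k then \<xi> else \<rho>) (fst w) (snd w)"
proof -
  let ?in = "\<lambda>w::real \<times> real. in_strip T (fst w) (snd w)"
  define u where "u k = (if k then \<xi> else \<rho>)" for k
  define u' where "u' k = (if k then \<xi>' else \<rho>')" for k
  define y where "y k = reflect k (u k)" for k
  define y' where "y' k = reflect k (u' k)" for k
  define b where "b k = reflect k (\<lambda>t x. a (t, x) / 2)" for k
  let ?f0 = "\<lambda>k z. if k then \<xi>0 (1 - z) else \<rho>0 z"
  have cls: "broad_class p T (u k)" "broad_class p T (u' k)" for k
    using sol sol' by (auto simp: broad_solution_upto_iff u_def u'_def)
  have rules: "char_rule T b ?f0 y k" "char_rule T b ?f0 y' k" for k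
    using sol sol' unfolding broad_solution_upto_iff b_def y_def y'_def u_def u'_def by blast+
  have ex_rep: "\<exists>uB. case_prod uB \<in> borel2 \<and>
      (AE w in lborel. ?in w \<longrightarrow> u (fst w) (snd w) = uB (fst w) (snd w))"
    if "broad_class p T u" for u
  proof -
    have m: "(\<lambda>(t, x). u t x) \<in> borel_measurable (lebesgue_on ({0<..<T} \<times> {0<..<1}))"
      using that by (simp add: broad_class_def)
    have S: "{0<..<T} \<times> {0<..<1::real} \<in> sets borel" by (simp add: borel_prod[symmetric])
    obtain g where g: "g \<in> borel_measurable borel" "AE w in lborel. w \<in> {0<..<T} \<times> {0<..<1} \<longrightarrow> (\<lambda>(t, x). u t x) w = g w"
      using ex_borel_representative[OF S m] by metis
    show ?thesis
    proof (intro exI conjI)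
      show "case_prod (\<lambda>t x. g (t, x)) \<in> borel2"
        using g(1) by (simp add: borel_prod split_beta')
      show "AE w in lborel. ?in w \<longrightarrow> u (fst w) (snd w) = g (fst w, snd w)"
        using g(2) by eventually_elim (auto simp: split_beta' mem_Times_iff)
    qed
  qed
  have "\<forall>k. \<exists>uB. case_prod uB \<in> borel2 \<and>
      (AE w in lborel. ?in w \<longrightarrow> u k (fst w) (snd w) = uB (fst w) (snd w))"
    by (intro allI ex_rep cls)
  from choice[OF this] obtain uB where uB_rep: "\<forall>k. case_prod (uB k) \<in> borel2 \<and>
      (AE w in lborel. ?in w \<longrightarrow> u k (fst w) (snd w) = uB k (fst w) (snd w))" ..
  then have uB [measurable]: "case_prod (uB k) \<in> borel2"
    and uB_eq: "AE w in lborel. ?in w \<longrightarrow> u k (fst w) (snd w) = uB k (fst w) (snd w)" for k by blast+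
  have "\<forall>k. \<exists>uB. case_prod uB \<in> borel2 \<and>
      (AE w in lborel. ?in w \<longrightarrow> u' k (fst w) (snd w) = uB (fst w) (snd w))"
    by (intro allI ex_rep cls)
  from choice[OF this] obtain uB' where uB'_rep: "\<forall>k. case_prod (uB' k) \<in> borel2 \<and>
      (AE w in lborel. ?in w \<longrightarrow> u' k (fst w) (snd w) = uB' k (fst w) (snd w))" ..
  then have uB' [measurable]: "case_prod (uB' k) \<in> borel2"
    and uB'_eq: "AE w in lborel. ?in w \<longrightarrow> u' k (fst w) (snd w) = uB' k (fst w) (snd w)" for k by blast+
  define yB where "yB k = reflect k (uB k)" for k
  define yB' where "yB' k = reflect k (uB' k)" for k
  define bB where "bB k = reflect k (\<lambda>t x. aB (t, x) / 2)" for k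
  have meas [measurable]: "case_prod (yB k) \<in> borel2" "case_prod (yB' k) \<in> borel2"
      "case_prod (bB k) \<in> borel2" for k
  proof -
    have [measurable]: "aB \<in> borel2" using aB unfolding borel_prod .
    show "case_prod (yB k) \<in> borel2" "case_prod (yB' k) \<in> borel2"
      "case_prod (bB k) \<in> borel2"
      unfolding yB_def yB'_def bB_def reflect_def split_beta' by measurable
  qed
  have rep: "AE w in lborel. ?in w \<longrightarrow> b k (fst w) (snd w) = bB k (fst w) (snd w) \<and>
      y k (fst w) (snd w) = yB k (fst w) (snd w) \<and> y' k (fst w) (snd w) = yB' k (fst w) (snd w)" for k
  proof -
    have "AE w in lborel. ?in w \<longrightarrow> a (fst w, snd w) / 2 = aB (fst w, snd w) / 2"
      using a by eventually_elim simp
    from AE_reflect_eq[of T "\<lambda>t x. a (t, x) / 2" "\<lambda>t x. aB (t, x) / 2", OF this, of k]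
      AE_reflect_eq[OF uB_eq[of k], of k] AE_reflect_eq[OF uB'_eq[of k], of k]
    show ?thesis unfolding b_def bB_def y_def yB_def y'_def yB'_def by eventually_elim blast
  qed
  let ?d = "\<lambda>k t x. y' k t x - y k t x"
  have L1: "L1_continuous {0..1} {0<..<T} (\<lambda>x t. ?d k t x)" for k
    unfolding y_def y'_def by (intro L1_continuous_diff broad_class_L1(2)[OF p] cls)
  have "\<forall>k. \<exists>g. g \<in> borel_measurable borel \<and> (AE t in lborel. t \<in> {0<..<T} \<longrightarrow> ?d k t 0 = g t)"
  proof
    fix k
    have m: "(\<lambda>t. ?d k t 0) \<in> borel_measurable (lebesgue_on {0<..<T})"
      using L1[of k] by (auto simp: L1_continuous_def intro: borel_measurable_integrable)
    obtain g where "g \<in> borel_measurable borel" "AE t in lborel. t \<in> {0<..<T} \<longrightarrow> ?d k t 0 = g t"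
      by (rule ex_borel_representative[OF _ m]) auto
    then show "\<exists>g. g \<in> borel_measurable borel \<and> (AE t in lborel. t \<in> {0<..<T} \<longrightarrow> ?d k t 0 = g t)" by blast
  qed
  from choice[OF this] obtain g where g_rep: "\<forall>k. g k \<in> borel_measurable borel \<and> (AE t in lborel. t \<in> {0<..<T} \<longrightarrow> ?d k t 0 = g k t)" ..
  then have g [measurable]: "g k \<in> borel_measurable borel"
    and g_eq: "AE t in lborel. t \<in> {0<..<T} \<longrightarrow> ?d k t 0 = g k t" for k by blast+
  define \<theta> where "\<theta> k t = ennreal \<bar>g k t\<bar>" for k t
  have \<theta> [measurable]: "\<theta> k \<in> borel_measurable borel" for k unfolding \<theta>_def by measurable
  have \<theta>_eq: "AE t in lborel. 0 < t \<longrightarrow> t < T \<longrightarrow> \<theta> k t = ennreal \<bar>?d k t 0\<bar>" for k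
    using g_eq[of k] by eventually_elim (simp add: \<theta>_def)
  have S: "{0<..<T} \<in> sets lebesgue" by simp
  have \<theta>_fin: "(\<integral>\<^sup>+t\<in>{0..T}. \<theta> k t \<partial>lborel) < \<infinity>" for k
  proof -
    have "(\<integral>\<^sup>+t\<in>{0..T}. \<theta> k t \<partial>lborel) = (\<integral>\<^sup>+t. \<theta> k t * indicator {0<..<T} t \<partial>lborel)"
      using AE_lborel_singleton[of 0] AE_lborel_singleton[of T]
      by (intro nn_integral_cong_AE, eventually_elim) (auto simp: indicator_def)
    also have "\<dots> = (\<integral>\<^sup>+t. \<theta> k t \<partial>lebesgue_on {0<..<T})"
      by (rule nn_integral_lebesgue_on[symmetric]) simp_all
    also have "\<dots> = (\<integral>\<^sup>+t. ennreal (norm (?d k t 0)) \<partial>lebesgue_on {0<..<T})"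
      using \<theta>_eq[of k] by (intro nn_integral_cong_AE) (auto simp: AE_lebesgue_on_iff elim!: eventually_mono)
    also have "\<dots> < \<infinity>"
      using L1[of k] by (auto simp: L1_continuous_def integrable_iff_bounded)
    finally show ?thesis .
  qed
  have inflow: "AE t in lborel. 0 < t \<longrightarrow> t < T \<longrightarrow> ennreal \<bar>?d k t 1\<bar> \<le> ennreal \<kappa> * \<theta> (\<not> k) t" for k
  proof -
    have bc: "AE t in lborel. t \<in> {0<..<T} \<longrightarrow> ?d k t 1 = (if k then c0 else c1) * ?d (\<not> k) t 0"
    proof -
      have "AE t in lborel. t \<in> {0<..<T} \<longrightarrow> \<xi> t 0 = c0 * \<rho> t 0" "AE t in lborel. t \<in> {0<..<T} \<longrightarrow> \<rho> t 1 = c1 * \<xi> t 1"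
        "AE t in lborel. t \<in> {0<..<T} \<longrightarrow> \<xi>' t 0 = c0 * \<rho>' t 0" "AE t in lborel. t \<in> {0<..<T} \<longrightarrow> \<rho>' t 1 = c1 * \<xi>' t 1"
        using sol sol' by (auto simp: broad_solution_upto_iff)
      then show ?thesis
        by eventually_elim (cases k, auto simp: y_def y'_def u_def u'_def reflect_def algebra_simps)
    qed
    from bc \<theta>_eq[of "\<not> k"] show ?thesis
    proof eventually_elim
      case (elim t)
      show ?case
      proof (intro impI)
        assume t: "0 < t" "t < T"
        have "\<bar>?d k t 1\<bar> \<le> \<kappa> * \<bar>?d (\<not> k) t 0\<bar>"
          using elim(1) t c by (auto simp: abs_mult intro!: mult_right_mono)
        then have "ennreal \<bar>?d k t 1\<bar> \<le> ennreal (\<kappa> * \<bar>?d (\<not> k) t 0\<bar>)" by (rule ennreal_leI)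
        also have "\<dots> = ennreal \<kappa> * \<theta> (\<not> k) t"
          using elim(2) t c by (simp add: ennreal_mult')
        finally show "ennreal \<bar>?d k t 1\<bar> \<le> ennreal \<kappa> * \<theta> (\<not> k) t" .
      qed
    qed
  qed
  define \<delta> where "\<delta> k t x = ennreal \<bar>yB' k t x - yB k t x\<bar>" for k t x
  have \<delta> [measurable]: "case_prod (\<delta> k) \<in> borel2" for k
    unfolding \<delta>_def split_beta' by measurable
  let ?g = "\<lambda>k z. if z < 1 then 0 else ennreal \<kappa> * \<theta> (\<not> k) (z - 1)"
  let ?h = "\<lambda>k t x. ennreal lam * (\<delta> k t x + \<delta> (\<not> k) t (1 - x))"
  have inside: "AE w in lborel. ?in w \<longrightarrow> \<delta> k (fst w) (snd w) \<le> transport (?g k) (?h k) (fst w) (snd w)" for k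
    unfolding \<delta>_def
  proof (rule char_rule_difference[OF rules])
    show "\<bar>bB k t x\<bar> \<le> lam" for k t x
      using aB_le[of "(t, if k then 1 - x else x)"] by (simp add: bB_def reflect_def)
  qed (rule meas rep inflow)+
  have "(\<integral>\<^sup>+t\<in>{0..T}. (\<integral>\<^sup>+x\<in>{0..1}. \<delta> k t x \<partial>lborel) \<partial>lborel) = 0"
  proof (rule transport_gronwall[where lam=lam and \<kappa>=\<kappa> and \<theta>=\<theta>])
    show "0 \<le> \<kappa>" using c(1) by linarith
    show "(\<integral>\<^sup>+t\<in>{0..T}. ennreal (exp (- ((2 * lam + 1) * t))) * \<theta> k t \<partial>lborel)
        \<le> (\<integral>\<^sup>+t\<in>{0..T}. ennreal (exp (- ((2 * lam + 1) * t))) * transport (?g k) (?h k) t 0 \<partial>lborel)" for k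
    proof (rule trace_le_outflow[OF L1[of k] _ _ _ \<theta>_eq])
      have "AE w in lborel. ?in w \<longrightarrow> ennreal \<bar>?d k (fst w) (snd w)\<bar> \<le> transport (?g k) (?h k) (fst w) (snd w)"
        using inside[of k] rep[of k] by eventually_elim (auto simp: \<delta>_def)
      from AE_pair_swap[of "\<lambda>t x. in_strip T t x \<longrightarrow> ennreal \<bar>?d k t x\<bar> \<le> transport (?g k) (?h k) t x", OF this]
      show "AE x in lborel. 0 < x \<longrightarrow> x < 1 \<longrightarrow> (AE t in lborel. 0 < t \<longrightarrow> t < T \<longrightarrow> ennreal \<bar>?d k t x\<bar> \<le> transport (?g k) (?h k) t x)"
      proof eventually_elim
        case (elim x)
        show ?case
        proof (intro impI)
          assume "0 < x" "x < 1"
          with elim show "AE t in lborel. 0 < t \<longrightarrow> t < T \<longrightarrow> ennreal \<bar>?d k t x\<bar> \<le> transport (?g k) (?h k) t x"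
            by (auto elim!: eventually_mono)
        qed
      qed
      show "case_prod (?h k) \<in> borel2" unfolding split_beta' by measurable
    qed (use lam in auto)
    show "(\<integral>\<^sup>+t\<in>{0..T}. (\<integral>\<^sup>+x\<in>{0..1}. \<delta> k t x \<partial>lborel) \<partial>lborel) < \<infinity>" for k
      unfolding \<delta>_def yB_def yB'_def
    proof (rule double_integral_diff_finite[OF p cls])
      show "AE w in lborel. ?in w \<longrightarrow> u k (fst w) (snd w) = uB k (fst w) (snd w) \<and> u' k (fst w) (snd w) = uB' k (fst w) (snd w)"
        using uB_eq[of k] uB'_eq[of k] by eventually_elim blast
    qed measurable
  qed (use lam c T inside \<theta>_fin in auto)
  then have "AE w in lborel. ?in w \<longrightarrow> \<delta> k (fst w) (snd w) = 0"
    by (intro AE_zero_of_double_integral) measurable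
  then have "AE w in lborel. ?in w \<longrightarrow> y' k (fst w) (snd w) = y k (fst w) (snd w)"
    using rep[of k] by eventually_elim (auto simp: \<delta>_def)
  from AE_reflect_eq[OF this, of k]
  have "AE w in lborel. ?in w \<longrightarrow> u' k (fst w) (snd w) = u k (fst w) (snd w)"
    by (cases k) (simp_all add: y_def y'_def reflect_def)
  then show ?thesis by (simp add: u_def u'_def)
qed

section \<open>The decay estimate\<close>

definition p_energy :: "real \<Rightarrow> (real \<Rightarrow> real) \<Rightarrow> ennreal" where
  "p_energy p f = (\<integral>\<^sup>+x. ennreal (\<bar>f x\<bar> powr p) \<partial>lebesgue_on {0<..<1})"

lemma Lp_norm_pair_eq:
  assumes "f \<in> Lp_space p {0<..<1}" "g \<in> Lp_space p {0<..<1}"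
  shows "Lp_norm_pair p {0<..<1} f g = enn2real (p_energy p f + p_energy p g) powr (1 / p)"
proof -
  have [measurable]: "f \<in> borel_measurable (lebesgue_on {0<..<1})" "g \<in> borel_measurable (lebesgue_on {0<..<1})"
    using assms by (auto simp: Lp_space_def)
  have "(LINT x|lebesgue_on {0<..<1}. \<bar>f x\<bar> powr p + \<bar>g x\<bar> powr p)
      = enn2real (\<integral>\<^sup>+x. ennreal (\<bar>f x\<bar> powr p + \<bar>g x\<bar> powr p) \<partial>lebesgue_on {0<..<1})"
    by (rule integral_eq_nn_integral) auto
  also have "(\<integral>\<^sup>+x. ennreal (\<bar>f x\<bar> powr p + \<bar>g x\<bar> powr p) \<partial>lebesgue_on {0<..<1})
      = (\<integral>\<^sup>+x. ennreal (\<bar>f x\<bar> powr p) + ennreal (\<bar>g x\<bar> powr p) \<partial>lebesgue_on {0<..<1})"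
    by (intro nn_integral_cong) (simp add: ennreal_plus)
  also have "\<dots> = p_energy p f + p_energy p g"
    unfolding p_energy_def by (rule nn_integral_add) measurable
  finally show ?thesis unfolding Lp_norm_pair_def by simp
qed

text \<open>
Both conventions meet here: the norms are taken on \<open>{0<..<1}\<close> with Lebesgue measurable functions, the
estimates on \<open>{0..1}\<close> with Borel functions in reflected variables.
\<close>

lemma p_energy_reflect:
  assumes [measurable]: "g \<in> borel_measurable borel"
    and eq: "AE x in lborel. 0 < x \<longrightarrow> x < 1 \<longrightarrow> f x = g (if k then 1 - x else x)"
  shows "p_energy p f = (\<integral>\<^sup>+x\<in>{0..1}. ennreal (\<bar>g x\<bar> powr p) \<partial>lborel)"
proof -
  let ?r = "\<lambda>x. if k then 1 - x else x :: real"
  have "p_energy p f = (\<integral>\<^sup>+x. ennreal (\<bar>g (?r x)\<bar> powr p) \<partial>lebesgue_on {0<..<1})"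
    unfolding p_energy_def
    by (intro nn_integral_cong_AE) (use eq in \<open>auto simp: AE_lebesgue_on_iff elim!: eventually_mono\<close>)
  also have "\<dots> = (\<integral>\<^sup>+x. ennreal (\<bar>g (?r x)\<bar> powr p) * indicator {0<..<1} x \<partial>lborel)"
    by (rule nn_integral_lebesgue_on) simp_all
  also have "\<dots> = (\<integral>\<^sup>+x. ennreal (\<bar>g (?r x)\<bar> powr p) * indicator {0..1} (?r x) \<partial>lborel)"
    using AE_lborel_singleton[of 0] AE_lborel_singleton[of 1]
    by (intro nn_integral_cong_AE, eventually_elim) (auto simp: indicator_def)
  also have "\<dots> = (\<integral>\<^sup>+x\<in>{0..1}. ennreal (\<bar>g x\<bar> powr p) \<partial>lborel)"
    using nn_integral_flip[of "\<lambda>x. ennreal (\<bar>g x\<bar> powr p) * indicator {0..1} x" 1] by (cases k) simp_all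
  finally show ?thesis .
qed

lemma p_energy_finite: "f \<in> Lp_space p {0<..<1} \<Longrightarrow> p_energy p f < \<infinity>"
  by (auto simp: Lp_space_def p_energy_def integrable_iff_bounded)

text \<open>
Clipping makes the bounds hold at every point, so that only the equality with \<open>a\<close> involves null sets.
\<close>

lemma ex_clipped_representative:
  assumes a: "a \<in> Linf_space ({0<..} \<times> {0<..<1})" and nn: "AE z in lebesgue_on ({0<..} \<times> {0<..<1}). 0 \<le> a z"
    and A: "Linf_norm ({0<..} \<times> {0<..<1}) a = ereal A" and L: "0 \<le> L" "A \<le> L"
  obtains aB :: "real \<times> real \<Rightarrow> real" where "aB \<in> borel_measurable borel" "\<And>z. 0 \<le> aB z" "\<And>z. aB z \<le> L"
    "AE z in lborel. z \<in> {0<..} \<times> {0<..<1} \<longrightarrow> a z = aB z"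
proof -
  let ?S = "{0<..} \<times> {0<..<1::real} :: (real \<times> real) set"
  have S [measurable]: "?S \<in> sets borel" by (simp add: borel_prod[symmetric])
  have S': "?S \<in> sets lebesgue" using S by simp
  have "a \<in> borel_measurable (lebesgue_on ?S)" using a by (simp add: Linf_space_def)
  then obtain g where g [measurable]: "g \<in> borel_measurable borel" and eq: "AE z in lborel. z \<in> ?S \<longrightarrow> a z = g z"
    by (rule ex_borel_representative[OF S]) auto
  have "AE z in lebesgue_on ?S. ereal \<bar>a z\<bar> \<le> ereal A"
    using esssup_AE[of "\<lambda>z. ereal \<bar>a z\<bar>" "lebesgue_on ?S"] A by (simp add: Linf_norm_def)
  then have le: "AE z in lborel. z \<in> ?S \<longrightarrow> \<bar>a z\<bar> \<le> A" by (simp add: AE_lebesgue_on_iff[OF S'])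
  have nn': "AE z in lborel. z \<in> ?S \<longrightarrow> 0 \<le> a z" using nn by (simp add: AE_lebesgue_on_iff[OF S'])
  show thesis
  proof (rule that[of "\<lambda>z. max 0 (min L (g z))"])
    show "AE z in lborel. z \<in> ?S \<longrightarrow> a z = max 0 (min L (g z))"
      using eq le nn' by eventually_elim (use L in auto)
  qed (use L in auto)
qed

theorem theorem6p2:
  fixes p c0 c1 A :: real
  assumes "1 < p" and "c0 \<in> {-1<..<1}" and "c1 \<in> {-1<..<1}"
  shows "\<exists>C>0. \<exists>\<gamma>>0.
    \<forall>a \<in> Linf_space ({0<..} \<times> {0<..<1}).
      (AE z in lebesgue_on ({0<..} \<times> {0<..<1}). 0 \<le> a z) \<longrightarrow>
      Linf_norm ({0<..} \<times> {0<..<1}) a = ereal A \<longrightarrow>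
      (\<forall>\<rho>0 \<in> Lp_space p {0<..<1}. \<forall>\<xi>0 \<in> Lp_space p {0<..<1}.
        \<exists>\<rho> \<xi>. broad_solution p c0 c1 a \<rho>0 \<xi>0 \<rho> \<xi> \<and>
          (\<forall>\<rho>' \<xi>'. broad_solution p c0 c1 a \<rho>0 \<xi>0 \<rho>' \<xi>' \<longrightarrow> broad_eq \<rho>' \<rho> \<and> broad_eq \<xi>' \<xi>) \<and>
          (\<forall>t\<ge>0. Lp_norm_pair p {0<..<1} (\<rho> t) (\<xi> t)
                    \<le> C * exp (- \<gamma> * t) * Lp_norm_pair p {0<..<1} \<rho>0 \<xi>0))"
proof -
  note p = \<open>1 < p\<close>
  \<comment> \<open>The value \<open>1 / 4\<close> only serves to keep \<open>q\<close> away from \<open>0\<close> when both coefficients vanish.\<close>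
  define m where "m = max (1 / 4) (max \<bar>c0\<bar> \<bar>c1\<bar>)"
  define q where "q = sqrt m"
  \<comment> \<open>At least half the bound of \<open>a\<close>, and positive also for \<open>A = 0\<close>.\<close>
  define lam where "lam = (max A 0 + 1) / 2"
  have m: "0 < m" "m < 1" "\<bar>c0\<bar> \<le> m" "\<bar>c1\<bar> \<le> m" using assms by (auto simp: m_def)
  then have q: "0 < q" "q < 1" "q\<^sup>2 = m" by (auto simp: q_def)
  have lam: "0 < lam" "A \<le> 2 * lam" by (auto simp: lam_def)
  obtain eps :: real and w w' :: "bool \<Rightarrow> real \<Rightarrow> real" where "0 < eps"
    and weights: "\<And>k x. (w k has_real_derivative w' k x) (at x)"
    "\<And>k. w' k \<in> borel_measurable borel"
    "\<And>k x. 0 \<le> x \<Longrightarrow> x \<le> 1 \<Longrightarrow> q \<le> w k x"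
    "\<And>k x. 0 \<le> x \<Longrightarrow> x \<le> 1 \<Longrightarrow> w k x \<le> 1"
    "\<And>k x. 0 \<le> x \<Longrightarrow> x \<le> 1 \<Longrightarrow> eps * w k x \<le> w' k x"
    "\<And>k x. 0 \<le> x \<Longrightarrow> x \<le> 1 \<Longrightarrow> lam * w (\<not> k) (1 - x) \<le> (lam - eps) * w k x + w' k x"
    "\<And>k. q * w k 1 \<le> w (\<not> k) 0"
    using ex_weights[OF lam(1) q(1,2)] by blast
  let ?S = "{0<..} \<times> {0<..<1::real} :: (real \<times> real) set"
  have main: "\<exists>\<rho> \<xi>. broad_solution p c0 c1 a \<rho>0 \<xi>0 \<rho> \<xi> \<and>
      (\<forall>\<rho>' \<xi>'. broad_solution p c0 c1 a \<rho>0 \<xi>0 \<rho>' \<xi>' \<longrightarrow> broad_eq \<rho>' \<rho> \<and> broad_eq \<xi>' \<xi>) \<and>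
      (\<forall>t\<ge>0. Lp_norm_pair p {0<..<1} (\<rho> t) (\<xi> t)
         \<le> (1 / q) powr (1 / p) * exp (- (eps / p) * t) * Lp_norm_pair p {0<..<1} \<rho>0 \<xi>0)"
    if a: "a \<in> Linf_space ?S" "AE z in lebesgue_on ?S. 0 \<le> a z" "Linf_norm ?S a = ereal A"
      and data: "\<rho>0 \<in> Lp_space p {0<..<1}" "\<xi>0 \<in> Lp_space p {0<..<1}" for a \<rho>0 \<xi>0
  proof -
    obtain aB where aB [measurable]: "aB \<in> borel_measurable borel" and aB_bounds: "\<And>z. 0 \<le> aB z" "\<And>z. aB z \<le> 2 * lam"
      and aB_eq: "AE z in lborel. z \<in> ?S \<longrightarrow> a z = aB z"
      by (rule ex_clipped_representative[OF a, of "2 * lam"]) (use lam in auto)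
    have aB_pair: "aB \<in> borel2" using aB unfolding borel_prod .
    have aB_eq': "AE w in lborel. 0 < fst w \<longrightarrow> 0 < snd w \<longrightarrow> snd w < 1 \<longrightarrow> a w = aB w"
      using aB_eq by eventually_elim (auto simp: mem_Times_iff)
    define al where "al k = reflect k (\<lambda>t x. aB (t, x) / 2)" for k
    obtain r where r [measurable]: "r \<in> borel_measurable borel" and r_eq: "AE x in lborel. x \<in> {0<..<1} \<longrightarrow> \<rho>0 x = r x"
      by (rule ex_borel_representative[of "{0<..<1}" \<rho>0]) (use data in \<open>auto simp: Lp_space_def\<close>)
    obtain e where e [measurable]: "e \<in> borel_measurable borel" and e_eq: "AE x in lborel. x \<in> {0<..<1} \<longrightarrow> \<xi>0 x = e x"
      by (rule ex_borel_representative[of "{0<..<1}" \<xi>0]) (use data in \<open>auto simp: Lp_space_def\<close>)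
    define f0 where "f0 k = (if k then (\<lambda>x. e (1 - x)) else r)" for k
    define c where "c k = (if k then c0 else c1)" for k
    have f0_meas: "f0 k \<in> borel_measurable borel" for k by (cases k) (simp_all add: f0_def)
    have E0: "p_energy p \<rho>0 = (\<integral>\<^sup>+x\<in>{0..1}. ennreal (\<bar>f0 False x\<bar> powr p) \<partial>lborel)"
      using r_eq by (intro p_energy_reflect[where k=False] f0_meas) (auto simp: f0_def elim!: eventually_mono)
    have E1: "p_energy p \<xi>0 = (\<integral>\<^sup>+x\<in>{0..1}. ennreal (\<bar>f0 True x\<bar> powr p) \<partial>lborel)"
      using e_eq by (intro p_energy_reflect[where k=True] f0_meas) (auto simp: f0_def elim!: eventually_mono)
    interpret initial_data lam al q eps w w' c f0 p
    proof
      show "case_prod (al k) \<in> borel2" for k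
        using aB_pair unfolding al_def reflect_def split_beta' by measurable
      show "0 \<le> al k t x" "al k t x \<le> lam" for k t x
        using aB_bounds[of "(t, if k then 1 - x else x)"] by (simp_all add: al_def reflect_def)
      show "al (\<not> k) t (1 - x) = al k t x" for k t x by (simp add: al_def reflect_def)
      show "\<bar>c k\<bar> \<le> q\<^sup>2" for k using m by (simp add: c_def q)
      show "(\<integral>\<^sup>+x\<in>{0..1}. ennreal (\<bar>f0 k x\<bar> powr p) \<partial>lborel) < \<infinity>" for k
        using p_energy_finite[OF data(1)] p_energy_finite[OF data(2)] E0 E1 by (cases k) simp_all
    qed (use lam q \<open>0 < eps\<close> weights p f0_meas in auto)
    let ?\<rho> = "reflect False (v False)" and ?\<xi> = "reflect True (v True)"
    have sol: "broad_solution p c0 c1 a \<rho>0 \<xi>0 ?\<rho> ?\<xi>"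
    proof -
      have "broad_solution p (c True) (c False) a \<rho>0 \<xi>0 ?\<rho> ?\<xi>"
      proof (rule v_broad_solution)
        show "AE w in lborel. 0 < fst w \<longrightarrow> 0 < snd w \<longrightarrow> snd w < 1 \<longrightarrow> a w = 2 * al False (fst w) (snd w)"
          using aB_eq' by eventually_elim (simp add: al_def reflect_def)
        show "AE z in lborel. 0 < z \<longrightarrow> z < 1 \<longrightarrow> \<rho>0 z = f0 False z"
          using r_eq by eventually_elim (simp add: f0_def)
        show "AE z in lborel. 0 < z \<longrightarrow> z < 1 \<longrightarrow> \<xi>0 z = f0 True (1 - z)"
          using e_eq by eventually_elim (simp add: f0_def)
      qed
      then show ?thesis by (simp add: c_def)
    qed
    have unique: "broad_eq \<rho>' ?\<rho> \<and> broad_eq \<xi>' ?\<xi>" if sol': "broad_solution p c0 c1 a \<rho>0 \<xi>0 \<rho>' \<xi>'" for \<rho>' \<xi>'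
    proof -
      have "AE w in lborel. in_strip T (fst w) (snd w) \<longrightarrow>
          (if k then \<xi>' else \<rho>') (fst w) (snd w) = (if k then ?\<xi> else ?\<rho>) (fst w) (snd w)" if T: "0 < T" for T k
      proof (rule broad_solution_upto_unique[OF p m(3,4,2) T less_imp_le[OF lam(1)] aB])
        show "\<bar>aB z\<bar> \<le> 2 * lam" for z using aB_bounds[of z] by simp
        show "AE w in lborel. in_strip T (fst w) (snd w) \<longrightarrow> a w = aB w"
          using aB_eq' by eventually_elim simp
        show "broad_solution_upto p c0 c1 a \<rho>0 \<xi>0 T ?\<rho> ?\<xi>" "broad_solution_upto p c0 c1 a \<rho>0 \<xi>0 T \<rho>' \<xi>'"
          using sol sol' T by (simp_all add: broad_solution_def)
      qed
      note eq = this[of _ False, simplified] this[of _ True, simplified]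
      have cls: "broad_class p T \<rho>' \<and> broad_class p T \<xi>'" if "0 < T" for T
        using sol' that by (simp add: broad_solution_def broad_solution_upto_def)
      show ?thesis using broad_eqI[OF p _ v_broad_class eq(1)] broad_eqI[OF p _ v_broad_class eq(2)] cls by blast
    qed
    have decay: "Lp_norm_pair p {0<..<1} (?\<rho> t) (?\<xi> t)
        \<le> (1 / q) powr (1 / p) * exp (- (eps / p) * t) * Lp_norm_pair p {0<..<1} \<rho>0 \<xi>0" if t: "0 \<le> t" for t
    proof -
      have [measurable]: "v k t \<in> borel_measurable borel" for k by measurable
      have Et: "p_energy p (reflect k (v k) t) = (\<integral>\<^sup>+x\<in>{0..1}. ennreal (\<bar>v k t x\<bar> powr p) \<partial>lborel)" for k
        by (rule p_energy_reflect[where k=k]) (simp_all add: reflect_def)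
      have cls: "broad_class p (t + 1) (reflect k (v k))" for k by (rule v_broad_class)
      have Lp: "reflect k (v k) t \<in> Lp_space p {0<..<1}" for k
        using cls[of k] t by (auto simp: broad_class_def continuous_into_Lp_def)
      let ?E = "p_energy p \<rho>0 + p_energy p \<xi>0"
      have fin: "?E < \<infinity>" using p_energy_finite[OF data(1)] p_energy_finite[OF data(2)] by simp
      have "p_energy p (?\<rho> t) + p_energy p (?\<xi> t) \<le> ennreal (exp (- eps * t) / q) * ?E"
        using v_decay[OF t] unfolding Et E0 E1 by (simp add: UNIV_bool add.commute)
      then have "enn2real (p_energy p (?\<rho> t) + p_energy p (?\<xi> t)) \<le> enn2real (ennreal (exp (- eps * t) / q) * ?E)"
        using fin by (intro enn2real_mono) (simp_all add: ennreal_mult_less_top)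
      also have "\<dots> = (1 / q) * exp (- eps * t) * enn2real ?E"
        using q by (simp add: enn2real_mult)
      finally have "enn2real (p_energy p (?\<rho> t) + p_energy p (?\<xi> t)) powr (1 / p) \<le> ((1 / q) * exp (- eps * t) * enn2real ?E) powr (1 / p)"
        using p by (intro powr_mono2) auto
      also have "\<dots> = (1 / q) powr (1 / p) * exp (- eps * t) powr (1 / p) * enn2real ?E powr (1 / p)"
        by (simp only: powr_mult)
      also have "exp (- eps * t) powr (1 / p) = exp (- (eps / p) * t)"
        by (simp add: powr_def)
      finally show ?thesis
        unfolding Lp_norm_pair_eq[OF Lp Lp] Lp_norm_pair_eq[OF data] .
    qed
    show ?thesis using sol unique decay by blast
  qed
  show ?thesis
    by (rule exI[of _ "(1 / q) powr (1 / p)"], rule conjI, use q in simp,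
        rule exI[of _ "eps / p"], rule conjI, use \<open>0 < eps\<close> p in simp)
       (use main in blast)
qed

end
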